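(* Let $n\ge 2$, $s\in(0,1)$, let $\omega\subset\mathbb{R}^{n-1}$ be a bounded domain, and let $Q=\omega\times\mathbb{R}=\{x=(x',z)\colon x'\in\omega,\ z\in\mathbb{R}\}$. Then the spectrum of the restricted Dirichlet fractional Laplacian $\mathcal{A}_s^Q$ coincides with its essential spectrum and equals the ray $[\Lambda_s,+\infty)$: $$\sigma(\mathcal{A}_s^Q)=\sigma_{ess}(\mathcal{A}_s^Q)=[\Lambda_s,+\infty),$$ where $\Lambda_s$ is the smallest eigenvalue of $\mathcal{A}_s^\omega$.
   Context: For $d\ge1$, an open set $\Omega\subset\mathbb{R}^d$ and $s\in(0,1)$, the restricted Dirichlet fractional Laplacian $\mathcal{A}_s^\Omega$ is the self-adjoint operator in $L_2(\Omega)$ associated with the closed quadratic form $a_s^\Omega[u]=\int_{\mathbb{R}^d}|\xi|^{2s}|\mathcal{F}_d u(\xi)|^2\,d\xi$ on the domain $\widetilde{H}^s(\Omega)=\{u\in H^s(\mathbb{R}^d)\colon \operatorname{supp}u\subset\overline{\Omega}\}$, where $\mathcal{F}_d u(\xi)=(2\pi)^{-d/2}\int_{\mathbb{R}^d}e^{-i\xi\cdot x}u(x)\,dx$ and $H^s(\mathbb{R}^d)=\{u\in L_2(\mathbb{R}^d)\colon |\xi|^s\mathcal{F}_du\in L_2(\mathbb{R}^d)\}$. For bounded $\omega\subset\mathbb{R}^{n-1}$, the spectrum of $\mathcal{A}_s^\omega$ is purely discrete, and $\Lambda_s>0$ denotes its smallest eigenvalue. *)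

theory Defs
  imports "HOL-Analysis.Analysis"
begin

text \<open>Functions on a Euclidean space 'b (of dimension d = DIM('b)) with values in complex numbers.
  Elements of L2 are represented by measurable, square-integrable functions; all identities
  between them are understood almost everywhere.\<close>

definition L2 :: "('b::euclidean_space \<Rightarrow> complex) set" where
  "L2 = {u. u \<in> borel_measurable lborel \<and> integrable lborel (\<lambda>x. (cmod (u x))\<^sup>2)}"

definition L2_inner :: "('b::euclidean_space \<Rightarrow> complex) \<Rightarrow> ('b \<Rightarrow> complex) \<Rightarrow> complex" where
  "L2_inner u v = (\<integral>x. u x * cnj (v x) \<partial>lborel)"

definition L2_norm :: "('b::euclidean_space \<Rightarrow> complex) \<Rightarrow> real" where
  "L2_norm u = sqrt (\<integral>x. (cmod (u x))\<^sup>2 \<partial>lborel)"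

definition fourier_L1 :: "('b::euclidean_space \<Rightarrow> complex) \<Rightarrow> 'b \<Rightarrow> complex" where
  "fourier_L1 u \<xi> = complex_of_real ((2 * pi) powr (- real DIM('b) / 2)) *
      (\<integral>x. exp (- \<i> * complex_of_real (\<xi> \<bullet> x)) * u x \<partial>lborel)"

definition is_fourier_L2 :: "('b::euclidean_space \<Rightarrow> complex) \<Rightarrow> ('b \<Rightarrow> complex) \<Rightarrow> bool" where
  "is_fourier_L2 u g \<longleftrightarrow> g \<in> L2 \<and>
     (\<lambda>R::nat. \<integral>\<xi>. (cmod (fourier_L1 (\<lambda>x. indicator (ball 0 (real R)) x * u x) \<xi> - g \<xi>))\<^sup>2 \<partial>lborel)
       \<longlonglongrightarrow> 0"

definition FT :: "('b::euclidean_space \<Rightarrow> complex) \<Rightarrow> 'b \<Rightarrow> complex" where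
  "FT u = (SOME g. is_fourier_L2 u g)"

definition Hs :: "real \<Rightarrow> ('b::euclidean_space \<Rightarrow> complex) set" where
  "Hs s = {u \<in> L2. \<exists>g. is_fourier_L2 u g \<and> (\<lambda>\<xi>. complex_of_real (norm \<xi> powr s) * g \<xi>) \<in> L2}"

definition frac_form :: "real \<Rightarrow> ('b::euclidean_space \<Rightarrow> complex) \<Rightarrow> ('b \<Rightarrow> complex) \<Rightarrow> complex" where
  "frac_form s u v = (\<integral>\<xi>. complex_of_real (norm \<xi> powr (2 * s)) * FT u \<xi> * cnj (FT v \<xi>) \<partial>lborel)"

definition Ht :: "real \<Rightarrow> 'b::euclidean_space set \<Rightarrow> ('b \<Rightarrow> complex) set" where
  "Ht s \<Omega> = {u \<in> Hs s. AE x in lborel. x \<notin> closure \<Omega> \<longrightarrow> u x = 0}"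

definition L2_on :: "'b::euclidean_space set \<Rightarrow> ('b \<Rightarrow> complex) set" where
  "L2_on \<Omega> = {u \<in> L2. AE x in lborel. x \<notin> \<Omega> \<longrightarrow> u x = 0}"

text \<open>The operator associated with the closed form (Kato's representation theorem),
  as a relation: frac_op s Omega u f means u is in the operator domain and A u = f.\<close>
definition frac_op :: "real \<Rightarrow> 'b::euclidean_space set \<Rightarrow> ('b \<Rightarrow> complex) \<Rightarrow> ('b \<Rightarrow> complex) \<Rightarrow> bool" where
  "frac_op s \<Omega> u f \<longleftrightarrow> u \<in> Ht s \<Omega> \<inter> L2_on \<Omega> \<and> f \<in> L2_on \<Omega> \<and>
     (\<forall>v \<in> Ht s \<Omega> \<inter> L2_on \<Omega>. frac_form s u v = L2_inner f v)"

text \<open>Spectral notions for an operator given as a relation A on the Hilbert space H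
  (elements of H identified when equal a.e.).\<close>
definition op_resolvent_set ::
    "('b::euclidean_space \<Rightarrow> complex) set \<Rightarrow> (('b \<Rightarrow> complex) \<Rightarrow> ('b \<Rightarrow> complex) \<Rightarrow> bool) \<Rightarrow> complex set" where
  "op_resolvent_set H A = {z.
     (\<forall>f \<in> H. \<exists>u. A u (\<lambda>x. f x + z * u x)) \<and>
     (\<forall>u. A u (\<lambda>x. z * u x) \<longrightarrow> (AE x in lborel. u x = 0)) \<and>
     (\<exists>C. \<forall>u f. f \<in> H \<longrightarrow> A u (\<lambda>x. f x + z * u x) \<longrightarrow> L2_norm u \<le> C * L2_norm f)}"

definition op_spectrum ::
    "('b::euclidean_space \<Rightarrow> complex) set \<Rightarrow> (('b \<Rightarrow> complex) \<Rightarrow> ('b \<Rightarrow> complex) \<Rightarrow> bool) \<Rightarrow> complex set" where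
  "op_spectrum H A = UNIV - op_resolvent_set H A"

definition eigenspace_op ::
    "(('b::euclidean_space \<Rightarrow> complex) \<Rightarrow> ('b \<Rightarrow> complex) \<Rightarrow> bool) \<Rightarrow> complex \<Rightarrow> ('b \<Rightarrow> complex) set" where
  "eigenspace_op A z = {u. A u (\<lambda>x. z * u x)}"

definition op_eigenvalues ::
    "(('b::euclidean_space \<Rightarrow> complex) \<Rightarrow> ('b \<Rightarrow> complex) \<Rightarrow> bool) \<Rightarrow> complex set" where
  "op_eigenvalues A = {z. \<exists>u \<in> eigenspace_op A z. \<not> (AE x in lborel. u x = 0)}"

definition finite_multiplicity ::
    "(('b::euclidean_space \<Rightarrow> complex) \<Rightarrow> ('b \<Rightarrow> complex) \<Rightarrow> bool) \<Rightarrow> complex \<Rightarrow> bool" where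
  "finite_multiplicity A z \<longleftrightarrow> (\<exists>F. finite F \<and> F \<subseteq> eigenspace_op A z \<and>
     (\<forall>u \<in> eigenspace_op A z. \<exists>c. AE x in lborel. u x = (\<Sum>v\<in>F. c v * v x)))"

definition op_disc_spectrum ::
    "('b::euclidean_space \<Rightarrow> complex) set \<Rightarrow> (('b \<Rightarrow> complex) \<Rightarrow> ('b \<Rightarrow> complex) \<Rightarrow> bool) \<Rightarrow> complex set" where
  "op_disc_spectrum H A = {z \<in> op_eigenvalues A. finite_multiplicity A z \<and>
     (\<exists>e>0. \<forall>\<mu> \<in> op_spectrum H A. cmod (\<mu> - z) < e \<longrightarrow> \<mu> = z)}"

definition op_ess_spectrum ::
    "('b::euclidean_space \<Rightarrow> complex) set \<Rightarrow> (('b \<Rightarrow> complex) \<Rightarrow> ('b \<Rightarrow> complex) \<Rightarrow> bool) \<Rightarrow> complex set" where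
  "op_ess_spectrum H A = op_spectrum H A - op_disc_spectrum H A"

end

theory Submission
  imports Defs "HOL-Probability.Probability" "HOL-Complex_Analysis.Great_Picard"
begin

text \<open>
  Write \<open>|(\<xi>, \<zeta>)|\<^sup>2\<^sup>s = (|\<xi>|\<^sup>2 + \<zeta>\<^sup>2)\<^sup>s\<close>. For fixed \<open>t\<close> the form on \<open>\<omega>\<close> with symbol \<open>(|\<xi>|\<^sup>2 + t\<^sup>2)\<^sup>s\<close> attains its
  lowest Rayleigh quotient \<open>\<Lambda>(t)\<close>, because bounded sets of the form domain are precompact in \<open>L\<^sup>2\<close>; \<open>\<Lambda>(0)\<close> is the
  lowest eigenvalue, and \<open>\<Lambda>\<close> is continuous with \<open>\<Lambda>(t) \<ge> |t|\<^sup>2\<^sup>s\<close>, so it takes every value in \<open>[\<Lambda>(0), \<infinity>)\<close>.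
  A partial Fourier transform gives, for \<open>u\<close> in the form domain of the cylinder,
  \<open>\<integral> (|\<xi>|\<^sup>2 + t\<^sup>2)\<^sup>s |F u|\<^sup>2 \<ge> \<Lambda>(t) \<parallel>u\<parallel>\<^sup>2\<close>. With \<open>t = 0\<close> this bounds the form from below by \<open>\<Lambda>(0)\<close>, so the
  complement of the ray consists of resolvent points. If \<open>\<phi>\<close> is a minimiser for \<open>\<Lambda>(t)\<close>, then \<open>\<phi>(x) e\<^sup>i\<^sup>t\<^sup>z\<close> times a wide
  Gaussian in \<open>z\<close> has zero energy for the nonnegative form with symbol \<open>(|\<xi>|\<^sup>2 + t\<^sup>2)\<^sup>s - \<Lambda>(t)\<close>, hence is orthogonal to
  everything with respect to it, by the Cauchy-Schwarz inequality; what remains of the equation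
  \<open>A w = \<Lambda>(t) w\<close> is the error \<open>|\<zeta>\<^sup>2 - t\<^sup>2|\<^sup>s\<close>, which is small where \<open>F w\<close> is concentrated. So every \<open>\<Lambda>(t)\<close> is in the
  spectrum, and the spectrum, being a ray, has no isolated points.
\<close>

section \<open>Semi-inner products on function spaces\<close>

text \<open>Since |(\<xi>, \<zeta>)|^(2s) is not a sum of a function of \<xi> and one of \<zeta>,
  variables do not separate: an eigenfunction on \<omega> times a plane wave is in general no
  approximate eigenfunction, and the frequency t has to be built into the cross-section problem.
  This forces a whole family of minimisation problems, one for each point of the ray. The symbol
  (|\<xi>|^2 + t^2)^s - \<Lambda>(t) need not be nonnegative; positivity of its form is a property
  of functions with the right support. Hence semi-inner products are axiomatised on an explicit set
  of functions, and nonzero null vectors are essential. A minimiser is only known to lie in the form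
  domain, so approximate eigenfunctions are tested weakly, against every v of the form domain with
  error d |w| |v|; this already contradicts a bounded resolvent. In the other direction, the
  resolvent comes from Riesz representation for the form plus a large constant and is moved by
  Neumann series; the radius available at z0 is the distance from z0 to the ray, because the
  numerical range lies in the ray.\<close>

lemma mult_cnj_cmod: "z * cnj z = complex_of_real ((cmod z)\<^sup>2)"
  by (metis complex_norm_square)

lemma Re_half: "Re (complex_of_real (1/2) * (a + b)) = (Re a + Re b) / 2"
  unfolding times_complex.simps by simp

text \<open>First variation: along \<open>a = - t * cnj c\<close> the linear term is -2 t |c|^2
  while the quadratic term is of order t^2, so a small t makes the sum negative unless
  \<open>c = 0\<close>.\<close>

lemma quadratic_nonneg_imp_zero:
  fixes c :: complex and q :: real
  assumes q: "0 \<le> q" and *: "\<And>a. 0 \<le> 2 * Re (a * c) + (cmod a)\<^sup>2 * q"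
  shows "c = 0"
proof (rule ccontr)
  assume c: "c \<noteq> 0"
  \<comment> \<open>The summand 1 allows \<open>q = 0\<close>, and \<open>t * q < 1\<close> keeps
    the factor \<open>t * q - 2\<close> negative.\<close>
  define t where "t = 1 / (q + 1)"
  have t: "0 < t" "t * q < 1" using q by (auto simp: t_def divide_simps)
  have "0 \<le> 2 * Re (complex_of_real (- t) * cnj c * c) + (cmod (complex_of_real (-t) * cnj c))\<^sup>2 * q"
    by (rule *)
  also have "\<dots> = (cmod c)\<^sup>2 * t * (t * q - 2)"
    by (simp add: norm_mult power_mult_distrib mult_cnj_cmod mult.assoc mult.commute[of "cnj c"])
       (simp add: algebra_simps power2_eq_square)
  also have "\<dots> < 0"
    using t c by (intro mult_pos_neg mult_pos_pos) auto
  finally show False by simp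
qed

text \<open>Elements are functions and not classes, and forms may have null vectors, so
  \<open>B\<close> is only semidefinite. The set \<open>V\<close> is explicit because one and the
  same formula for \<open>B\<close> can be nonnegative on one space of functions and fail to be so
  on a larger one.\<close>

locale semi_inner =
  fixes V :: "('b \<Rightarrow> complex) set" and B :: "('b \<Rightarrow> complex) \<Rightarrow> ('b \<Rightarrow> complex) \<Rightarrow> complex"
  assumes nonempty: "V \<noteq> {}"
    and add_mem: "u \<in> V \<Longrightarrow> v \<in> V \<Longrightarrow> (\<lambda>x. u x + v x) \<in> V"
    and scale_mem: "u \<in> V \<Longrightarrow> (\<lambda>x. c * u x) \<in> V"
    and B_add: "u \<in> V \<Longrightarrow> v \<in> V \<Longrightarrow> w \<in> V \<Longrightarrow> B (\<lambda>x. u x + v x) w = B u w + B v w"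
    and B_scale: "u \<in> V \<Longrightarrow> w \<in> V \<Longrightarrow> B (\<lambda>x. c * u x) w = c * B u w"
    and B_cnj: "u \<in> V \<Longrightarrow> v \<in> V \<Longrightarrow> cnj (B u v) = B v u"
    and B_nonneg: "u \<in> V \<Longrightarrow> 0 \<le> Re (B u u)"
begin

definition nrm :: "('b \<Rightarrow> complex) \<Rightarrow> real" where "nrm u = sqrt (Re (B u u))"

lemma nrm_nonneg [simp]: "u \<in> V \<Longrightarrow> 0 \<le> nrm u"
  by (simp add: nrm_def B_nonneg)

lemma nrm_sq: "u \<in> V \<Longrightarrow> (nrm u)\<^sup>2 = Re (B u u)"
  by (simp add: nrm_def B_nonneg)

lemma B_self: "u \<in> V \<Longrightarrow> B u u = complex_of_real ((nrm u)\<^sup>2)"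
  using B_cnj[of u u] by (simp add: nrm_sq complex_eq_iff)

lemma diff_mem: "u \<in> V \<Longrightarrow> v \<in> V \<Longrightarrow> (\<lambda>x. u x - v x) \<in> V"
  using add_mem[OF _ scale_mem[of v "-1"], of u] by simp

lemma B_diff: "u \<in> V \<Longrightarrow> v \<in> V \<Longrightarrow> w \<in> V \<Longrightarrow> B (\<lambda>x. u x - v x) w = B u w - B v w"
  using B_add[OF _ scale_mem[of v "-1"], of u w] B_scale[of v w "-1"] by simp

lemma B_add_right: "u \<in> V \<Longrightarrow> v \<in> V \<Longrightarrow> w \<in> V \<Longrightarrow> B w (\<lambda>x. u x + v x) = B w u + B w v"
  using B_cnj[OF add_mem[of u v] , of w] B_cnj[of u w] B_cnj[of v w] by (simp add: B_add)

lemma B_scale_right: "u \<in> V \<Longrightarrow> w \<in> V \<Longrightarrow> B w (\<lambda>x. c * u x) = cnj c * B w u"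
  using B_cnj[OF scale_mem[of u c], of w] B_cnj[of u w] by (simp add: B_scale)

lemma B_diff_right: "u \<in> V \<Longrightarrow> v \<in> V \<Longrightarrow> w \<in> V \<Longrightarrow> B w (\<lambda>x. u x - v x) = B w u - B w v"
  using B_cnj[OF diff_mem[of u v] , of w] B_cnj[of u w] B_cnj[of v w] by (simp add: B_diff)

text \<open>The Cauchy-Schwarz inequality, the triangle inequality, the parallelogram law, the first
  variation in \<open>Riesz\<close> and the polarisation in \<open>wform_1\<close> are all read off
  from this expansion.\<close>

lemma nrm_sq_add_scale:
  assumes "u \<in> V" "v \<in> V"
  shows "(nrm (\<lambda>x. u x + c * v x))\<^sup>2 = (nrm u)\<^sup>2 + 2 * Re (c * B v u) + (cmod c)\<^sup>2 * (nrm v)\<^sup>2"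
proof -
  have "Re (cnj c * B u v) = Re (c * B v u)"
    by (simp flip: B_cnj[OF assms])
  moreover have "Re (c * (cnj c * B v v)) = (cmod c)\<^sup>2 * (nrm v)\<^sup>2"
    using B_self[OF assms(2)] by (simp add: mult.assoc[symmetric] mult_cnj_cmod)
  ultimately show ?thesis
    using assms by (simp add: nrm_sq add_mem scale_mem B_add B_scale B_add_right B_scale_right algebra_simps)
qed

lemma nrm_scale: "u \<in> V \<Longrightarrow> nrm (\<lambda>x. c * u x) = cmod c * nrm u"
proof -
  assume u: "u \<in> V"
  have "B (\<lambda>x. c * u x) (\<lambda>x. c * u x) = c * cnj c * B u u"
    using u by (simp add: B_scale B_scale_right scale_mem)
  also have "\<dots> = complex_of_real ((cmod c * nrm u)\<^sup>2)"
    using B_self[OF u] by (simp add: mult_cnj_cmod power_mult_distrib)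
  finally show ?thesis using u by (simp add: nrm_def[of "\<lambda>x. c * u x"])
qed

lemma nrm_minus: "u \<in> V \<Longrightarrow> v \<in> V \<Longrightarrow> nrm (\<lambda>x. u x - v x) = nrm (\<lambda>x. v x - u x)"
  using nrm_scale[OF diff_mem[of u v], of "-1"] by simp

text \<open>The expansion along complex multiples of \<open>u\<close> is nonnegative for every
  coefficient. The case \<open>nrm u = 0\<close> has content, since \<open>u\<close> need not
  vanish; it is the case that later turns minimisers into solutions of the eigenvalue
  equation.\<close>

lemma Cauchy_Schwarz:
  assumes u: "u \<in> V" and v: "v \<in> V"
  shows "cmod (B u v) \<le> nrm u * nrm v"
proof -
  have *: "0 \<le> (nrm v)\<^sup>2 + 2 * Re (a * B u v) + (cmod a)\<^sup>2 * (nrm u)\<^sup>2" for a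
    using nrm_sq_add_scale[OF v u, of a] by (metis zero_le_power2)
  show ?thesis
  proof (cases "nrm u = 0")
    case True
    define b where "b = B u v"
    show ?thesis
    proof (rule ccontr)
      assume "\<not> ?thesis"
      then have b: "b \<noteq> 0" using True by (auto simp: b_def)
      \<comment> \<open>With \<open>nrm u = 0\<close> the expression is affine in \<open>a\<close>,
        and this choice gives it the value \<open>- (nrm v)\<^sup>2 - 2\<close>.\<close>
      define a where "a = complex_of_real (- ((nrm v)\<^sup>2 + 1) / (cmod b)\<^sup>2) * cnj b"
      have "a * b = complex_of_real (- ((nrm v)\<^sup>2 + 1))"
        using b by (simp add: a_def mult_cnj_cmod mult.commute[of "cnj b"] mult.assoc)
      then have "Re (a * b) = - ((nrm v)\<^sup>2 + 1)" by simp
      with *[of a] True show False by (simp add: b_def) (smt (verit) zero_le_power2)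
    qed
  next
    case False
    \<comment> \<open>The minimiser of the quadratic expression in \<open>a\<close>.\<close>
    define a where "a = complex_of_real (- 1 / (nrm u)\<^sup>2) * cnj (B u v)"
    have "a * B u v = complex_of_real (- (cmod (B u v))\<^sup>2 / (nrm u)\<^sup>2)"
      by (simp add: a_def mult.assoc mult.commute[of "cnj (B u v)"] mult_cnj_cmod)
    then have 1: "Re (a * B u v) = - (cmod (B u v))\<^sup>2 / (nrm u)\<^sup>2" by simp
    have 2: "(cmod a)\<^sup>2 * (nrm u)\<^sup>2 = (cmod (B u v))\<^sup>2 / (nrm u)\<^sup>2"
      using False by (simp add: a_def norm_mult norm_divide power_mult_distrib power_divide field_simps power2_eq_square)
    have "0 \<le> (nrm v)\<^sup>2 - (cmod (B u v))\<^sup>2 / (nrm u)\<^sup>2"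
      using *[of a] 1 2 by simp
    then have "(cmod (B u v))\<^sup>2 \<le> (nrm u * nrm v)\<^sup>2"
      using False by (simp add: divide_simps power_mult_distrib mult.commute split: if_splits)
    then show ?thesis using u v by (meson mult_nonneg_nonneg nrm_nonneg power2_le_imp_le)
  qed
qed

lemma nrm_triangle:
  assumes u: "u \<in> V" and v: "v \<in> V"
  shows "nrm (\<lambda>x. u x + v x) \<le> nrm u + nrm v"
proof -
  have "(nrm (\<lambda>x. u x + v x))\<^sup>2 = (nrm u)\<^sup>2 + 2 * Re (B v u) + (nrm v)\<^sup>2"
    using nrm_sq_add_scale[OF u v, of 1] by simp
  also have "Re (B v u) \<le> nrm v * nrm u"
    using Cauchy_Schwarz[OF v u] complex_Re_le_cmod order_trans by blast
  finally have "(nrm (\<lambda>x. u x + v x))\<^sup>2 \<le> (nrm u + nrm v)\<^sup>2"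
    by (simp add: power2_sum mult.commute mult.left_commute)
  then show ?thesis using u v by (meson add_nonneg_nonneg nrm_nonneg power2_le_imp_le)
qed

lemma nrm_triangle_diff:
  assumes "u \<in> V" "v \<in> V"
  shows "nrm u \<le> nrm v + nrm (\<lambda>x. u x - v x)"
  using nrm_triangle[OF assms(2) diff_mem[OF assms]] by simp

lemma abs_nrm_diff:
  assumes "u \<in> V" "v \<in> V"
  shows "\<bar>nrm u - nrm v\<bar> \<le> nrm (\<lambda>x. u x - v x)"
  using nrm_triangle_diff[OF assms] nrm_triangle_diff[OF assms(2,1)] nrm_minus[OF assms] by linarith

lemma nrm_triangle3:
  assumes "u \<in> V" "v \<in> V" "w \<in> V"
  shows "nrm (\<lambda>x. u x - w x) \<le> nrm (\<lambda>x. u x - v x) + nrm (\<lambda>x. v x - w x)"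
  using nrm_triangle[OF diff_mem[OF assms(1,2)] diff_mem[OF assms(2,3)]] by simp

lemma parallelogram:
  assumes u: "u \<in> V" and v: "v \<in> V"
  shows "(nrm (\<lambda>x. u x + v x))\<^sup>2 + (nrm (\<lambda>x. u x - v x))\<^sup>2 = 2 * (nrm u)\<^sup>2 + 2 * (nrm v)\<^sup>2"
  using nrm_sq_add_scale[OF u v, of 1] nrm_sq_add_scale[OF u v, of "-1"] by simp

lemma tendsto_nrm:
  assumes "\<And>n. X n \<in> V" "u \<in> V" and "(\<lambda>n. nrm (\<lambda>x. X n x - u x)) \<longlonglongrightarrow> 0"
  shows "(\<lambda>n. nrm (X n)) \<longlonglongrightarrow> nrm u"
proof -
  have "(\<lambda>n. nrm (X n) - nrm u) \<longlonglongrightarrow> 0"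
    by (rule tendsto_0_le[OF assms(3), of _ 1]) (use assms abs_nrm_diff nrm_nonneg diff_mem in auto)
  then show ?thesis by (rule LIM_zero_cancel)
qed

definition cauchy :: "(nat \<Rightarrow> 'b \<Rightarrow> complex) \<Rightarrow> bool" where
  "cauchy X \<longleftrightarrow> (\<forall>n. X n \<in> V) \<and> (\<forall>e>0. \<exists>N. \<forall>m\<ge>N. \<forall>n\<ge>N. nrm (\<lambda>x. X m x - X n x) < e)"

text \<open>A predicate and not an axiom of the locale: the form with symbol
  \<open>symb - bottom\<close> is used as a semi-inner product without its completeness being
  established.\<close>

definition is_complete :: bool where
  "is_complete \<longleftrightarrow> (\<forall>X. cauchy X \<longrightarrow> (\<exists>u\<in>V. (\<lambda>n. nrm (\<lambda>x. X n x - u x)) \<longlonglongrightarrow> 0))"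

lemma cauchyI_bound:
  assumes "\<And>n. X n \<in> V" and "e \<longlonglongrightarrow> 0"
    and "\<And>m n. m \<le> n \<Longrightarrow> (nrm (\<lambda>x. X m x - X n x))\<^sup>2 \<le> (e m :: real)"
  shows "cauchy X"
  unfolding cauchy_def
proof (intro conjI allI impI)
  fix d :: real assume d: "d > 0"
  then have "eventually (\<lambda>m. e m < d\<^sup>2) sequentially"
    using assms(2) by (intro order_tendstoD) auto
  then obtain N where N: "\<And>m. m \<ge> N \<Longrightarrow> e m < d\<^sup>2" by (auto simp: eventually_sequentially)
  have *: "nrm (\<lambda>x. X m x - X n x) < d" if "m \<ge> N" "m \<le> n" for m n
  proof -
    have "(nrm (\<lambda>x. X m x - X n x))\<^sup>2 < d\<^sup>2" using N[of m] assms(3)[of m n] that by linarith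
    then show ?thesis using d by (meson less_imp_le power_less_imp_less_base)
  qed
  show "\<exists>N. \<forall>m\<ge>N. \<forall>n\<ge>N. nrm (\<lambda>x. X m x - X n x) < d"
  proof (intro exI[of _ N] allI impI)
    fix m n assume "N \<le> m" "N \<le> n"
    then show "nrm (\<lambda>x. X m x - X n x) < d"
      using *[of m n] *[of n m] nrm_minus[OF assms(1) assms(1), of m n] by (cases "m \<le> n") auto
  qed
qed (use assms in auto)

text \<open>The representing vector minimises \<open>u \<mapsto> (nrm u)\<^sup>2 - 2 Re (l u)\<close>.\<close>

lemma Riesz:
  assumes complete: is_complete
    and l_add: "\<And>u v. u \<in> V \<Longrightarrow> v \<in> V \<Longrightarrow> l (\<lambda>x. u x + v x) = l u + l v"
    and l_scale: "\<And>c u. u \<in> V \<Longrightarrow> l (\<lambda>x. c * u x) = c * l u"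
    and l_bound: "\<And>u. u \<in> V \<Longrightarrow> cmod (l u) \<le> C * nrm u"
  shows "\<exists>u\<in>V. \<forall>v\<in>V. B v u = l v"
proof -
  define J where "J = (\<lambda>u. (nrm u)\<^sup>2 - 2 * Re (l u))"
  have J_lower: "J u \<ge> - C\<^sup>2" if u: "u \<in> V" for u
  proof -
    have "Re (l u) \<le> C * nrm u" using l_bound[OF u] complex_Re_le_cmod order_trans by blast
    moreover have "0 \<le> (nrm u - C)\<^sup>2" by simp
    ultimately show ?thesis unfolding J_def power2_diff by (simp add: algebra_simps)
  qed
  define m where "m = Inf (J ` V)"
  have bdd: "bdd_below (J ` V)" using J_lower by (intro bdd_belowI2) auto
  have m_le: "m \<le> J u" if "u \<in> V" for u
    unfolding m_def using that by (intro cInf_lower bdd) auto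
  have "\<exists>u\<in>V. J u < m + inverse (real (Suc k))" for k
  proof -
    have "Inf (J ` V) < m + inverse (real (Suc k))" by (simp add: m_def)
    then show ?thesis using nonempty bdd by (subst (asm) cInf_less_iff) auto
  qed
  then obtain X where X: "\<And>k. X k \<in> V" "\<And>k. J (X k) < m + inverse (real (Suc k))" by metis
  \<comment> \<open>The midpoint \<open>h\<close> also satisfies \<open>m \<le> J h\<close>; with
    the parallelogram law this forces two almost minimising vectors to be close to each
    other.\<close>
  have half: "(nrm (\<lambda>x. u x - v x))\<^sup>2 \<le> 2 * (J u - m) + 2 * (J v - m)" if u: "u \<in> V" and v: "v \<in> V" for u v
  proof -
    define h where "h = (\<lambda>x. (1/2 :: complex) * (u x + v x))"
    have uv: "(\<lambda>x. u x + v x) \<in> V" using add_mem[OF u v] .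
    have h: "h \<in> V" unfolding h_def by (intro scale_mem uv)
    have "l h = (1/2) * (l u + l v)" unfolding h_def by (subst l_scale[OF uv]) (simp add: l_add u v)
    then have "l h = complex_of_real (1/2) * (l u + l v)" by simp
    then have 1: "Re (l h) = (Re (l u) + Re (l v)) / 2" by (simp only: Re_half)
    have "nrm h = (1/2) * nrm (\<lambda>x. u x + v x)" unfolding h_def by (subst nrm_scale[OF uv]) simp
    then have "nrm (\<lambda>x. u x + v x) = 2 * nrm h" by simp
    then have 2: "4 * (nrm h)\<^sup>2 = (nrm (\<lambda>x. u x + v x))\<^sup>2" by (simp add: power_mult_distrib)
    have "4 * J h \<ge> 4 * m" using m_le[OF h] by simp
    then show ?thesis using parallelogram[OF u v] 1 2 unfolding J_def by argo
  qed
  have "cauchy X"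
  proof (rule cauchyI_bound)
    show "X n \<in> V" for n by (rule X)
    have "(\<lambda>m. 4 * inverse (real (Suc m))) \<longlonglongrightarrow> 4 * 0"
      by (intro tendsto_mult tendsto_const LIMSEQ_inverse_real_of_nat)
    then show "(\<lambda>m. 4 * inverse (real (Suc m))) \<longlonglongrightarrow> 0" by simp
    fix i j :: nat assume "i \<le> j"
    then have "inverse (real (Suc j)) \<le> inverse (real (Suc i))" by (simp add: le_imp_inverse_le)
    then show "(nrm (\<lambda>x. X i x - X j x))\<^sup>2 \<le> 4 * inverse (real (Suc i))"
      using half[OF X(1) X(1), of i j] X(2)[of i] X(2)[of j] by argo
  qed
  then obtain u where u: "u \<in> V" and lim: "(\<lambda>n. nrm (\<lambda>x. X n x - u x)) \<longlonglongrightarrow> 0"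
    using complete unfolding is_complete_def by blast
  have l_diff: "l (\<lambda>x. v x - w x) = l v - l w" if "v \<in> V" "w \<in> V" for v w
    using l_add[OF that(1) scale_mem[OF that(2), of "-1"]] l_scale[OF that(2), of "-1"] by simp
  have "(\<lambda>n. l (X n) - l u) \<longlonglongrightarrow> 0"
  proof (rule tendsto_0_le[OF lim, of _ "C"], intro always_eventually allI)
    fix n show "norm (l (X n) - l u) \<le> norm (nrm (\<lambda>x. X n x - u x)) * C"
      using l_bound[OF diff_mem[OF X(1) u], of n] l_diff[OF X(1) u, of n] nrm_nonneg[OF diff_mem[OF X(1) u], of n]
      by (simp add: mult.commute)
  qed
  then have "(\<lambda>n. l (X n)) \<longlonglongrightarrow> l u" by (rule LIM_zero_cancel)
  then have "(\<lambda>n. J (X n)) \<longlonglongrightarrow> J u"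
    unfolding J_def by (intro tendsto_intros tendsto_nrm[OF X(1) u lim])
  moreover have "(\<lambda>n. m + inverse (real (Suc n))) \<longlonglongrightarrow> m + 0"
    by (intro tendsto_intros LIMSEQ_inverse_real_of_nat)
  ultimately have Ju: "J u \<le> m"
    using X(2) by (intro LIMSEQ_le[of _ "J u" _ m]) (auto intro!: exI[of _ 0] less_imp_le)
  have "B v u = l v" if v: "v \<in> V" for v
  proof -
    \<comment> \<open>At the minimiser the variation of \<open>J\<close> in direction
      \<open>a * v\<close> is nonnegative for every complex \<open>a\<close>, and its part linear in
      \<open>a\<close> is twice the real part of \<open>a\<close> times this difference.\<close>
    have "B v u - l v = 0"
    proof (rule quadratic_nonneg_imp_zero)
      show "0 \<le> (nrm v)\<^sup>2" by simp
      fix a :: complex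
      have av: "(\<lambda>x. a * v x) \<in> V" by (rule scale_mem[OF v])
      have "J u \<le> J (\<lambda>x. u x + a * v x)" using Ju m_le[OF add_mem[OF u av]] by linarith
      then show "0 \<le> 2 * Re (a * (B v u - l v)) + (cmod a)\<^sup>2 * (nrm v)\<^sup>2"
        unfolding J_def nrm_sq_add_scale[OF u v] by (simp add: l_add[OF u av] l_scale[OF v] algebra_simps)
    qed
    then show ?thesis by simp
  qed
  then show ?thesis using u by blast
qed

end

section \<open>Square-integrable functions\<close>

lemma L2D [measurable_dest]: "u \<in> L2 \<Longrightarrow> u \<in> borel_measurable borel"
  by (simp add: L2_def)

lemma L2_integrable: "u \<in> L2 \<Longrightarrow> integrable lborel (\<lambda>x. (cmod (u x))\<^sup>2)"
  by (simp add: L2_def)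

lemma L2_bound:
  assumes "v \<in> L2" "u \<in> borel_measurable borel" "AE x in lborel. cmod (u x) \<le> C * cmod (v x)"
  shows "u \<in> L2"
proof -
  have "integrable lborel (\<lambda>x. C\<^sup>2 * (cmod (v x))\<^sup>2)" using L2_integrable[OF assms(1)] by simp
  then have "integrable lborel (\<lambda>x. (cmod (u x))\<^sup>2)"
  proof (rule Bochner_Integration.integrable_bound)
    show "AE x in lborel. norm ((cmod (u x))\<^sup>2) \<le> norm (C\<^sup>2 * (cmod (v x))\<^sup>2)"
      using assms(3)
    proof eventually_elim
      case (elim x)
      then have "(cmod (u x))\<^sup>2 \<le> (C * cmod (v x))\<^sup>2" by (intro power_mono) auto
      then show ?case by (simp add: power_mult_distrib)
    qed
  qed (use assms(2) in measurable)
  then show ?thesis using assms(2) by (simp add: L2_def)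
qed

lemma L2_cong_AE:
  assumes "v \<in> L2" "u \<in> borel_measurable borel" "AE x in lborel. u x = v x"
  shows "u \<in> L2"
  by (rule L2_bound[OF assms(1,2), of 1]) (use assms(3) in auto)

lemma cmod_add_sq_le: "(cmod (a + b))\<^sup>2 \<le> 2 * (cmod a)\<^sup>2 + 2 * (cmod b)\<^sup>2"
proof -
  have "(cmod (a + b))\<^sup>2 \<le> (cmod a + cmod b)\<^sup>2" by (intro power_mono norm_triangle_ineq) auto
  also have "\<dots> \<le> 2 * (cmod a)\<^sup>2 + 2 * (cmod b)\<^sup>2"
    using zero_le_power2[of "cmod a - cmod b"] unfolding power2_diff power2_sum by linarith
  finally show ?thesis .
qed

lemma mult_le_sum_squares: "0 \<le> a \<Longrightarrow> 0 \<le> b \<Longrightarrow> a * b \<le> a\<^sup>2 + (b\<^sup>2 :: real)"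
  using sum_squares_bound[of a b] mult_nonneg_nonneg[of a b] by linarith

lemma L2_add: "u \<in> L2 \<Longrightarrow> v \<in> L2 \<Longrightarrow> (\<lambda>x. u x + v x) \<in> L2"
proof -
  assume uv: "u \<in> L2" "v \<in> L2"
  have "integrable lborel (\<lambda>x. 2 * (cmod (u x))\<^sup>2 + 2 * (cmod (v x))\<^sup>2)"
    using L2_integrable[OF uv(1)] L2_integrable[OF uv(2)] by simp
  then have "integrable lborel (\<lambda>x. (cmod (u x + v x))\<^sup>2)"
  proof (rule Bochner_Integration.integrable_bound)
    show "AE x in lborel. norm ((cmod (u x + v x))\<^sup>2) \<le> norm (2 * (cmod (u x))\<^sup>2 + 2 * (cmod (v x))\<^sup>2)"
      using cmod_add_sq_le by auto
  qed (use uv in measurable)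
  then show ?thesis using uv by (auto simp: L2_def)
qed

lemma L2_scale: "u \<in> L2 \<Longrightarrow> (\<lambda>x. c * u x) \<in> L2"
  by (rule L2_bound[of u _ "cmod c"]) (auto simp: norm_mult)

lemma L2_zero: "(\<lambda>x. 0) \<in> L2"
  by (simp add: L2_def)

lemma L2_diff: "u \<in> L2 \<Longrightarrow> v \<in> L2 \<Longrightarrow> (\<lambda>x. u x - v x) \<in> L2"
  using L2_add[OF _ L2_scale[of v "-1"], of u] by simp

lemma borel_measurable_cnj [measurable (raw)]:
  "f \<in> borel_measurable M \<Longrightarrow> (\<lambda>x. cnj (f x)) \<in> borel_measurable M"
  by (rule borel_measurable_continuous_on[of cnj]) (auto intro: continuous_intros)

lemma L2_mult_integrable:
  assumes "u \<in> L2" "v \<in> L2"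
  shows "integrable lborel (\<lambda>x. u x * cnj (v x))"
proof (rule Bochner_Integration.integrable_bound)
  show "integrable lborel (\<lambda>x. (cmod (u x))\<^sup>2 + (cmod (v x))\<^sup>2)"
    using assms by (auto intro: L2_integrable)
  have "cmod (u x * cnj (v x)) \<le> norm ((cmod (u x))\<^sup>2 + (cmod (v x))\<^sup>2)" for x
    using mult_le_sum_squares by (simp add: norm_mult)
  then show "AE x in lborel. norm (u x * cnj (v x)) \<le> norm ((cmod (u x))\<^sup>2 + (cmod (v x))\<^sup>2)"
    by blast
qed (use assms in measurable)

interpretation L2: semi_inner "L2 :: ('b::euclidean_space \<Rightarrow> complex) set" L2_inner
proof
  show "L2 \<noteq> {}" using L2_zero by blast
  fix u v w :: "'b \<Rightarrow> complex" and c
  assume u: "u \<in> L2"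
  show "(\<lambda>x. c * u x) \<in> L2" by (rule L2_scale[OF u])
  have "L2_inner u u = complex_of_real (\<integral>x. (cmod (u x))\<^sup>2 \<partial>lborel)"
    unfolding L2_inner_def integral_complex_of_real[symmetric]
    by (intro Bochner_Integration.integral_cong) (simp_all add: mult_cnj_cmod)
  then show "0 \<le> Re (L2_inner u u)" by simp
  assume v: "v \<in> L2"
  show "(\<lambda>x. u x + v x) \<in> L2" by (rule L2_add[OF u v])
  show "cnj (L2_inner u v) = L2_inner v u"
    by (simp only: L2_inner_def flip: Bochner_Integration.integral_cnj) (simp add: mult.commute)
  assume w: "w \<in> L2"
  show "L2_inner (\<lambda>x. u x + v x) w = L2_inner u w + L2_inner v w"
    unfolding L2_inner_def
    by (subst Bochner_Integration.integral_add[symmetric]) (auto intro: L2_mult_integrable u v w simp: algebra_simps)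
next
  fix u w :: "'b \<Rightarrow> complex" and c
  show "L2_inner (\<lambda>x. c * u x) w = c * L2_inner u w"
    unfolding L2_inner_def by (simp add: mult.assoc)
qed

lemma L2_nrm_eq: "L2.nrm = L2_norm"
proof
  fix u :: "'b::euclidean_space \<Rightarrow> complex"
  have "L2_inner u u = complex_of_real (\<integral>x. (cmod (u x))\<^sup>2 \<partial>lborel)"
    unfolding L2_inner_def integral_complex_of_real[symmetric]
    by (intro Bochner_Integration.integral_cong) (simp_all add: mult_cnj_cmod)
  then show "L2.nrm u = L2_norm u" by (simp add: L2.nrm_def L2_norm_def)
qed

lemma L2_norm_sq: "(L2_norm u)\<^sup>2 = (\<integral>x. (cmod (u x))\<^sup>2 \<partial>lborel)"
  by (simp add: L2_norm_def)

lemma L2_norm_nonneg [simp]: "0 \<le> L2_norm u"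
  by (simp add: L2_norm_def)

lemma nn_integral_L2: "u \<in> L2 \<Longrightarrow> (\<integral>\<^sup>+x. ennreal ((cmod (u x))\<^sup>2) \<partial>lborel) = ennreal ((L2_norm u)\<^sup>2)"
  unfolding L2_norm_sq by (intro nn_integral_eq_integral L2_integrable) auto

lemma L2I_nn_integral:
  assumes "u \<in> borel_measurable borel" "(\<integral>\<^sup>+x. ennreal ((cmod (u x))\<^sup>2) \<partial>lborel) \<le> ennreal C"
  shows "u \<in> L2"
proof -
  have "integrable lborel (\<lambda>x. (cmod (u x))\<^sup>2)"
    by (rule integrableI_bounded) (use assms in \<open>auto simp: top_unique intro: le_less_trans\<close>)
  then show ?thesis using assms(1) by (simp add: L2_def)
qed

lemma L2_norm_le_nn_integral:
  assumes "u \<in> L2" "(\<integral>\<^sup>+x. ennreal ((cmod (u x))\<^sup>2) \<partial>lborel) \<le> ennreal C" "0 \<le> C"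
  shows "(L2_norm u)\<^sup>2 \<le> C"
  using assms nn_integral_L2[OF assms(1)] by simp

lemma L2_norm_cong_AE:
  assumes "u \<in> borel_measurable borel" "v \<in> borel_measurable borel" "AE x in lborel. u x = v x"
  shows "L2_norm u = L2_norm v"
  unfolding L2_norm_def using assms by (intro arg_cong[of _ _ sqrt] integral_cong_AE) auto

lemma L2_norm_eq_0_iff:
  assumes "u \<in> L2"
  shows "L2_norm u = 0 \<longleftrightarrow> (AE x in lborel. u x = 0)"
  unfolding L2_norm_def using integral_nonneg_eq_0_iff_AE[OF L2_integrable[OF assms]] by simp

text \<open>A fast subsequence converges almost everywhere, and Fatou's lemma makes its limit the L2
  limit of the whole sequence. Subsequence and pointwise limit belong to the conclusion because
  supports and weighted energies are later passed to the limit pointwise.\<close>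

theorem Riesz_Fischer:
  fixes X :: "nat \<Rightarrow> 'b::euclidean_space \<Rightarrow> complex"
  assumes "L2.cauchy X"
  obtains u r where "u \<in> L2" "strict_mono r" "AE x in lborel. (\<lambda>k. X (r k) x) \<longlonglongrightarrow> u x"
    "(\<lambda>n. L2_norm (\<lambda>x. X n x - u x)) \<longlonglongrightarrow> 0"
proof -
  have X: "X n \<in> L2" for n using assms by (auto simp: L2.cauchy_def)
  note [measurable] = L2D[OF X]
  have C: "\<exists>N. \<forall>m\<ge>N. \<forall>n\<ge>N. L2_norm (\<lambda>x. X m x - X n x) < e" if "e > 0" for e
    using assms that by (auto simp: L2.cauchy_def L2_nrm_eq)
  obtain N where N: "\<And>k m n. m \<ge> N k \<Longrightarrow> n \<ge> N k \<Longrightarrow> L2_norm (\<lambda>x. X m x - X n x) < (1/4)^k"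
    using C[of "(1/4)^_"] by (metis zero_less_divide_1_iff zero_less_numeral zero_less_power)
  define r where "r = rec_nat (N 0) (\<lambda>k p. max (Suc p) (N (Suc k)))"
  have rS: "r (Suc k) = max (Suc (r k)) (N (Suc k))" for k by (simp add: r_def)
  have r: "strict_mono r" by (auto intro!: strict_mono_Suc_iff[THEN iffD2] simp: rS)
  have rN: "r k \<ge> N k" for k by (cases k) (simp_all add: rS r_def)
  define d where "d = (\<lambda>k x. cmod (X (r (Suc k)) x - X (r k) x))"
  have [measurable]: "d k \<in> borel_measurable borel" for k unfolding d_def by measurable
  \<comment> \<open>The increments have squared norm at most 16^-k. The weight 4^k keeps the series
    of integrals convergent and, where the series of integrands is finite, forces
    \<open>d k x\<close> below 2^-k eventually.\<close>
  have d_int: "(\<integral>\<^sup>+x. ennreal (4^k * (d k x)\<^sup>2) \<partial>lborel) \<le> ennreal ((1/4)^k)" for k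
  proof -
    have D: "(\<lambda>x. X (r (Suc k)) x - X (r k) x) \<in> L2" by (intro L2_diff X)
    have "r (Suc k) \<ge> r k" using r by (simp add: strict_mono_less_eq)
    then have "L2_norm (\<lambda>x. X (r (Suc k)) x - X (r k) x) \<le> (1/4)^k"
      using rN[of k] by (intro less_imp_le[OF N]) auto
    then have "(L2_norm (\<lambda>x. X (r (Suc k)) x - X (r k) x))\<^sup>2 \<le> ((1/4)^k)\<^sup>2" by (intro power_mono) auto
    then have "4^k * (L2_norm (\<lambda>x. X (r (Suc k)) x - X (r k) x))\<^sup>2 \<le> 4^k * ((1/4)^k)\<^sup>2" by simp
    also have "4^k * ((1/4)^k)\<^sup>2 = (1/4 :: real)^k"
      by (simp add: power2_eq_square power_divide)
    finally have "4^k * (L2_norm (\<lambda>x. X (r (Suc k)) x - X (r k) x))\<^sup>2 \<le> (1/4)^k" .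
    moreover have "(\<integral>\<^sup>+x. ennreal (4^k * (d k x)\<^sup>2) \<partial>lborel)
        = ennreal (4^k * (L2_norm (\<lambda>x. X (r (Suc k)) x - X (r k) x))\<^sup>2)"
      unfolding d_def by (simp add: ennreal_mult nn_integral_cmult nn_integral_L2[OF D])
    ultimately show ?thesis by (simp add: ennreal_leI)
  qed
  have "(\<integral>\<^sup>+x. (\<Sum>k. ennreal (4^k * (d k x)\<^sup>2)) \<partial>lborel) = (\<Sum>k. \<integral>\<^sup>+x. ennreal (4^k * (d k x)\<^sup>2) \<partial>lborel)"
    by (intro nn_integral_suminf) measurable
  also have "\<dots> \<le> (\<Sum>k. ennreal ((1/4)^k))" by (intro suminf_le d_int) auto
  also have "\<dots> = ennreal (\<Sum>k. (1/4)^k)" by (intro suminf_ennreal2) (auto simp: summable_geometric)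
  finally have "(\<integral>\<^sup>+x. (\<Sum>k. ennreal (4^k * (d k x)\<^sup>2)) \<partial>lborel) \<noteq> \<infinity>"
    by (auto simp: top_unique)
  then have "AE x in lborel. (\<Sum>k. ennreal (4^k * (d k x)\<^sup>2)) \<noteq> \<infinity>"
    by (intro nn_integral_PInf_AE) measurable
  then have conv: "AE x in lborel. convergent (\<lambda>k. X (r k) x)"
  proof eventually_elim
    case (elim x)
    then have s: "summable (\<lambda>k. 4^k * (d k x)\<^sup>2)" by (intro summable_suminf_not_top) auto
    then have "(\<lambda>k. 4^k * (d k x)\<^sup>2) \<longlonglongrightarrow> 0" by (rule summable_LIMSEQ_zero)
    then have "eventually (\<lambda>k. 4^k * (d k x)\<^sup>2 < 1) sequentially" by (rule order_tendstoD) simp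
    then have "eventually (\<lambda>k. norm (X (r (Suc k)) x - X (r k) x) \<le> (1/2)^k) sequentially"
    proof eventually_elim
      case (elim k)
      have "(2^k * d k x)\<^sup>2 = 4^k * (d k x)\<^sup>2"
        by (simp add: power_mult_distrib power_mult[symmetric] mult.commute[of k]) (simp add: power_mult)
      with elim have "(2^k * d k x)\<^sup>2 \<le> 1\<^sup>2" by simp
      then have "2^k * d k x \<le> 1" by (rule power2_le_imp_le) simp
      then have "d k x \<le> (1/2)^k" by (simp add: power_divide field_simps)
      then show ?case by (simp add: d_def)
    qed
    then have "summable (\<lambda>k. X (r (Suc k)) x - X (r k) x)"
      by (rule summable_comparison_test_ev) (simp add: summable_geometric)
    then have "convergent (\<lambda>n. \<Sum>k<n. X (r (Suc k)) x - X (r k) x)"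
      by (simp add: summable_iff_convergent)
    then have "convergent (\<lambda>n. X (r n) x - X (r 0) x)"
      using sum_lessThan_telescope[of "\<lambda>k. X (r k) x"] by simp
    then show ?case by (metis convergent_diff_const_right_iff)
  qed
  define u where "u = (\<lambda>x. lim (\<lambda>k. X (r k) x))"
  have [measurable]: "u \<in> borel_measurable borel" unfolding u_def by measurable
  have lim: "AE x in lborel. (\<lambda>k. X (r k) x) \<longlonglongrightarrow> u x"
    using conv by eventually_elim (simp add: u_def convergent_LIMSEQ_iff)
  \<comment> \<open>The subsequence is used in the second index only; \<open>m\<close> is arbitrary,
    so the bound holds along the full sequence.\<close>
  have fatou: "(\<integral>\<^sup>+x. ennreal ((cmod (X m x - u x))\<^sup>2) \<partial>lborel) \<le> ennreal (e\<^sup>2)"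
    if e: "e > 0" and M: "\<And>n. n \<ge> M \<Longrightarrow> L2_norm (\<lambda>x. X m x - X n x) < e" for m M e
  proof -
    have "(\<integral>\<^sup>+x. ennreal ((cmod (X m x - u x))\<^sup>2) \<partial>lborel)
       = (\<integral>\<^sup>+x. liminf (\<lambda>k. ennreal ((cmod (X m x - X (r k) x))\<^sup>2)) \<partial>lborel)"
      using lim
    proof (intro nn_integral_cong_AE, eventually_elim)
      case (elim x)
      then have "(\<lambda>k. ennreal ((cmod (X m x - X (r k) x))\<^sup>2)) \<longlonglongrightarrow> ennreal ((cmod (X m x - u x))\<^sup>2)"
        by (intro tendsto_intros)
      then show ?case by (metis lim_imp_Liminf trivial_limit_sequentially)
    qed
    also have "\<dots> \<le> liminf (\<lambda>k. \<integral>\<^sup>+x. ennreal ((cmod (X m x - X (r k) x))\<^sup>2) \<partial>lborel)"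
      by (intro nn_integral_liminf) measurable
    also have "\<dots> \<le> liminf (\<lambda>k. ennreal (e\<^sup>2))"
    proof (rule Liminf_mono, rule eventually_sequentiallyI[of M])
      fix k assume "M \<le> k"
      then have "r k \<ge> M" using seq_suble[OF r, of k] by linarith
      then have "L2_norm (\<lambda>x. X m x - X (r k) x) \<le> e" using M by (simp add: less_imp_le)
      then have "(L2_norm (\<lambda>x. X m x - X (r k) x))\<^sup>2 \<le> e\<^sup>2" by (intro power_mono) auto
      then show "(\<integral>\<^sup>+x. ennreal ((cmod (X m x - X (r k) x))\<^sup>2) \<partial>lborel) \<le> ennreal (e\<^sup>2)"
        by (subst nn_integral_L2) (auto intro: L2_diff X ennreal_leI)
    qed
    finally show ?thesis by (simp add: Liminf_const)
  qed
  have "u \<in> L2"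
  proof -
    obtain M where M: "\<And>n. n \<ge> M \<Longrightarrow> L2_norm (\<lambda>x. X M x - X n x) < 1" using C[of 1] by auto
    have "(\<lambda>x. X M x - u x) \<in> L2"
      by (rule L2I_nn_integral[OF _ fatou[where e=1 and M=M and m=M]]) (use M in auto)
    from L2_diff[OF X[of M] this] show ?thesis by simp
  qed
  have "(\<lambda>n. L2_norm (\<lambda>x. X n x - u x)) \<longlonglongrightarrow> 0"
  proof (rule LIMSEQ_I)
    fix e :: real assume e: "e > 0"
    obtain M where M: "\<And>m n. m \<ge> M \<Longrightarrow> n \<ge> M \<Longrightarrow> L2_norm (\<lambda>x. X m x - X n x) < e/2"
      using C[of "e/2"] e by auto
    have "L2_norm (\<lambda>x. X n x - u x) \<le> e/2" if "n \<ge> M" for n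
    proof -
      have "(L2_norm (\<lambda>x. X n x - u x))\<^sup>2 \<le> (e/2)\<^sup>2"
        using e M[OF that] by (intro L2_norm_le_nn_integral fatou[of "e/2" M] L2_diff X \<open>u \<in> L2\<close>) auto
      then show ?thesis using e by (auto intro: power2_le_imp_le)
    qed
    then have "\<forall>n\<ge>M. norm (L2_norm (\<lambda>x. X n x - u x) - 0) < e" using e by fastforce
    then show "\<exists>no. \<forall>n\<ge>no. norm (L2_norm (\<lambda>x. X n x - u x) - 0) < e" by blast
  qed
  with \<open>u \<in> L2\<close> r lim show thesis by (rule that)
qed

section \<open>Plancherel's theorem\<close>

lemma integral_lborel_affine:
  fixes f :: "'b::euclidean_space \<Rightarrow> 'c::{banach, second_countable_topology}"
  assumes [measurable]: "f \<in> borel_measurable borel" and c: "c \<noteq> 0"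
  shows "(\<integral>x. f x \<partial>lborel) = \<bar>c\<bar> ^ DIM('b) *\<^sub>R (\<integral>x. f (t + c *\<^sub>R x) \<partial>lborel)"
  by (subst lborel_affine[OF c, of t], subst integral_density) (simp_all add: integral_distr)

lemma integrable_lborel_affine_iff:
  fixes f :: "'b::euclidean_space \<Rightarrow> 'c::{banach, second_countable_topology}"
  assumes [measurable]: "f \<in> borel_measurable borel" and c: "c \<noteq> 0"
  shows "integrable lborel f \<longleftrightarrow> integrable lborel (\<lambda>x. f (t + c *\<^sub>R x))"
proof -
  have "integrable lborel (\<lambda>x. a *\<^sub>R g x) \<longleftrightarrow> integrable lborel g" if "a \<noteq> 0" for a and g :: "'b \<Rightarrow> 'c"
    using integrable_scaleR_right[of a lborel g] integrable_scaleR_right[of "inverse a" lborel "\<lambda>x. a *\<^sub>R g x"] that by auto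
  then show ?thesis
    using c by (subst lborel_affine[OF c, of t], subst integrable_density) (simp_all add: integrable_distr_eq)
qed

lemma (in pair_sigma_finite) integrable_pair_mult:
  fixes a :: "'a \<Rightarrow> 'c::{real_normed_field, banach, second_countable_topology}" and b :: "'b \<Rightarrow> 'c"
  assumes a: "integrable M1 a" and b: "integrable M2 b"
  shows "integrable (M1 \<Otimes>\<^sub>M M2) (\<lambda>(x, y). a x * b y)"
proof (rule Fubini_integrable)
  show "(\<lambda>(x, y). a x * b y) \<in> borel_measurable (M1 \<Otimes>\<^sub>M M2)"
    using a b by (auto dest!: borel_measurable_integrable)
  show "integrable M1 (\<lambda>x. \<integral>y. norm (case (x, y) of (x, y) \<Rightarrow> a x * b y) \<partial>M2)"
    using a by (simp add: norm_mult)
  show "AE x in M1. integrable M2 (\<lambda>y. case (x, y) of (x, y) \<Rightarrow> a x * b y)"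
    using b by simp
qed

lemma (in pair_sigma_finite) integral_pair_mult:
  fixes a :: "'a \<Rightarrow> 'c::{real_normed_field, banach, second_countable_topology}" and b :: "'b \<Rightarrow> 'c"
  assumes a: "integrable M1 a" and b: "integrable M2 b"
  shows "(\<integral>(x, y). a x * b y \<partial>(M1 \<Otimes>\<^sub>M M2)) = (\<integral>x. a x \<partial>M1) * (\<integral>y. b y \<partial>M2)"
  by (subst integral_fst'[symmetric, OF integrable_pair_mult[OF a b]]) simp

subsection \<open>Gaussians\<close>

text \<open>The Gaussian is \<open>sqrt (2 * pi)\<close> times the standard normal density, so this
  is the characteristic function of the normal distribution.\<close>

lemma gaussian_1d:
  fixes t :: real
  shows "integrable lborel (\<lambda>x. exp (\<i> * complex_of_real (t * x)) * complex_of_real (exp (- x\<^sup>2 / 2)))" (is "integrable _ ?f")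
    and "(\<integral>x. exp (\<i> * complex_of_real (t * x)) * complex_of_real (exp (- x\<^sup>2 / 2)) \<partial>lborel)
      = complex_of_real (sqrt (2 * pi) * exp (- t\<^sup>2 / 2))"
proof -
  have eq: "?f x = complex_of_real (sqrt (2 * pi)) * (std_normal_density x *\<^sub>R iexp (t * x))" for x
    by (simp add: normal_density_def scaleR_conv_of_real flip: of_real_mult)
  have "integrable lborel (\<lambda>x. std_normal_density x *\<^sub>R iexp (t * x))"
    by (rule Bochner_Integration.integrable_bound[OF integrable_normal_density[OF zero_less_one, of 0]])
      (auto simp: normal_density_nonneg)
  then show "integrable lborel ?f" unfolding eq by (rule integrable_mult_right)
  have "complex_of_real (exp (- t\<^sup>2 / 2)) = char std_normal_distribution t"
    by (simp add: char_std_normal_distribution)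
  also have "\<dots> = (\<integral>x. std_normal_density x *\<^sub>R iexp (t * x) \<partial>lborel)"
    unfolding char_def by (subst integral_density) (auto simp: normal_density_nonneg)
  finally have F: "(\<integral>x. std_normal_density x *\<^sub>R iexp (t * x) \<partial>lborel) = complex_of_real (exp (- t\<^sup>2 / 2))" by (rule sym)
  show "integral\<^sup>L lborel ?f = complex_of_real (sqrt (2 * pi) * exp (- t\<^sup>2 / 2))"
    unfolding eq integral_mult_right_zero F by simp
qed

lemma exp_mult_of_real_exp: "exp a * complex_of_real (exp (- r / 2)) = exp (a - complex_of_real (r / 2))"
proof -
  have "exp (a - complex_of_real (r / 2)) = exp (a + complex_of_real (- r / 2))" by simp
  also have "\<dots> = exp a * complex_of_real (exp (- r / 2))" by (simp only: exp_add exp_of_real)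
  finally show ?thesis ..
qed

text \<open>The exponential of the inner product and the Gaussian both factor over the coordinates,
  so the integral is a product of one-dimensional ones.\<close>

lemma gaussian_fourier:
  fixes y :: "'b::euclidean_space"
  shows integrable_gaussian_iexp:
      "integrable lborel (\<lambda>x. exp (\<i> * complex_of_real (y \<bullet> x)) * complex_of_real (exp (- (norm x)\<^sup>2 / 2)))" (is "integrable _ ?f")
    and integral_gaussian_iexp:
      "(\<integral>x. exp (\<i> * complex_of_real (y \<bullet> x)) * complex_of_real (exp (- (norm x)\<^sup>2 / 2)) \<partial>lborel)
        = complex_of_real ((2 * pi) powr (real DIM('b) / 2) * exp (- (norm y)\<^sup>2 / 2))"
proof -
  interpret product_sigma_finite "\<lambda>_::'b. lborel :: real measure" by standard
  let ?h = "\<lambda>b x. exp (\<i> * complex_of_real ((y \<bullet> b) * x)) * complex_of_real (exp (- x\<^sup>2 / 2))"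
  have norm_eq: "(norm x)\<^sup>2 = (\<Sum>b\<in>Basis. (x \<bullet> b)\<^sup>2)" for x :: 'b
    by (subst power2_norm_eq_inner, subst euclidean_inner) (simp add: power2_eq_square)
  have prod_eq: "?f x = (\<Prod>b\<in>Basis. ?h b (x \<bullet> b))" for x
  proof -
    have "?f x = exp (\<i> * complex_of_real (y \<bullet> x) - complex_of_real ((norm x)\<^sup>2 / 2))"
      by (rule exp_mult_of_real_exp)
    also have "\<i> * complex_of_real (y \<bullet> x) - complex_of_real ((norm x)\<^sup>2 / 2)
        = (\<Sum>b\<in>Basis. \<i> * complex_of_real ((y \<bullet> b) * (x \<bullet> b)) - complex_of_real ((x \<bullet> b)\<^sup>2 / 2))"
      by (simp add: norm_eq euclidean_inner[of y x] sum_subtractf sum_distrib_left sum_divide_distrib)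
    also have "exp \<dots> = (\<Prod>b\<in>Basis. exp (\<i> * complex_of_real ((y \<bullet> b) * (x \<bullet> b)) - complex_of_real ((x \<bullet> b)\<^sup>2 / 2)))"
      by (simp add: exp_sum)
    also have "\<dots> = (\<Prod>b\<in>Basis. ?h b (x \<bullet> b))"
      by (simp only: exp_mult_of_real_exp)
    finally show ?thesis .
  qed
  have proj: "?f (\<Sum>b\<in>Basis. f b *\<^sub>R b) = (\<Prod>b\<in>Basis. ?h b (f b))" for f
    unfolding prod_eq by (intro prod.cong) (simp_all add: inner_sum_left_Basis)
  define F where "F = ?f"
  define H where "H = ?h"
  have proj': "F (\<Sum>b\<in>Basis. f b *\<^sub>R b) = (\<Prod>b\<in>Basis. H b (f b))" for f
    unfolding F_def H_def by (rule proj)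
  have [measurable]: "F \<in> borel_measurable borel" unfolding F_def by measurable
  have "integrable (\<Pi>\<^sub>M b\<in>Basis. lborel) (\<lambda>f. \<Prod>b\<in>Basis. H b (f b))"
    unfolding H_def by (intro product_integrable_prod gaussian_1d) auto
  then have "integrable lborel F"
    by (subst lborel_eq) (simp add: integrable_distr_eq proj')
  then show "integrable lborel ?f" unfolding F_def .
  have "integral\<^sup>L lborel F = (\<integral>f. (\<Prod>b\<in>Basis. H b (f b)) \<partial>(\<Pi>\<^sub>M b\<in>Basis. lborel))"
    by (subst lborel_eq) (simp add: integral_distr proj')
  also have "\<dots> = (\<Prod>b\<in>Basis. integral\<^sup>L lborel (H b))"
    unfolding H_def by (intro product_integral_prod gaussian_1d) auto
  also have "\<dots> = (\<Prod>b\<in>Basis. complex_of_real (sqrt (2 * pi) * exp (- (y \<bullet> b)\<^sup>2 / 2)))"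
    unfolding H_def by (simp only: gaussian_1d)
  also have "\<dots> = complex_of_real (sqrt (2 * pi) ^ DIM('b) * exp (\<Sum>b\<in>Basis. - (y \<bullet> b)\<^sup>2 / 2))"
    by (simp add: prod.distrib exp_sum)
  also have "sqrt (2 * pi) ^ DIM('b) = (2 * pi) powr (real DIM('b) / 2)"
    by (simp add: powr_half_sqrt[symmetric] powr_powr flip: powr_realpow)
  also have "(\<Sum>b\<in>Basis. - (y \<bullet> b)\<^sup>2 / 2) = - (norm y)\<^sup>2 / 2"
    by (simp add: norm_eq sum_negf sum_divide_distrib)
  finally show "integral\<^sup>L lborel ?f = complex_of_real ((2 * pi) powr (real DIM('b) / 2) * exp (- (norm y)\<^sup>2 / 2))"
    unfolding F_def .
qed

lemma integrable_gaussian: "integrable lborel (\<lambda>x::'b::euclidean_space. exp (- (norm x)\<^sup>2 / 2))"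
proof -
  have "integrable lborel (\<lambda>x::'b. Re (complex_of_real (exp (- (norm x)\<^sup>2 / 2))))"
    by (intro integrable_Re) (use integrable_gaussian_iexp[of "0::'b"] in simp)
  then show ?thesis by simp
qed

lemma integral_gaussian: "(\<integral>x. exp (- (norm (x::'b::euclidean_space))\<^sup>2 / 2) \<partial>lborel) = (2 * pi) powr (real DIM('b) / 2)"
proof -
  have "complex_of_real (\<integral>x. exp (- (norm (x::'b))\<^sup>2 / 2) \<partial>lborel) = complex_of_real ((2 * pi) powr (real DIM('b) / 2))"
    using integral_gaussian_iexp[of "0::'b"] by (simp del: of_real_exp flip: integral_complex_of_real)
  then show ?thesis by (simp only: of_real_eq_iff)
qed

lemma gaussian_fourier_scaled:
  fixes v :: "'b::euclidean_space"
  assumes e: "e > 0"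
  shows "integrable lborel (\<lambda>x::'b. exp (- (norm (e *\<^sub>R x))\<^sup>2 / 2))"
    and "(\<integral>x. exp (- \<i> * complex_of_real (x \<bullet> v)) * complex_of_real (exp (- (norm (e *\<^sub>R x))\<^sup>2 / 2)) \<partial>lborel)
      = complex_of_real (inverse e ^ DIM('b) * ((2 * pi) powr (real DIM('b) / 2) * exp (- (norm (inverse e *\<^sub>R v))\<^sup>2 / 2)))"
proof -
  have "integrable lborel (\<lambda>x::'b. exp (- (norm (0 + e *\<^sub>R x))\<^sup>2 / 2))"
    using e integrable_gaussian
    by (subst integrable_lborel_affine_iff[of "\<lambda>x::'b. exp (- (norm x)\<^sup>2 / 2)" e 0, symmetric]) simp_all
  then show "integrable lborel (\<lambda>x::'b. exp (- (norm (e *\<^sub>R x))\<^sup>2 / 2))" by simp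
  have "(\<integral>x. exp (- \<i> * complex_of_real (x \<bullet> v)) * complex_of_real (exp (- (norm (e *\<^sub>R x))\<^sup>2 / 2)) \<partial>lborel)
    = \<bar>inverse e\<bar> ^ DIM('b) *\<^sub>R (\<integral>x. exp (- \<i> * complex_of_real ((0 + inverse e *\<^sub>R x) \<bullet> v)) *
          complex_of_real (exp (- (norm (e *\<^sub>R (0 + inverse e *\<^sub>R x)))\<^sup>2 / 2)) \<partial>lborel)"
    using e by (intro integral_lborel_affine) auto
  also have "(\<lambda>x. exp (- \<i> * complex_of_real ((0 + inverse e *\<^sub>R x) \<bullet> v)) *
          complex_of_real (exp (- (norm (e *\<^sub>R (0 + inverse e *\<^sub>R x)))\<^sup>2 / 2)))
      = (\<lambda>x. exp (\<i> * complex_of_real ((- (inverse e *\<^sub>R v)) \<bullet> x)) * complex_of_real (exp (- (norm x)\<^sup>2 / 2)))"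
    using e by (auto simp: fun_eq_iff inner_commute)
  finally show "(\<integral>x. exp (- \<i> * complex_of_real (x \<bullet> v)) * complex_of_real (exp (- (norm (e *\<^sub>R x))\<^sup>2 / 2)) \<partial>lborel)
      = complex_of_real (inverse e ^ DIM('b) * ((2 * pi) powr (real DIM('b) / 2) * exp (- (norm (inverse e *\<^sub>R v))\<^sup>2 / 2)))"
    using e unfolding integral_gaussian_iexp by (simp add: scaleR_conv_of_real)
qed

subsection \<open>Continuity of translations\<close>

text \<open>Outer regularity reduces the claim to an open superset \<open>U\<close>, whose
  translates eventually contain any given point of \<open>U\<close>; the excess \<open>U - A\<close>
  costs at most twice its measure.\<close>

lemma translation_tendsto_indicator:
  fixes h :: "nat \<Rightarrow> 'b::euclidean_space"
  assumes A [measurable]: "A \<in> sets lborel" "emeasure lborel A < \<infinity>" and h: "h \<longlonglongrightarrow> 0"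
  shows "(\<lambda>n. \<integral>x. \<bar>indicator A (x - h n) - indicator A x\<bar> \<partial>lborel) \<longlonglongrightarrow> (0::real)"
proof (rule LIMSEQ_I)
  have shift: "(\<integral>x. f (x - h n) \<partial>lborel) = (\<integral>x. f x \<partial>lborel)" "integrable lborel (\<lambda>x. f (x - h n))"
    if "integrable lborel f" for f :: "'b \<Rightarrow> real" and n
    using integral_lborel_affine[of f 1 "- h n"] integrable_lborel_affine_iff[of f 1 "- h n"] that
    by (simp_all add: borel_measurable_integrable[simplified])
  fix e :: real assume e: "e > 0"
  obtain U where U: "open U" "A \<subseteq> U" "emeasure lborel (U - A) < e / 4"
    using outer_regular_lborel[of A "e/4"] A e by auto
  have [measurable]: "U \<in> sets borel" using U by simp
  have "emeasure lborel U \<le> emeasure lborel A + emeasure lborel (U - A)"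
    by (rule order_trans[OF _ emeasure_subadditive]) (use U A in \<open>auto intro!: emeasure_mono\<close>)
  also have "\<dots> < \<infinity>" using A U by (auto simp: less_top[symmetric])
  finally have Ufin: "emeasure lborel U < \<infinity>" .
  have intU: "integrable lborel (indicator U :: 'b \<Rightarrow> real)" using Ufin by (intro integrable_real_indicator) auto
  have intA: "integrable lborel (indicator A :: 'b \<Rightarrow> real)" using A by (intro integrable_real_indicator) auto
  have lim: "(\<lambda>n. \<integral>x. indicator U x * indicator U (x - h n) \<partial>lborel) \<longlonglongrightarrow> (\<integral>x. (indicator U x :: real) \<partial>lborel)"
  proof (rule integral_dominated_convergence[where w="indicator U"])
    show "AE x in lborel. (\<lambda>n. indicator U x * indicator U (x - h n) :: real) \<longlonglongrightarrow> indicator U x"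
    proof (intro always_eventually allI)
      fix x
      show "(\<lambda>n. indicator U x * indicator U (x - h n) :: real) \<longlonglongrightarrow> indicator U x"
      proof (cases "x \<in> U")
        case True
        have "(\<lambda>n. x - h n) \<longlonglongrightarrow> x - 0" by (intro tendsto_intros h)
        then have "eventually (\<lambda>n. x - h n \<in> U) sequentially"
          using topological_tendstoD[OF _ U(1)] True by simp
        then have "eventually (\<lambda>n. indicator U x * indicator U (x - h n) = (indicator U x :: real)) sequentially"
          by eventually_elim (simp add: True)
        then show ?thesis by (rule tendsto_eventually)
      qed simp
    qed
    show "AE x in lborel. norm (indicator U x * indicator U (x - h n) :: real) \<le> indicator U x" for n
      by (auto simp: indicator_def)
  qed (use intU in auto)
  \<comment> \<open>For indicators |a - b| = a + b - 2ab. This moves the limit to the overlap of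
    \<open>U\<close> with its translate, where pointwise convergence holds everywhere; the boundary
    of \<open>U\<close> may have positive measure.\<close>
  have dU: "(\<integral>x. \<bar>indicator U (x - h n) - indicator U x\<bar> \<partial>lborel)
     = 2 * (\<integral>x. indicator U x \<partial>lborel) - 2 * (\<integral>x. indicator U x * indicator U (x - h n) \<partial>lborel :: real)" for n
  proof -
    have ip: "integrable lborel (\<lambda>x. indicator U x * indicator U (x - h n) :: real)"
      by (rule Bochner_Integration.integrable_bound[OF intU]) (auto simp: indicator_def)
    have "(\<integral>x. \<bar>indicator U (x - h n) - indicator U x\<bar> \<partial>lborel)
       = (\<integral>x. (indicator U (x - h n) + indicator U x) - 2 * (indicator U x * indicator U (x - h n) :: real) \<partial>lborel)"
      by (intro Bochner_Integration.integral_cong) (auto simp: indicator_def)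
    also have "\<dots> = ((\<integral>x. indicator U (x - h n) \<partial>lborel) + (\<integral>x. indicator U x \<partial>lborel))
        - 2 * (\<integral>x. indicator U x * indicator U (x - h n) \<partial>lborel :: real)"
      using shift(2)[OF intU, of n] intU ip by simp
    finally show ?thesis using shift(1)[OF intU, of n] by simp
  qed
  have "(\<lambda>n. \<integral>x. \<bar>indicator U (x - h n) - indicator U x\<bar> \<partial>lborel :: real)
      \<longlonglongrightarrow> 2 * (\<integral>x. indicator U x \<partial>lborel) - 2 * (\<integral>x. indicator U x \<partial>lborel :: real)"
    unfolding dU by (intro tendsto_intros lim)
  then have "eventually (\<lambda>n. (\<integral>x. \<bar>indicator U (x - h n) - indicator U x\<bar> \<partial>lborel :: real) < e/2) sequentially"
    using e by (intro order_tendstoD) auto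
  then obtain N where N: "\<And>n. n \<ge> N \<Longrightarrow> (\<integral>x. \<bar>indicator U (x - h n) - indicator U x\<bar> \<partial>lborel :: real) < e/2"
    by (auto simp: eventually_sequentially)
  have [simp]: "U - A \<in> sets borel" using A(1) U(1) by auto
  have intD: "integrable lborel (indicator (U - A) :: 'b \<Rightarrow> real)"
    using Ufin A(1) U(1) by (intro integrable_real_indicator) (auto intro: le_less_trans[OF emeasure_mono])
  have D: "(\<integral>x. indicator (U - A) x \<partial>lborel :: real) < e / 4"
  proof -
    have "ennreal (\<integral>x. indicator (U - A) x \<partial>lborel) = emeasure lborel (U - A)"
      using intD by (subst nn_integral_eq_integral[symmetric]) (auto simp: ennreal_indicator)
    then show ?thesis using U(3) e by (metis ennreal_less_iff integral_nonneg_AE AE_I2 indicator_pos_le)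
  qed
  have "norm ((\<integral>x. \<bar>indicator A (x - h n) - indicator A x\<bar> \<partial>lborel :: real) - 0) < e" if "n \<ge> N" for n
  proof -
    have iU: "integrable lborel (\<lambda>x. \<bar>indicator U (x - h n) - indicator U x\<bar> :: real)"
      using shift(2)[OF intU] intU by (intro integrable_abs Bochner_Integration.integrable_diff)
    have iD: "integrable lborel (\<lambda>x. indicator (U - A) (x - h n) :: real)" by (rule shift(2)[OF intD])
    have "(\<integral>x. \<bar>indicator A (x - h n) - indicator A x\<bar> \<partial>lborel :: real)
       \<le> (\<integral>x. \<bar>indicator U (x - h n) - indicator U x\<bar> + (indicator (U - A) (x - h n) + indicator (U - A) x) \<partial>lborel)"
    proof (rule integral_mono)
      show "integrable lborel (\<lambda>x. \<bar>indicator A (x - h n) - indicator A x\<bar> :: real)"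
        using shift(2)[OF intA, of n] intA by (intro integrable_abs Bochner_Integration.integrable_diff)
      show "integrable lborel (\<lambda>x. \<bar>indicator U (x - h n) - indicator U x\<bar> + (indicator (U - A) (x - h n) + indicator (U - A) x) :: real)"
        using iU iD intD by (intro Bochner_Integration.integrable_add)
    qed (use U(2) in \<open>auto simp: indicator_def\<close>)
    also have "\<dots> = (\<integral>x. \<bar>indicator U (x - h n) - indicator U x\<bar> \<partial>lborel) + 2 * (\<integral>x. indicator (U - A) x \<partial>lborel)"
      using iU iD intD shift(1)[OF intD, of n] by simp
    also have "\<dots> < e" using N[OF that] D by simp
    finally show ?thesis by simp
  qed
  then show "\<exists>no. \<forall>n\<ge>no. norm ((\<integral>x. \<bar>indicator A (x - h n) - indicator A x\<bar> \<partial>lborel :: real) - 0) < e" by blast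
qed

lemma integrable_translate:
  fixes f :: "'b::euclidean_space \<Rightarrow> 'c::{banach, second_countable_topology}"
  assumes "integrable lborel f"
  shows "integrable lborel (\<lambda>x. f (x - h))" "(\<integral>x. f (x - h) \<partial>lborel) = (\<integral>x. f x \<partial>lborel)"
  using integral_lborel_affine[of f 1 "- h"] integrable_lborel_affine_iff[of f 1 "- h"] assms
    borel_measurable_integrable[OF assms] by simp_all

text \<open>The density argument, run as an induction over integrable functions: indicators, sums
  and dominated limits.\<close>

lemma L1_translation_tendsto:
  fixes f :: "'b::euclidean_space \<Rightarrow> complex"
  assumes "integrable lborel f" and h: "h \<longlonglongrightarrow> 0"
  shows "(\<lambda>n. \<integral>x. cmod (f (x - h n) - f x) \<partial>lborel) \<longlonglongrightarrow> 0"
  using assms(1)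
proof induct
  case (base A c)
  have "(\<lambda>n. cmod c * (\<integral>x. \<bar>indicator A (x - h n) - indicator A x\<bar> \<partial>lborel)) \<longlonglongrightarrow> cmod c * 0"
    by (intro tendsto_intros translation_tendsto_indicator base h)
  moreover have "cmod (indicator A (x - h n) *\<^sub>R c - indicator A x *\<^sub>R c) = cmod c * \<bar>indicator A (x - h n) - indicator A x\<bar>" for x n
    by (simp add: mult.commute flip: scaleR_left_diff_distrib)
  ultimately show ?case by simp
next
  case (add f g)
  have lim: "(\<lambda>n. (\<integral>x. cmod (f (x - h n) - f x) \<partial>lborel) + (\<integral>x. cmod (g (x - h n) - g x) \<partial>lborel)) \<longlonglongrightarrow> 0"
    using tendsto_add[OF add(2,4)] by simp
  have le: "(\<integral>x. cmod (f (x - h n) + g (x - h n) - (f x + g x)) \<partial>lborel)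
     \<le> (\<integral>x. cmod (f (x - h n) - f x) \<partial>lborel) + (\<integral>x. cmod (g (x - h n) - g x) \<partial>lborel)" for n
  proof -
    note t = integrable_translate(1)[OF add(1), of "h n"] integrable_translate(1)[OF add(3), of "h n"] add(1,3)
    have "(\<integral>x. cmod (f (x - h n) + g (x - h n) - (f x + g x)) \<partial>lborel)
       \<le> (\<integral>x. cmod (f (x - h n) - f x) + cmod (g (x - h n) - g x) \<partial>lborel)"
      using t by (intro integral_mono) (auto simp: add_diff_add norm_triangle_ineq)
    then show ?thesis using t by simp
  qed
  show ?case
    by (rule Lim_null_comparison[OF always_eventually lim]) (use le in simp)
next
  case (lim f s)
  have sf: "(\<lambda>i. \<integral>x. cmod (s i x - f x) \<partial>lborel) \<longlonglongrightarrow> (\<integral>x. cmod (0::complex) \<partial>(lborel :: 'b measure))"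
  proof (rule integral_dominated_convergence[where w="\<lambda>x. 3 * cmod (f x)"])
    show "AE x in lborel. (\<lambda>i. cmod (s i x - f x)) \<longlonglongrightarrow> cmod 0"
      using lim(3) by (intro always_eventually allI tendsto_norm) (simp add: LIM_zero)
    show "AE x in lborel. norm (cmod (s i x - f x)) \<le> 3 * cmod (f x)" for i
    proof (intro always_eventually allI)
      fix x show "norm (cmod (s i x - f x)) \<le> 3 * cmod (f x)"
        using lim(4)[of x i] norm_triangle_ineq4[of "s i x" "f x"] by simp
    qed
  qed (use lim(1,5) in auto)
  show ?case
  proof (rule LIMSEQ_I)
    fix e :: real assume e: "e > 0"
    have "eventually (\<lambda>i. (\<integral>x. cmod (s i x - f x) \<partial>lborel) < e / 4) sequentially"
      using sf e by (intro order_tendstoD(2)) auto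
    then obtain i where i: "(\<integral>x. cmod (s i x - f x) \<partial>lborel) < e / 4" by (auto simp: eventually_sequentially)
    have "eventually (\<lambda>n. (\<integral>x. cmod (s i (x - h n) - s i x) \<partial>lborel) < e / 4) sequentially"
      using lim(2)[of i] e by (intro order_tendstoD(2)) auto
    then obtain N where N: "\<And>n. n \<ge> N \<Longrightarrow> (\<integral>x. cmod (s i (x - h n) - s i x) \<partial>lborel) < e / 4"
      by (auto simp: eventually_sequentially)
    have "norm ((\<integral>x. cmod (f (x - h n) - f x) \<partial>lborel) - 0) < e" if "n \<ge> N" for n
    proof -
      have d: "integrable lborel (\<lambda>x. s i x - f x)" using lim by auto
      note dt = integrable_translate[OF integrable_norm[OF d], of "h n"]
      note st = integrable_translate(1)[OF lim(1)[of i], of "h n"]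
      note ft = integrable_translate(1)[OF lim(5), of "h n"]
      have "(\<integral>x. cmod (f (x - h n) - f x) \<partial>lborel)
        \<le> (\<integral>x. cmod (s i (x - h n) - f (x - h n)) + (cmod (s i (x - h n) - s i x) + cmod (s i x - f x)) \<partial>lborel)"
      proof (rule integral_mono)
        show "cmod (f (x - h n) - f x) \<le> cmod (s i (x - h n) - f (x - h n)) + (cmod (s i (x - h n) - s i x) + cmod (s i x - f x))" for x
          using norm_triangle_ineq4[of "s i (x - h n) - s i x + (s i x - f x)" "s i (x - h n) - f (x - h n)"]
            norm_triangle_ineq[of "s i (x - h n) - s i x" "s i x - f x"] by simp
      qed (use dt(1) d st ft lim(1,5) in auto)
      also have "\<dots> = (\<integral>x. cmod (s i x - f x) \<partial>lborel) + ((\<integral>x. cmod (s i (x - h n) - s i x) \<partial>lborel) + (\<integral>x. cmod (s i x - f x) \<partial>lborel))"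
        using dt d st lim(1) by simp
      also have "\<dots> < e" using i N[OF that] e by linarith
      finally show ?thesis by simp
    qed
    then show "\<exists>no. \<forall>n\<ge>no. norm ((\<integral>x. cmod (f (x - h n) - f x) \<partial>lborel) - 0) < e" by blast
  qed
qed

lemma L2_translate:
  assumes "f \<in> L2"
  shows "(\<lambda>x. f (x - h)) \<in> L2" "L2_norm (\<lambda>x. f (x - h)) = L2_norm f"
  using assms integrable_translate[OF L2_integrable[OF assms], of h]
  by (auto simp: L2_norm_def L2_def)

text \<open>The difference \<open>d n\<close> is small in L1 but here only bounded in L2. Hence
  \<open>f\<close> is split into a part bounded by \<open>N\<close>, which is paired with the L1
  norm of \<open>d n\<close>, and the remainder \<open>r N\<close>, which is small in L2 for large
  \<open>N\<close>.\<close>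

lemma autocorrelation_tendsto:
  fixes f :: "'b::euclidean_space \<Rightarrow> complex"
  assumes f: "f \<in> L2" "integrable lborel f" and h: "h \<longlonglongrightarrow> 0"
  shows "(\<lambda>n. \<integral>x. f x * cnj (f (x - h n)) \<partial>lborel) \<longlonglongrightarrow> L2_inner f f"
proof -
  note [measurable] = L2D[OF f(1)]
  define d where "d n = (\<lambda>x. f (x - h n) - f x)" for n
  have d: "d n \<in> L2" for n unfolding d_def by (intro L2_diff L2_translate f)
  have dint: "integrable lborel (d n)" for n
    unfolding d_def by (intro Bochner_Integration.integrable_diff integrable_translate f)
  have dn: "L2_norm (d n) \<le> 2 * L2_norm f" for n
    using L2.nrm_triangle[OF L2_translate(1)[OF f(1), of "h n"] L2.scale_mem[OF f(1), of "-1"]] L2.nrm_scale[OF f(1), of "-1"]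
    by (simp add: d_def L2_nrm_eq L2_translate f)
  have L1: "(\<lambda>n. \<integral>x. cmod (d n x) \<partial>lborel) \<longlonglongrightarrow> 0"
    unfolding d_def by (intro L1_translation_tendsto f h)
  define r where "r N = (\<lambda>x. if cmod (f x) \<le> real N then 0 else f x)" for N :: nat
  have r: "r N \<in> L2" for N unfolding r_def by (rule L2_bound[OF f(1), of _ 1]) auto
  have "(\<lambda>N. \<integral>x. (cmod (r N x))\<^sup>2 \<partial>lborel) \<longlonglongrightarrow> (\<integral>x. 0 \<partial>(lborel :: 'b measure))"
  proof (rule integral_dominated_convergence[where w="\<lambda>x. (cmod (f x))\<^sup>2"])
    show "AE x in lborel. (\<lambda>N. (cmod (r N x))\<^sup>2) \<longlonglongrightarrow> 0"
    proof (intro always_eventually allI)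
      fix x
      have "eventually (\<lambda>N. (cmod (r N x))\<^sup>2 = 0) sequentially"
        using eventually_ge_at_top[of "nat \<lceil>cmod (f x)\<rceil>"]
        by eventually_elim (auto simp: r_def nat_ceiling_le_eq)
      then show "(\<lambda>N. (cmod (r N x))\<^sup>2) \<longlonglongrightarrow> 0" by (rule tendsto_eventually)
    qed
    show "AE x in lborel. norm ((cmod (r N x))\<^sup>2) \<le> (cmod (f x))\<^sup>2" for N
      by (auto simp: r_def)
  qed (use L2_integrable[OF f(1)] L2D[OF r] in measurable)
  then have rlim: "(\<lambda>N. (L2_norm (r N))\<^sup>2) \<longlonglongrightarrow> 0" by (simp add: L2_norm_sq)
  have bound: "cmod (L2_inner f (d n)) \<le> real N * (\<integral>x. cmod (d n x) \<partial>lborel) + L2_norm (r N) * (2 * L2_norm f)" for n N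
  proof -
    define g where "g = (\<lambda>x. f x - r N x)"
    have g: "g \<in> L2" unfolding g_def by (intro L2_diff f r)
    have gN: "cmod (g x) \<le> real N" for x by (auto simp: g_def r_def)
    have "L2_inner f (d n) = L2_inner g (d n) + L2_inner (r N) (d n)"
      using L2.B_add[OF g r d, of N n] by (simp add: g_def)
    moreover have "cmod (L2_inner (r N) (d n)) \<le> L2_norm (r N) * (2 * L2_norm f)"
      using L2.Cauchy_Schwarz[OF r d, of N n] mult_left_mono[OF dn[of n] L2_norm_nonneg[of "r N"]]
      by (simp add: L2_nrm_eq)
    moreover have "cmod (L2_inner g (d n)) \<le> real N * (\<integral>x. cmod (d n x) \<partial>lborel)"
    proof -
      have "cmod (L2_inner g (d n)) \<le> (\<integral>x. cmod (g x * cnj (d n x)) \<partial>lborel)"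
        unfolding L2_inner_def by (rule integral_norm_bound)
      also have "\<dots> \<le> (\<integral>x. real N * cmod (d n x) \<partial>lborel)"
        using gN integrable_norm[OF L2_mult_integrable[OF g d]] dint
        by (intro integral_mono) (auto simp: norm_mult intro!: mult_right_mono)
      finally show ?thesis by simp
    qed
    ultimately show ?thesis using norm_triangle_ineq[of "L2_inner g (d n)" "L2_inner (r N) (d n)"] by simp
  qed
  have lim: "(\<lambda>n. L2_inner f (d n)) \<longlonglongrightarrow> 0"
  proof (rule LIMSEQ_I)
    fix e :: real assume e: "e > 0"
    have "(\<lambda>N. sqrt ((L2_norm (r N))\<^sup>2) * (2 * L2_norm f)) \<longlonglongrightarrow> sqrt 0 * (2 * L2_norm f)"
      by (intro tendsto_intros rlim)
    then have "eventually (\<lambda>N. L2_norm (r N) * (2 * L2_norm f) < e / 2) sequentially"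
      using e by (intro order_tendstoD(2)) auto
    then obtain N where N: "L2_norm (r N) * (2 * L2_norm f) < e / 2" by (auto simp: eventually_sequentially)
    have "(\<lambda>n. real N * (\<integral>x. cmod (d n x) \<partial>lborel)) \<longlonglongrightarrow> real N * 0" by (intro tendsto_intros L1)
    then have "eventually (\<lambda>n. real N * (\<integral>x. cmod (d n x) \<partial>lborel) < e / 2) sequentially"
      using e by (intro order_tendstoD(2)) auto
    then obtain M where M: "\<And>n. n \<ge> M \<Longrightarrow> real N * (\<integral>x. cmod (d n x) \<partial>lborel) < e / 2"
      by (auto simp: eventually_sequentially)
    have "norm (L2_inner f (d n) - 0) < e" if "n \<ge> M" for n
      using bound[of n N] M[OF that] N by simp
    then show "\<exists>no. \<forall>n\<ge>no. norm (L2_inner f (d n) - 0) < e" by blast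
  qed
  have "(\<lambda>n. L2_inner f (d n) + L2_inner f f) \<longlonglongrightarrow> 0 + L2_inner f f"
    by (intro tendsto_intros lim)
  moreover have "L2_inner f (d n) + L2_inner f f = (\<integral>x. f x * cnj (f (x - h n)) \<partial>lborel)" for n
    using L2.B_diff_right[OF L2_translate(1)[OF f(1), of "h n"] f(1) f(1)] by (simp add: d_def L2_inner_def)
  ultimately show ?thesis by simp
qed

section \<open>Fourier integrals of integrable functions and the Plancherel identity for
  them\<close>

lemma fourier_L1_measurable [measurable]:
  fixes f :: "'b::euclidean_space \<Rightarrow> complex"
  assumes [measurable]: "f \<in> borel_measurable borel"
  shows "fourier_L1 f \<in> borel_measurable borel"
proof -
  have "(\<lambda>\<xi>. \<integral>x. exp (- \<i> * complex_of_real (\<xi> \<bullet> x)) * f x \<partial>lborel) \<in> borel_measurable borel"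
    by measurable
  then show ?thesis unfolding fourier_L1_def by measurable
qed

lemma cmod_exp_i [simp]: "cmod (exp (- \<i> * complex_of_real t)) = 1"
  by (simp add: norm_exp_eq_Re)

lemma fourier_L1_bound:
  fixes f :: "'b::euclidean_space \<Rightarrow> complex"
  shows "cmod (fourier_L1 f \<xi>) \<le> (2 * pi) powr (- real DIM('b) / 2) * (\<integral>x. cmod (f x) \<partial>lborel)"
proof -
  have "cmod (\<integral>x. exp (- \<i> * complex_of_real (\<xi> \<bullet> x)) * f x \<partial>lborel) \<le> (\<integral>x. cmod (exp (- \<i> * complex_of_real (\<xi> \<bullet> x)) * f x) \<partial>lborel)"
    by (rule integral_norm_bound)
  also have "\<dots> = (\<integral>x. cmod (f x) \<partial>lborel)" by (simp add: norm_mult)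
  finally show ?thesis by (simp add: fourier_L1_def norm_mult mult_left_mono)
qed

lemma integrable_exp_mult:
  fixes f :: "'b::euclidean_space \<Rightarrow> complex"
  assumes "integrable lborel f"
  shows "integrable lborel (\<lambda>x. exp (- \<i> * complex_of_real (\<xi> \<bullet> x)) * f x)"
  by (rule Bochner_Integration.integrable_bound[OF assms])
    (use borel_measurable_integrable[OF assms] in \<open>auto simp: norm_mult\<close>)

text \<open>Fubini's theorem, after substituting \<open>y = x - e w\<close> in the double integral of
  \<open>f x * cnj (f y)\<close> against the Gaussian \<open>(2 \<pi>)\<^sup>-\<^sup>d e\<^sup>-\<^sup>d exp (- |x - y|\<^sup>2 / 2 e\<^sup>2)\<close>.\<close>

lemma gaussian_regularised_plancherel:
  fixes f :: "'b::euclidean_space \<Rightarrow> complex"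
  assumes f: "f \<in> L2" "integrable lborel f" and e: "e > 0"
  defines "c \<equiv> (2 * pi) powr (- real DIM('b) / 2)"
  shows "(\<integral>\<xi>. complex_of_real ((cmod (fourier_L1 f \<xi>))\<^sup>2 * exp (- (norm (e *\<^sub>R \<xi>))\<^sup>2 / 2)) \<partial>lborel)
    = complex_of_real c * (\<integral>w. complex_of_real (exp (- (norm w)\<^sup>2 / 2)) * (\<integral>x. f x * cnj (f (x - e *\<^sub>R w)) \<partial>lborel) \<partial>lborel)"
proof -
  note [measurable] = L2D[OF f(1)]
  define E where "E = (\<lambda>\<xi>::'b. exp (- (norm (e *\<^sub>R \<xi>))\<^sup>2 / 2))"
  define G where "G = (\<lambda>v::'b. exp (- (norm (inverse e *\<^sub>R v))\<^sup>2 / 2))"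
  define P where "P = (\<lambda>(x, y). f x * cnj (f y))"
  have [measurable]: "E \<in> borel_measurable borel" "G \<in> borel_measurable borel" unfolding E_def G_def by measurable
  have E_int: "integrable lborel E" unfolding E_def by (rule gaussian_fourier_scaled[OF e])
  have G_le: "\<bar>G v\<bar> \<le> 1" for v by (simp add: G_def)
  have cf: "integrable lborel (\<lambda>x. cnj (f x))" using f(2) by simp
  have P_int: "integrable (lborel \<Otimes>\<^sub>M lborel) P"
    unfolding P_def by (rule lborel_pair.integrable_pair_mult[OF f(2) cf])
  then have P_int': "integrable lborel P" by (simp add: lborel_prod)
  note [measurable] = borel_measurable_integrable[OF P_int'] borel_measurable_integrable[OF P_int]
  define X where "X = (\<lambda>\<xi> (p :: 'b \<times> 'b). exp (- \<i> * complex_of_real (\<xi> \<bullet> (fst p - snd p))) * P p)"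
  have FF: "complex_of_real ((cmod (fourier_L1 f \<xi>))\<^sup>2) = complex_of_real (c\<^sup>2) * (\<integral>p. X \<xi> p \<partial>lborel)" for \<xi>
  proof -
    let ?a = "\<lambda>x. exp (- \<i> * complex_of_real (\<xi> \<bullet> x)) * f x"
    have a: "integrable lborel ?a" by (rule integrable_exp_mult[OF f(2)])
    have ca: "integrable lborel (\<lambda>x. cnj (?a x))" using a by (rule integrable_cnj)
    have "complex_of_real ((cmod (fourier_L1 f \<xi>))\<^sup>2) = fourier_L1 f \<xi> * cnj (fourier_L1 f \<xi>)"
      by (rule mult_cnj_cmod[symmetric])
    also have "\<dots> = complex_of_real (c\<^sup>2) * ((\<integral>x. ?a x \<partial>lborel) * (\<integral>x. cnj (?a x) \<partial>lborel))"
      unfolding Bochner_Integration.integral_cnj by (simp add: fourier_L1_def c_def power2_eq_square)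
    also have "(\<integral>x. ?a x \<partial>lborel) * (\<integral>x. cnj (?a x) \<partial>lborel) = (\<integral>(x, y). ?a x * cnj (?a y) \<partial>(lborel \<Otimes>\<^sub>M lborel))"
      by (rule lborel_pair.integral_pair_mult[OF a ca, symmetric])
    also have "(\<lambda>(x, y). ?a x * cnj (?a y)) = X \<xi>"
      by (auto simp: fun_eq_iff X_def P_def inner_diff_right exp_diff exp_minus exp_cnj field_simps)
    finally show ?thesis by (simp add: lborel_prod)
  qed
  \<comment> \<open>Integrating over \<xi> first turns the frequency cut-off \<open>E\<close> into
    the Gaussian \<open>G\<close> of width \<open>e\<close> in \<open>fst p - snd p\<close>.\<close>
  have inner: "(\<integral>\<xi>. complex_of_real (E \<xi>) * X \<xi> p \<partial>lborel)
     = complex_of_real (inverse e ^ DIM('b) / c) * (P p * complex_of_real (G (fst p - snd p)))" for p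
  proof -
    have "(\<integral>\<xi>. complex_of_real (E \<xi>) * X \<xi> p \<partial>lborel)
      = (\<integral>\<xi>. exp (- \<i> * complex_of_real (\<xi> \<bullet> (fst p - snd p))) * complex_of_real (E \<xi>) * P p \<partial>lborel)"
      by (simp add: X_def mult_ac)
    also have "\<dots> = (\<integral>\<xi>. exp (- \<i> * complex_of_real (\<xi> \<bullet> (fst p - snd p))) * complex_of_real (E \<xi>) \<partial>lborel) * P p"
      by (rule integral_mult_left_zero)
    also have "\<dots> = complex_of_real (inverse e ^ DIM('b) / c) * (P p * complex_of_real (G (fst p - snd p)))"
    proof -
      have "(\<integral>\<xi>. exp (- \<i> * complex_of_real (\<xi> \<bullet> (fst p - snd p))) * complex_of_real (E \<xi>) \<partial>lborel)
         = complex_of_real (inverse e ^ DIM('b) * ((2 * pi) powr (real DIM('b) / 2) * G (fst p - snd p)))"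
        unfolding E_def G_def by (rule gaussian_fourier_scaled(2)[OF e])
      moreover have "inverse c = (2 * pi) powr (real DIM('b) / 2)" by (simp add: c_def powr_minus)
      ultimately show ?thesis by (simp only: divide_inverse of_real_mult mult_ac)
    qed
    finally show ?thesis .
  qed
  have [measurable]: "(\<lambda>x. fst (snd x)) \<in> borel_measurable ((lborel :: 'b measure) \<Otimes>\<^sub>M (lborel :: ('b \<times> 'b) measure))"
    "(\<lambda>x. snd (snd x)) \<in> borel_measurable ((lborel :: 'b measure) \<Otimes>\<^sub>M (lborel :: ('b \<times> 'b) measure))"
    "(\<lambda>x. P (snd x)) \<in> borel_measurable ((lborel :: 'b measure) \<Otimes>\<^sub>M (lborel :: ('b \<times> 'b) measure))"
    by (rule measurable_compose[OF measurable_snd];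
        use borel_measurable_integrable[OF P_int'] in \<open>auto intro!: borel_measurable_continuous_onI continuous_intros\<close>)+
  have [measurable]: "(\<lambda>x. X (fst x) (snd x)) \<in> borel_measurable ((lborel :: 'b measure) \<Otimes>\<^sub>M (lborel :: ('b \<times> 'b) measure))"
    unfolding X_def by measurable
  \<comment> \<open>The cut-off \<open>E\<close> is what makes the integral over all three variables
    absolutely convergent; \<open>P\<close> is integrable because \<open>f\<close> is.\<close>
  have big: "integrable (lborel \<Otimes>\<^sub>M lborel) (\<lambda>(\<xi>, p). complex_of_real (E \<xi>) * X \<xi> p)"
  proof (rule Bochner_Integration.integrable_bound)
    show "integrable (lborel \<Otimes>\<^sub>M lborel) (\<lambda>(\<xi>, p). complex_of_real (E \<xi>) * P p)"
      by (rule lborel_pair.integrable_pair_mult) (use E_int P_int' in auto)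
    show "AE x in lborel \<Otimes>\<^sub>M lborel. norm (case x of (\<xi>, p) \<Rightarrow> complex_of_real (E \<xi>) * X \<xi> p)
       \<le> norm (case x of (\<xi>, p) \<Rightarrow> complex_of_real (E \<xi>) * P p)"
      by (intro always_eventually) (auto simp: X_def norm_mult)
  qed (unfold case_prod_beta, measurable)
  have "(\<integral>\<xi>. complex_of_real ((cmod (fourier_L1 f \<xi>))\<^sup>2 * E \<xi>) \<partial>lborel)
      = (\<integral>\<xi>. complex_of_real (c\<^sup>2) * (\<integral>p. complex_of_real (E \<xi>) * X \<xi> p \<partial>lborel) \<partial>lborel)"
    unfolding of_real_mult FF by (simp add: mult_ac)
  also have "\<dots> = complex_of_real (c\<^sup>2) * (\<integral>p. (\<integral>\<xi>. complex_of_real (E \<xi>) * X \<xi> p \<partial>lborel) \<partial>lborel)"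
    by (simp add: lborel_pair.Fubini_integral[OF big])
  also have "\<dots> = complex_of_real (c * inverse e ^ DIM('b)) * (\<integral>p. P p * complex_of_real (G (fst p - snd p)) \<partial>lborel)"
  proof -
    have "c\<^sup>2 * (inverse e ^ DIM('b) / c) = c * inverse e ^ DIM('b)"
      by (simp add: c_def power2_eq_square)
    then show ?thesis
      unfolding inner integral_mult_right_zero by (simp only: mult.assoc[symmetric] of_real_mult[symmetric])
  qed
  also have "(\<integral>p. P p * complex_of_real (G (fst p - snd p)) \<partial>lborel)
     = (\<integral>x. (\<integral>y. f x * cnj (f y) * complex_of_real (G (x - y)) \<partial>lborel) \<partial>lborel)"
  proof -
    have "integrable (lborel \<Otimes>\<^sub>M lborel) (\<lambda>p. P p * complex_of_real (G (fst p - snd p)))"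
      by (rule Bochner_Integration.integrable_bound[OF P_int])
        (auto simp: norm_mult intro!: mult_right_le_one_le G_le)
    from lborel_pair.integral_fst'[OF this] show ?thesis by (simp add: lborel_prod P_def)
  qed
  \<comment> \<open>The Jacobian \<open>e ^ DIM('b)\<close> of this substitution cancels the power
    of \<open>inverse e\<close> left by the Gaussian integral.\<close>
  also have "\<dots> = (\<integral>x. complex_of_real (e ^ DIM('b)) * (\<integral>w. f x * cnj (f (x - e *\<^sub>R w)) * complex_of_real (G (e *\<^sub>R w)) \<partial>lborel) \<partial>lborel)"
  proof (intro Bochner_Integration.integral_cong refl)
    fix x
    show "(\<integral>y. f x * cnj (f y) * complex_of_real (G (x - y)) \<partial>lborel)
        = complex_of_real (e ^ DIM('b)) * (\<integral>w. f x * cnj (f (x - e *\<^sub>R w)) * complex_of_real (G (e *\<^sub>R w)) \<partial>lborel)"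
      using e by (subst integral_lborel_affine[of _ "- e" x]) (auto simp: scaleR_conv_of_real)
  qed
  also have "\<dots> = complex_of_real (e ^ DIM('b)) * (\<integral>x. (\<integral>w. complex_of_real (exp (- (norm w)\<^sup>2 / 2)) * (f x * cnj (f (x - e *\<^sub>R w))) \<partial>lborel) \<partial>lborel)"
  proof -
    have Gew: "G (e *\<^sub>R w) = exp (- (norm w)\<^sup>2 / 2)" for w using e by (simp add: G_def)
    show ?thesis unfolding Gew integral_mult_right_zero by (simp only: mult_ac)
  qed
  also have "(\<integral>x. (\<integral>w. complex_of_real (exp (- (norm w)\<^sup>2 / 2)) * (f x * cnj (f (x - e *\<^sub>R w))) \<partial>lborel) \<partial>lborel)
      = (\<integral>w. (\<integral>x. complex_of_real (exp (- (norm w)\<^sup>2 / 2)) * (f x * cnj (f (x - e *\<^sub>R w))) \<partial>lborel) \<partial>lborel)"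
  proof (rule lborel_pair.Fubini_integral)
    let ?F = "\<lambda>(w, x). complex_of_real (exp (- (norm w)\<^sup>2 / 2)) * (f x * cnj (f (x - e *\<^sub>R w)))"
    have L: "(\<lambda>x. f (x - e *\<^sub>R w)) \<in> L2" for w by (intro L2_translate f)
    have "integrable (lborel \<Otimes>\<^sub>M lborel) ?F"
    proof (rule lborel_pair.Fubini_integrable)
      show "AE w in lborel. integrable lborel (\<lambda>x. ?F (w, x))"
        using L2_mult_integrable[OF f(1) L] by simp
      show "integrable lborel (\<lambda>w. \<integral>x. norm (?F (w, x)) \<partial>lborel)"
      proof (rule Bochner_Integration.integrable_bound)
        show "integrable lborel (\<lambda>w::'b. exp (- (norm w)\<^sup>2 / 2) * (2 * (L2_norm f)\<^sup>2))"
          by (intro integrable_mult_left integrable_gaussian)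
        show "AE w in lborel. norm (\<integral>x. norm (?F (w, x)) \<partial>lborel) \<le> norm (exp (- (norm w)\<^sup>2 / 2) * (2 * (L2_norm f)\<^sup>2))"
        proof (intro always_eventually allI)
          fix w :: 'b
          have "(\<integral>x. cmod (f x * cnj (f (x - e *\<^sub>R w))) \<partial>lborel) \<le> (\<integral>x. (cmod (f x))\<^sup>2 + (cmod (f (x - e *\<^sub>R w)))\<^sup>2 \<partial>lborel)"
          proof (rule integral_mono)
            fix x show "cmod (f x * cnj (f (x - e *\<^sub>R w))) \<le> (cmod (f x))\<^sup>2 + (cmod (f (x - e *\<^sub>R w)))\<^sup>2"
              using mult_le_sum_squares[OF norm_ge_zero[of "f x"] norm_ge_zero[of "f (x - e *\<^sub>R w)"]]
              by (simp add: norm_mult)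
          qed (use L2_mult_integrable[OF f(1) L] L2_integrable[OF f(1)] L2_integrable[OF L] in auto)
          also have "\<dots> = (L2_norm f)\<^sup>2 + (L2_norm (\<lambda>x. f (x - e *\<^sub>R w)))\<^sup>2"
            using L2_integrable[OF f(1)] L2_integrable[OF L, of w] by (simp add: L2_norm_sq)
          also have "\<dots> = 2 * (L2_norm f)\<^sup>2" using L2_translate(2)[OF f(1)] by simp
          finally show "norm (\<integral>x. norm (?F (w, x)) \<partial>lborel) \<le> norm (exp (- (norm w)\<^sup>2 / 2) * (2 * (L2_norm f)\<^sup>2))"
            by (simp add: norm_mult abs_mult integral_nonneg_AE)
        qed
      qed measurable
    qed measurable
    then show "integrable (lborel \<Otimes>\<^sub>M lborel) ?F" .
  qed
  finally have "(\<integral>\<xi>. complex_of_real ((cmod (fourier_L1 f \<xi>))\<^sup>2 * E \<xi>) \<partial>lborel)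
    = complex_of_real (c * inverse e ^ DIM('b)) * (complex_of_real (e ^ DIM('b)) *
      (\<integral>w. complex_of_real (exp (- (norm w)\<^sup>2 / 2)) * (\<integral>x. f x * cnj (f (x - e *\<^sub>R w)) \<partial>lborel) \<partial>lborel))"
    by (simp only: integral_mult_right_zero)
  moreover have "c * inverse e ^ DIM('b) * e ^ DIM('b) = c"
    using e by (simp add: power_inverse)
  ultimately show ?thesis unfolding E_def mult.assoc[symmetric] of_real_mult[symmetric] by (simp only:)
qed

text \<open>The regularisation is removed along \<open>e = inverse (real (Suc n))\<close>: the
  rescaled Gaussian average of the autocorrelation tends to its value at 0, which is the squared
  norm of \<open>f\<close>.\<close>

theorem plancherel_L1_L2:
  fixes f :: "'b::euclidean_space \<Rightarrow> complex"
  assumes f: "f \<in> L2" "integrable lborel f"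
  shows "fourier_L1 f \<in> L2" "L2_norm (fourier_L1 f) = L2_norm f"
proof -
  note [measurable] = L2D[OF f(1)]
  define c where "c = (2 * pi) powr (- real DIM('b) / 2)"
  define A where "A = (\<lambda>n \<xi>. (cmod (fourier_L1 f \<xi>))\<^sup>2 * exp (- (norm (inverse (real (Suc n)) *\<^sub>R \<xi>))\<^sup>2 / 2))"
  define C where "C = (\<lambda>h. \<integral>x. f x * cnj (f (x - h)) \<partial>lborel)"
  have C_meas [measurable]: "C \<in> borel_measurable borel" unfolding C_def by measurable
  have C_le: "cmod (C h) \<le> (L2_norm f)\<^sup>2" for h
    using L2.Cauchy_Schwarz[OF f(1) L2_translate(1)[OF f(1)], of h] L2_translate(2)[OF f(1), of h]
    by (simp add: L2_nrm_eq L2_inner_def C_def power2_eq_square)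
  have A_eq: "(\<integral>\<xi>. complex_of_real (A n \<xi>) \<partial>lborel)
      = complex_of_real c * (\<integral>w. complex_of_real (exp (- (norm w)\<^sup>2 / 2)) * C (inverse (real (Suc n)) *\<^sub>R w) \<partial>lborel)" for n
    unfolding A_def C_def c_def by (rule gaussian_regularised_plancherel[OF f]) simp
  have Clim: "(\<lambda>n. \<integral>w. complex_of_real (exp (- (norm w)\<^sup>2 / 2)) * C (inverse (real (Suc n)) *\<^sub>R (w::'b)) \<partial>lborel)
     \<longlonglongrightarrow> (\<integral>w. complex_of_real (exp (- (norm (w::'b))\<^sup>2 / 2)) * L2_inner f f \<partial>lborel)"
  proof (rule integral_dominated_convergence[where w="\<lambda>w::'b. exp (- (norm w)\<^sup>2 / 2) * (L2_norm f)\<^sup>2"])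
    show "integrable lborel (\<lambda>w::'b. exp (- (norm w)\<^sup>2 / 2) * (L2_norm f)\<^sup>2)"
      by (intro integrable_mult_left integrable_gaussian)
    show "AE w in lborel. (\<lambda>n. complex_of_real (exp (- (norm w)\<^sup>2 / 2)) * C (inverse (real (Suc n)) *\<^sub>R w))
      \<longlonglongrightarrow> complex_of_real (exp (- (norm w)\<^sup>2 / 2)) * L2_inner f f"
    proof (intro always_eventually allI tendsto_intros)
      fix w :: 'b
      have "(\<lambda>n. inverse (real (Suc n)) *\<^sub>R w) \<longlonglongrightarrow> 0 *\<^sub>R w"
        by (intro tendsto_intros LIMSEQ_inverse_real_of_nat)
      then show "(\<lambda>n. C (inverse (real (Suc n)) *\<^sub>R w)) \<longlonglongrightarrow> L2_inner f f"
        unfolding C_def by (intro autocorrelation_tendsto f) simp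
    qed
    show "AE w in lborel. norm (complex_of_real (exp (- (norm w)\<^sup>2 / 2)) * C (inverse (real (Suc n)) *\<^sub>R w))
        \<le> exp (- (norm w)\<^sup>2 / 2) * (L2_norm f)\<^sup>2" for n
      using C_le by (intro always_eventually allI) (simp add: norm_mult)
  qed measurable
  have norm1: "complex_of_real c * (\<integral>w. complex_of_real (exp (- (norm (w::'b))\<^sup>2 / 2)) * L2_inner f f \<partial>lborel) = L2_inner f f"
  proof -
    have "(\<integral>w. complex_of_real (exp (- (norm (w::'b))\<^sup>2 / 2)) * L2_inner f f \<partial>lborel)
       = complex_of_real (\<integral>w. exp (- (norm (w::'b))\<^sup>2 / 2) \<partial>lborel) * L2_inner f f"
      by (simp only: integral_mult_left_zero integral_complex_of_real)
    then have "(\<integral>w. complex_of_real (exp (- (norm (w::'b))\<^sup>2 / 2)) * L2_inner f f \<partial>lborel)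
       = complex_of_real ((2 * pi) powr (real DIM('b) / 2)) * L2_inner f f"
      by (simp only: integral_gaussian)
    moreover have "c * (2 * pi) powr (real DIM('b) / 2) = 1"
      by (simp add: c_def powr_minus)
    ultimately show ?thesis by (simp only: mult.assoc[symmetric] of_real_mult[symmetric]) simp
  qed
  have "(\<lambda>n. \<integral>\<xi>. complex_of_real (A n \<xi>) \<partial>lborel) \<longlonglongrightarrow> L2_inner f f"
    using tendsto_mult[OF tendsto_const Clim, of "complex_of_real c"] unfolding A_eq norm1 .
  then have "(\<lambda>n. Re (\<integral>\<xi>. complex_of_real (A n \<xi>) \<partial>lborel)) \<longlonglongrightarrow> Re (L2_inner f f)" by (intro tendsto_intros)
  moreover have "Re (L2_inner f f) = (L2_norm f)\<^sup>2" using L2.nrm_sq[OF f(1)] by (simp add: L2_nrm_eq)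
  ultimately have Alim: "(\<lambda>n. \<integral>\<xi>. A n \<xi> \<partial>lborel) \<longlonglongrightarrow> (L2_norm f)\<^sup>2" by simp
  have [measurable]: "A n \<in> borel_measurable borel" for n unfolding A_def by measurable
  have A0: "0 \<le> A n \<xi>" for n \<xi> by (simp add: A_def)
  have F_bd: "cmod (fourier_L1 f \<xi>) \<le> c * (\<integral>x. cmod (f x) \<partial>lborel)" for \<xi>
    unfolding c_def by (rule fourier_L1_bound)
  have A_int: "integrable lborel (A n)" for n
  proof (rule Bochner_Integration.integrable_bound)
    show "integrable lborel (\<lambda>\<xi>::'b. (c * (\<integral>x. cmod (f x) \<partial>lborel))\<^sup>2 * exp (- (norm (inverse (real (Suc n)) *\<^sub>R \<xi>))\<^sup>2 / 2))"
      by (intro integrable_mult_right gaussian_fourier_scaled) simp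
    show "AE \<xi> in lborel. norm (A n \<xi>) \<le> norm ((c * (\<integral>x. cmod (f x) \<partial>lborel))\<^sup>2 * exp (- (norm (inverse (real (Suc n)) *\<^sub>R \<xi>))\<^sup>2 / 2))"
      by (intro always_eventually allI) (auto simp: A_def abs_mult intro!: mult_right_mono power_mono F_bd)
  qed measurable
  have pt: "(\<lambda>n. A n \<xi>) \<longlonglongrightarrow> (cmod (fourier_L1 f \<xi>))\<^sup>2" for \<xi>
  proof -
    have "(\<lambda>n. inverse (real (Suc n)) *\<^sub>R \<xi>) \<longlonglongrightarrow> 0 *\<^sub>R \<xi>"
      by (intro tendsto_intros LIMSEQ_inverse_real_of_nat)
    then have "(\<lambda>n. A n \<xi>) \<longlonglongrightarrow> (cmod (fourier_L1 f \<xi>))\<^sup>2 * exp (- (norm (0::'b))\<^sup>2 / 2)"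
      unfolding A_def by (intro tendsto_intros) auto
    then show ?thesis by simp
  qed
  \<comment> \<open>Fatou's lemma settles square integrability of the transform; only then can its
    squared modulus dominate the sequence and give the exact limit.\<close>
  have "(\<integral>\<^sup>+\<xi>. ennreal ((cmod (fourier_L1 f \<xi>))\<^sup>2) \<partial>lborel) = (\<integral>\<^sup>+\<xi>. liminf (\<lambda>n. ennreal (A n \<xi>)) \<partial>lborel)"
  proof (intro nn_integral_cong)
    fix \<xi>
    have "(\<lambda>n. ennreal (A n \<xi>)) \<longlonglongrightarrow> ennreal ((cmod (fourier_L1 f \<xi>))\<^sup>2)" by (intro tendsto_intros pt)
    then show "ennreal ((cmod (fourier_L1 f \<xi>))\<^sup>2) = liminf (\<lambda>n. ennreal (A n \<xi>))"
      by (metis lim_imp_Liminf trivial_limit_sequentially)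
  qed
  also have "\<dots> \<le> liminf (\<lambda>n. \<integral>\<^sup>+\<xi>. ennreal (A n \<xi>) \<partial>lborel)" by (intro nn_integral_liminf) measurable
  also have "\<dots> = liminf (\<lambda>n. ennreal (\<integral>\<xi>. A n \<xi> \<partial>lborel))"
    using A_int A0 by (simp add: nn_integral_eq_integral)
  also have "\<dots> = ennreal ((L2_norm f)\<^sup>2)"
    by (intro lim_imp_Liminf tendsto_intros Alim) simp
  finally show F: "fourier_L1 f \<in> L2" by (intro L2I_nn_integral) auto
  have "(\<lambda>n. \<integral>\<xi>. A n \<xi> \<partial>lborel) \<longlonglongrightarrow> (\<integral>\<xi>. (cmod (fourier_L1 f \<xi>))\<^sup>2 \<partial>lborel)"
  proof (rule integral_dominated_convergence[where w="\<lambda>\<xi>. (cmod (fourier_L1 f \<xi>))\<^sup>2"])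
    show "AE \<xi> in lborel. norm (A n \<xi>) \<le> (cmod (fourier_L1 f \<xi>))\<^sup>2" for n
      by (intro always_eventually allI) (auto simp: A_def abs_mult intro!: mult_right_le_one_le)
  qed (use L2_integrable[OF F] pt in auto)
  from LIMSEQ_unique[OF this Alim] show "L2_norm (fourier_L1 f) = L2_norm f"
    unfolding L2_norm_def[of "fourier_L1 f"] by simp
qed

section \<open>The Fourier transform on square-integrable functions\<close>

abbreviation cut :: "nat \<Rightarrow> ('b::euclidean_space \<Rightarrow> complex) \<Rightarrow> 'b \<Rightarrow> complex" where
  "cut n u \<equiv> (\<lambda>x. indicator (ball 0 (real n)) x * u x)"

lemma L2_indicator_mult:
  assumes "u \<in> L2" "S \<in> sets borel"
  shows "(\<lambda>x. indicator S x * u x) \<in> L2"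
  by (rule L2_bound[OF assms(1), of _ 1]) (use assms L2D[OF assms(1)] in \<open>auto simp: indicator_def\<close>)

lemma L2_indicator:
  fixes S :: "'b::euclidean_space set"
  assumes "S \<in> sets borel" "bounded S"
  shows "(indicator S :: 'b \<Rightarrow> complex) \<in> L2"
proof -
  have "(indicator S :: 'b \<Rightarrow> real) = (\<lambda>x. (cmod (indicator S x))\<^sup>2)"
    by (auto simp: indicator_def fun_eq_iff)
  moreover have "integrable lborel (indicator S :: 'b \<Rightarrow> real)"
    using assms emeasure_bounded_finite[OF assms(2)] by (intro integrable_real_indicator) auto
  ultimately show ?thesis using assms by (simp add: L2_def)
qed

lemma L2_integrable_bounded:
  assumes "u \<in> L2" "S \<in> sets borel" "bounded S"
  shows "integrable lborel (\<lambda>x. indicator S x * u x)"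
proof -
  have "cnj (indicator S x) = indicator S x" for x by (simp add: indicator_def)
  then show ?thesis
    using L2_mult_integrable[OF assms(1) L2_indicator[OF assms(2,3)]] by (simp add: mult.commute)
qed

lemma cut_L2: "u \<in> L2 \<Longrightarrow> cut n u \<in> L2"
  by (intro L2_indicator_mult) auto

lemma cut_integrable: "u \<in> L2 \<Longrightarrow> integrable lborel (cut n u)"
  by (intro L2_integrable_bounded) auto

lemma cut_tendsto:
  fixes u :: "'b::euclidean_space \<Rightarrow> complex"
  assumes u: "u \<in> L2"
  shows "(\<lambda>n. L2_norm (\<lambda>x. cut n u x - u x)) \<longlonglongrightarrow> 0"
proof -
  note [measurable] = L2D[OF u] L2D[OF cut_L2[OF u]]
  have "(\<lambda>n. \<integral>x. (cmod (cut n u x - u x))\<^sup>2 \<partial>lborel) \<longlonglongrightarrow> (\<integral>x. 0 \<partial>(lborel :: 'b measure))"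
  proof (rule integral_dominated_convergence[where w="\<lambda>x. (cmod (u x))\<^sup>2"])
    show "AE x in lborel. (\<lambda>n. (cmod (cut n u x - u x))\<^sup>2) \<longlonglongrightarrow> 0"
    proof (intro always_eventually allI)
      fix x
      have "eventually (\<lambda>n. (cmod (cut n u x - u x))\<^sup>2 = 0) sequentially"
        using eventually_gt_at_top[of "nat \<lceil>norm x\<rceil>"]
      proof eventually_elim
        case (elim n)
        then have "norm x < real n" by linarith
        then show ?case by (simp add: indicator_def)
      qed
      then show "(\<lambda>n. (cmod (cut n u x - u x))\<^sup>2) \<longlonglongrightarrow> 0" by (rule tendsto_eventually)
    qed
    show "AE x in lborel. norm ((cmod (cut n u x - u x))\<^sup>2) \<le> (cmod (u x))\<^sup>2" for n
      by (auto simp: indicator_def)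
  qed (use L2_integrable[OF u] in auto)
  then have "(\<lambda>n. sqrt (\<integral>x. (cmod (cut n u x - u x))\<^sup>2 \<partial>lborel)) \<longlonglongrightarrow> sqrt 0"
    by (intro tendsto_intros) simp
  then show ?thesis by (simp add: L2_norm_def)
qed

lemma fourier_L1_add:
  assumes "integrable lborel f" "integrable lborel g"
  shows "fourier_L1 (\<lambda>x. f x + g x) \<xi> = fourier_L1 f \<xi> + fourier_L1 g \<xi>"
  using integrable_exp_mult[OF assms(1), of \<xi>] integrable_exp_mult[OF assms(2), of \<xi>]
  by (simp add: fourier_L1_def distrib_left)

lemma fourier_L1_scale: "fourier_L1 (\<lambda>x. c * f x) \<xi> = c * fourier_L1 f \<xi>"
  by (simp add: fourier_L1_def mult.left_commute[of _ c])

lemma fourier_L1_diff: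
  assumes "integrable lborel f" "integrable lborel g"
  shows "fourier_L1 (\<lambda>x. f x - g x) \<xi> = fourier_L1 f \<xi> - fourier_L1 g \<xi>"
  using fourier_L1_add[OF assms(1), of "\<lambda>x. - 1 * g x" \<xi>] fourier_L1_scale[of "- 1" g \<xi>] assms(2) by simp

lemma plancherel_diff:
  assumes f: "f \<in> L2" "integrable lborel f" and g: "g \<in> L2" "integrable lborel g"
  shows "L2_norm (\<lambda>\<xi>. fourier_L1 f \<xi> - fourier_L1 g \<xi>) = L2_norm (\<lambda>x. f x - g x)"
  using plancherel_L1_L2(2)[OF L2_diff[OF f(1) g(1)] Bochner_Integration.integrable_diff[OF f(2) g(2)]]
  by (simp add: fourier_L1_diff[OF f(2) g(2), abs_def])

lemma fourier_cut_L2: "u \<in> L2 \<Longrightarrow> fourier_L1 (cut n u) \<in> L2"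
  by (intro plancherel_L1_L2 cut_L2 cut_integrable)

lemma is_fourier_L2_iff:
  "is_fourier_L2 u g \<longleftrightarrow> g \<in> L2 \<and> (\<lambda>n. L2_norm (\<lambda>\<xi>. fourier_L1 (cut n u) \<xi> - g \<xi>)) \<longlonglongrightarrow> 0"
proof -
  have "(\<lambda>n. sqrt (X n)) \<longlonglongrightarrow> 0 \<longleftrightarrow> X \<longlonglongrightarrow> 0" if "\<And>n. 0 \<le> X n" for X :: "nat \<Rightarrow> real"
  proof
    assume "(\<lambda>n. sqrt (X n)) \<longlonglongrightarrow> 0"
    then have "(\<lambda>n. (sqrt (X n))\<^sup>2) \<longlonglongrightarrow> 0\<^sup>2" by (intro tendsto_intros)
    then show "X \<longlonglongrightarrow> 0" using that by simp
  next
    assume "X \<longlonglongrightarrow> 0"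
    then have "(\<lambda>n. sqrt (X n)) \<longlonglongrightarrow> sqrt 0" by (intro tendsto_intros)
    then show "(\<lambda>n. sqrt (X n)) \<longlonglongrightarrow> 0" by simp
  qed
  then show ?thesis unfolding is_fourier_L2_def L2_norm_def by simp
qed

lemma L2_limit_unique:
  assumes X: "\<And>n. X n \<in> L2" and g: "g \<in> L2" "(\<lambda>n. L2_norm (\<lambda>x. X n x - g x)) \<longlonglongrightarrow> 0"
    and h: "h \<in> L2" "(\<lambda>n. L2_norm (\<lambda>x. X n x - h x)) \<longlonglongrightarrow> 0"
  shows "AE x in lborel. g x = h x"
proof -
  have "L2_norm (\<lambda>x. g x - h x) \<le> 0"
  proof (rule LIMSEQ_le_const)
    show "(\<lambda>n. L2_norm (\<lambda>x. X n x - g x) + L2_norm (\<lambda>x. X n x - h x)) \<longlonglongrightarrow> 0"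
      using tendsto_add[OF g(2) h(2)] by simp
    show "\<exists>N. \<forall>n\<ge>N. L2_norm (\<lambda>x. g x - h x) \<le> L2_norm (\<lambda>x. X n x - g x) + L2_norm (\<lambda>x. X n x - h x)"
      using L2.nrm_triangle3[OF g(1) X h(1)] L2.nrm_minus[OF g(1) X] by (auto simp: L2_nrm_eq)
  qed
  then have "L2_norm (\<lambda>x. g x - h x) = 0" by (simp add: order_antisym)
  then show ?thesis using L2_norm_eq_0_iff[OF L2_diff[OF g(1) h(1)]] by auto
qed

lemma is_fourier_L2_unique:
  assumes "u \<in> L2" "is_fourier_L2 u g" "is_fourier_L2 u h"
  shows "AE \<xi> in lborel. g \<xi> = h \<xi>"
  by (rule L2_limit_unique[of "\<lambda>n. fourier_L1 (cut n u)"]) (use assms in \<open>auto simp: is_fourier_L2_iff fourier_cut_L2\<close>)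

text \<open>By Plancherel the transforms of the truncations are as close to each other as the
  truncations, so they form a Cauchy sequence.\<close>

lemma is_fourier_L2_ex:
  fixes u :: "'b::euclidean_space \<Rightarrow> complex"
  assumes u: "u \<in> L2"
  shows "\<exists>g. is_fourier_L2 u g"
proof -
  have F: "L2_norm (\<lambda>\<xi>. fourier_L1 (cut m u) \<xi> - fourier_L1 (cut n u) \<xi>) = L2_norm (\<lambda>x. cut m u x - cut n u x)" for m n
    by (intro plancherel_diff cut_L2 cut_integrable u)
  have "L2.cauchy (\<lambda>n. fourier_L1 (cut n u))"
    unfolding L2.cauchy_def
  proof (intro conjI allI impI fourier_cut_L2 u)
    fix e :: real assume e: "e > 0"
    have "eventually (\<lambda>n. L2_norm (\<lambda>x. cut n u x - u x) < e / 2) sequentially"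
      using cut_tendsto[OF u] e by (intro order_tendstoD(2)) auto
    then obtain N where N: "\<And>n. n \<ge> N \<Longrightarrow> L2_norm (\<lambda>x. cut n u x - u x) < e / 2" by (auto simp: eventually_sequentially)
    show "\<exists>N. \<forall>m\<ge>N. \<forall>n\<ge>N. L2.nrm (\<lambda>x. fourier_L1 (cut m u) x - fourier_L1 (cut n u) x) < e"
    proof (intro exI[of _ N] allI impI)
      fix m n assume mn: "N \<le> m" "N \<le> n"
      have "L2_norm (\<lambda>x. cut m u x - cut n u x) \<le> L2_norm (\<lambda>x. cut m u x - u x) + L2_norm (\<lambda>x. u x - cut n u x)"
        using L2.nrm_triangle3[OF cut_L2[OF u] u cut_L2[OF u], of m n] by (simp add: L2_nrm_eq)
      also have "L2_norm (\<lambda>x. u x - cut n u x) = L2_norm (\<lambda>x. cut n u x - u x)"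
        using L2.nrm_minus[OF u cut_L2[OF u], of n] by (simp add: L2_nrm_eq)
      finally show "L2.nrm (\<lambda>x. fourier_L1 (cut m u) x - fourier_L1 (cut n u) x) < e"
        using N[OF mn(1)] N[OF mn(2)] by (simp add: L2_nrm_eq F)
    qed
  qed
  then obtain g where "g \<in> L2" "(\<lambda>n. L2_norm (\<lambda>\<xi>. fourier_L1 (cut n u) \<xi> - g \<xi>)) \<longlonglongrightarrow> 0"
    by (rule Riesz_Fischer)
  then show ?thesis unfolding is_fourier_L2_iff by blast
qed

lemma FT: "u \<in> L2 \<Longrightarrow> is_fourier_L2 u (FT u)"
  unfolding FT_def by (rule someI_ex[OF is_fourier_L2_ex])

lemma FT_L2: "u \<in> L2 \<Longrightarrow> FT u \<in> L2"
  using FT by (auto simp: is_fourier_L2_iff)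

lemma FT_lim: "u \<in> L2 \<Longrightarrow> (\<lambda>n. L2_norm (\<lambda>\<xi>. fourier_L1 (cut n u) \<xi> - FT u \<xi>)) \<longlonglongrightarrow> 0"
  using FT by (auto simp: is_fourier_L2_iff)

lemma FT_unique: "u \<in> L2 \<Longrightarrow> is_fourier_L2 u g \<Longrightarrow> AE \<xi> in lborel. FT u \<xi> = g \<xi>"
  by (rule is_fourier_L2_unique[OF _ FT])

theorem FT_norm:
  assumes u: "u \<in> L2"
  shows "L2_norm (FT u) = L2_norm u"
proof (rule LIMSEQ_unique)
  show "(\<lambda>n. L2_norm (fourier_L1 (cut n u))) \<longlonglongrightarrow> L2_norm (FT u)"
    using L2.tendsto_nrm[OF fourier_cut_L2[OF u] FT_L2[OF u]] FT_lim[OF u] by (simp add: L2_nrm_eq)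
  show "(\<lambda>n. L2_norm (fourier_L1 (cut n u))) \<longlonglongrightarrow> L2_norm u"
    using L2.tendsto_nrm[OF cut_L2[OF u] u] cut_tendsto[OF u]
    by (simp add: L2_nrm_eq plancherel_L1_L2(2)[OF cut_L2[OF u] cut_integrable[OF u]])
qed

text \<open>\<open>FT\<close> chooses a representative for each function separately, so linearity
  can be claimed almost everywhere only.\<close>

lemma FT_add:
  assumes u: "u \<in> L2" and v: "v \<in> L2"
  shows "AE \<xi> in lborel. FT (\<lambda>x. u x + v x) \<xi> = FT u \<xi> + FT v \<xi>"
proof (rule FT_unique[OF L2_add[OF u v]], unfold is_fourier_L2_iff, intro conjI L2_add FT_L2 u v)
  have eq: "fourier_L1 (cut n (\<lambda>x. u x + v x)) \<xi> - (FT u \<xi> + FT v \<xi>)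
     = (fourier_L1 (cut n u) \<xi> - FT u \<xi>) + (fourier_L1 (cut n v) \<xi> - FT v \<xi>)" for n \<xi>
    using fourier_L1_add[OF cut_integrable[OF u] cut_integrable[OF v]] by (simp add: distrib_left)
  show "(\<lambda>n. L2_norm (\<lambda>\<xi>. fourier_L1 (cut n (\<lambda>x. u x + v x)) \<xi> - (FT u \<xi> + FT v \<xi>))) \<longlonglongrightarrow> 0"
  proof (rule Lim_null_comparison[OF always_eventually])
    show "(\<lambda>n. L2_norm (\<lambda>\<xi>. fourier_L1 (cut n u) \<xi> - FT u \<xi>) + L2_norm (\<lambda>\<xi>. fourier_L1 (cut n v) \<xi> - FT v \<xi>)) \<longlonglongrightarrow> 0"
      using tendsto_add[OF FT_lim[OF u] FT_lim[OF v]] by simp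
    show "\<forall>n. norm (L2_norm (\<lambda>\<xi>. fourier_L1 (cut n (\<lambda>x. u x + v x)) \<xi> - (FT u \<xi> + FT v \<xi>)))
      \<le> L2_norm (\<lambda>\<xi>. fourier_L1 (cut n u) \<xi> - FT u \<xi>) + L2_norm (\<lambda>\<xi>. fourier_L1 (cut n v) \<xi> - FT v \<xi>)"
      unfolding eq using L2.nrm_triangle[OF L2_diff[OF fourier_cut_L2[OF u] FT_L2[OF u]] L2_diff[OF fourier_cut_L2[OF v] FT_L2[OF v]]]
      by (simp add: L2_nrm_eq)
  qed
qed

lemma FT_scale:
  assumes u: "u \<in> L2"
  shows "AE \<xi> in lborel. FT (\<lambda>x. c * u x) \<xi> = c * FT u \<xi>"
proof (rule FT_unique[OF L2_scale[OF u]], unfold is_fourier_L2_iff, intro conjI L2_scale FT_L2 u)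
  have eq: "fourier_L1 (cut n (\<lambda>x. c * u x)) \<xi> - c * FT u \<xi> = c * (fourier_L1 (cut n u) \<xi> - FT u \<xi>)" for n \<xi>
    using fourier_L1_scale[of c "cut n u" \<xi>] by (simp add: right_diff_distrib mult.left_commute)
  show "(\<lambda>n. L2_norm (\<lambda>\<xi>. fourier_L1 (cut n (\<lambda>x. c * u x)) \<xi> - c * FT u \<xi>)) \<longlonglongrightarrow> 0"
    unfolding eq using L2.nrm_scale[OF L2_diff[OF fourier_cut_L2[OF u] FT_L2[OF u]], of c] tendsto_mult[OF tendsto_const FT_lim[OF u], of "cmod c"]
    by (simp add: L2_nrm_eq)
qed

lemma FT_diff:
  assumes u: "u \<in> L2" and v: "v \<in> L2"
  shows "AE \<xi> in lborel. FT (\<lambda>x. u x - v x) \<xi> = FT u \<xi> - FT v \<xi>"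
  using FT_add[OF u L2_scale[OF v, of "-1"]] FT_scale[OF v, of "-1"] by eventually_elim simp

lemma FT_eq_fourier_L1:
  assumes u: "u \<in> L2" "integrable lborel u"
  shows "AE \<xi> in lborel. FT u \<xi> = fourier_L1 u \<xi>"
proof (rule FT_unique[OF u(1)], unfold is_fourier_L2_iff, intro conjI plancherel_L1_L2 u)
  have "L2_norm (\<lambda>\<xi>. fourier_L1 (cut n u) \<xi> - fourier_L1 u \<xi>) = L2_norm (\<lambda>x. cut n u x - u x)" for n
    by (intro plancherel_diff cut_L2 cut_integrable u)
  then show "(\<lambda>n. L2_norm (\<lambda>\<xi>. fourier_L1 (cut n u) \<xi> - fourier_L1 u \<xi>)) \<longlonglongrightarrow> 0"
    using cut_tendsto[OF u(1)] by simp
qed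

section \<open>Quadratic forms given by Fourier multipliers\<close>

abbreviation pw :: "real \<Rightarrow> 'b::euclidean_space \<Rightarrow> real" where
  "pw s \<equiv> (\<lambda>\<xi>. norm \<xi> powr (2 * s))"

text \<open>The symbol \<open>W\<close> may have either sign, so that \<open>frac_form\<close>, the
  shifted forms and the differences of such forms are instances of one construction.\<close>

definition wform :: "('b::euclidean_space \<Rightarrow> real) \<Rightarrow> ('b \<Rightarrow> complex) \<Rightarrow> ('b \<Rightarrow> complex) \<Rightarrow> complex" where
  "wform W u v = (\<integral>\<xi>. complex_of_real (W \<xi>) * FT u \<xi> * cnj (FT v \<xi>) \<partial>lborel)"

definition wquad :: "('b::euclidean_space \<Rightarrow> real) \<Rightarrow> ('b \<Rightarrow> complex) \<Rightarrow> real" where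
  "wquad W u = (\<integral>\<xi>. W \<xi> * (cmod (FT u \<xi>))\<^sup>2 \<partial>lborel)"

lemma frac_form_eq: "frac_form s = wform (pw s)"
  by (simp add: fun_eq_iff frac_form_def wform_def)

lemma wform_self: "wform W u u = complex_of_real (wquad W u)"
  unfolding wform_def wquad_def integral_complex_of_real[symmetric]
  by (intro Bochner_Integration.integral_cong) (simp_all add: mult.assoc mult_cnj_cmod)

lemma wform_integrable:
  assumes uv: "u \<in> L2" "v \<in> L2" and [measurable]: "W \<in> borel_measurable borel"
    and iu: "integrable lborel (\<lambda>\<xi>. W \<xi> * (cmod (FT u \<xi>))\<^sup>2)"
    and iv: "integrable lborel (\<lambda>\<xi>. W \<xi> * (cmod (FT v \<xi>))\<^sup>2)"
  shows "integrable lborel (\<lambda>\<xi>. complex_of_real (W \<xi>) * FT u \<xi> * cnj (FT v \<xi>))"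
proof (rule Bochner_Integration.integrable_bound)
  show "integrable lborel (\<lambda>\<xi>. \<bar>W \<xi> * (cmod (FT u \<xi>))\<^sup>2\<bar> + \<bar>W \<xi> * (cmod (FT v \<xi>))\<^sup>2\<bar>)"
    using iu iv by (intro Bochner_Integration.integrable_add integrable_abs)
  show "AE \<xi> in lborel. norm (complex_of_real (W \<xi>) * FT u \<xi> * cnj (FT v \<xi>))
     \<le> norm (\<bar>W \<xi> * (cmod (FT u \<xi>))\<^sup>2\<bar> + \<bar>W \<xi> * (cmod (FT v \<xi>))\<^sup>2\<bar>)"
  proof (intro always_eventually allI)
    fix \<xi>
    have "\<bar>W \<xi>\<bar> * (cmod (FT u \<xi>) * cmod (FT v \<xi>)) \<le> \<bar>W \<xi>\<bar> * ((cmod (FT u \<xi>))\<^sup>2 + (cmod (FT v \<xi>))\<^sup>2)"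
      by (intro mult_left_mono mult_le_sum_squares) auto
    then show "norm (complex_of_real (W \<xi>) * FT u \<xi> * cnj (FT v \<xi>))
     \<le> norm (\<bar>W \<xi> * (cmod (FT u \<xi>))\<^sup>2\<bar> + \<bar>W \<xi> * (cmod (FT v \<xi>))\<^sup>2\<bar>)"
      by (simp add: norm_mult abs_mult distrib_left mult.assoc)
  qed
qed (use L2D[OF FT_L2[OF uv(1)]] L2D[OF FT_L2[OF uv(2)]] in measurable)

text \<open>Nonnegativity is required of the quadratic form on \<open>V\<close> and not of the
  symbol: symbols that become negative at low frequencies are to be covered.\<close>

lemma semi_inner_wform:
  fixes V :: "('b::euclidean_space \<Rightarrow> complex) set"
  assumes V: "V \<subseteq> L2" "V \<noteq> {}"
    "\<And>u v. u \<in> V \<Longrightarrow> v \<in> V \<Longrightarrow> (\<lambda>x. u x + v x) \<in> V" "\<And>c u. u \<in> V \<Longrightarrow> (\<lambda>x. c * u x) \<in> V"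
    and [measurable]: "W \<in> borel_measurable borel"
    and int: "\<And>u. u \<in> V \<Longrightarrow> integrable lborel (\<lambda>\<xi>. W \<xi> * (cmod (FT u \<xi>))\<^sup>2)"
    and nonneg: "\<And>u. u \<in> V \<Longrightarrow> 0 \<le> wquad W u"
  shows "semi_inner V (wform W)"
proof
  have L2: "u \<in> V \<Longrightarrow> u \<in> L2" for u using V(1) by auto
  note [measurable] = L2D[OF FT_L2[OF L2]]
  note i = wform_integrable[OF L2 L2 assms(5) int int]
  show "V \<noteq> {}" by fact
  fix u v w :: "'b \<Rightarrow> complex" and c
  assume u: "u \<in> V"
  show "0 \<le> Re (wform W u u)" using nonneg[OF u] by (simp add: wform_self)
  show "(\<lambda>x. c * u x) \<in> V" using V(4)[OF u] .
  { assume v: "v \<in> V"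
    show "(\<lambda>x. u x + v x) \<in> V" using V(3)[OF u v] .
    show "cnj (wform W u v) = wform W v u"
      unfolding wform_def by (simp only: flip: Bochner_Integration.integral_cnj) (simp add: mult_ac)
    assume w: "w \<in> V"
    have "wform W (\<lambda>x. u x + v x) w
       = (\<integral>\<xi>. complex_of_real (W \<xi>) * FT u \<xi> * cnj (FT w \<xi>) + complex_of_real (W \<xi>) * FT v \<xi> * cnj (FT w \<xi>) \<partial>lborel)"
      unfolding wform_def
    proof (rule integral_cong_AE)
      show "AE \<xi> in lborel. complex_of_real (W \<xi>) * FT (\<lambda>x. u x + v x) \<xi> * cnj (FT w \<xi>)
        = complex_of_real (W \<xi>) * FT u \<xi> * cnj (FT w \<xi>) + complex_of_real (W \<xi>) * FT v \<xi> * cnj (FT w \<xi>)"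
        using FT_add[OF L2[OF u] L2[OF v]] by eventually_elim (simp add: algebra_simps)
    qed (use u v w L2D[OF FT_L2[OF L2_add[OF L2[OF u] L2[OF v]]]] in measurable)
    then show "wform W (\<lambda>x. u x + v x) w = wform W u w + wform W v w"
      using i[OF u w u w] i[OF v w v w] by (simp add: wform_def) }
  assume w: "w \<in> V"
  have "wform W (\<lambda>x. c * u x) w = (\<integral>\<xi>. c * (complex_of_real (W \<xi>) * FT u \<xi> * cnj (FT w \<xi>)) \<partial>lborel)"
    unfolding wform_def
  proof (rule integral_cong_AE)
    show "AE \<xi> in lborel. complex_of_real (W \<xi>) * FT (\<lambda>x. c * u x) \<xi> * cnj (FT w \<xi>)
      = c * (complex_of_real (W \<xi>) * FT u \<xi> * cnj (FT w \<xi>))"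
      using FT_scale[OF L2[OF u], of c] by eventually_elim (simp add: algebra_simps)
  qed (use u w L2D[OF FT_L2[OF L2_scale[OF L2[OF u]]]] in measurable)
  then show "wform W (\<lambda>x. c * u x) w = c * wform W u w" by (simp add: wform_def)
qed

lemma wquad_1: "u \<in> L2 \<Longrightarrow> wquad (\<lambda>_. 1) u = (L2_norm u)\<^sup>2"
  using FT_norm[of u] L2_norm_sq[of "FT u"] by (simp add: wquad_def)

text \<open>Parseval by polarisation: two semi-inner products with the same norm agree, as seen from
  the expansion of \<open>v + c * u\<close> with c = 1 and c = \<i>.\<close>

lemma wform_1:
  fixes u v :: "'b::euclidean_space \<Rightarrow> complex"
  assumes u: "u \<in> L2" and v: "v \<in> L2"
  shows "wform (\<lambda>_. 1) u v = L2_inner u v"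
proof -
  interpret W: semi_inner "L2 :: ('b \<Rightarrow> complex) set" "wform (\<lambda>_. 1)"
    by (rule semi_inner_wform) (auto simp: L2_add L2_scale wquad_1 L2_integrable[OF FT_L2] intro: L2_zero)
  have n: "W.nrm w = L2.nrm w" if "w \<in> L2" for w
    using that by (simp add: W.nrm_def L2_nrm_eq wform_self wquad_1)
  have "Re (c * wform (\<lambda>_. 1) u v) = Re (c * L2_inner u v)" for c
    using W.nrm_sq_add_scale[OF v u, of c] L2.nrm_sq_add_scale[OF v u, of c] n u v
      n[OF L2_add[OF v L2_scale[OF u]], of c] by simp
  from this[of 1] this[of \<i>] show ?thesis by (simp add: complex_eq_iff)
qed

subsection \<open>Functions supported in a set\<close>

lemma L2_onD: "u \<in> L2_on S \<Longrightarrow> u \<in> L2"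
  by (simp add: L2_on_def)

lemma L2_on_zero: "(\<lambda>x. 0) \<in> L2_on S"
  by (simp add: L2_on_def L2_zero)

lemma L2_on_add: "u \<in> L2_on S \<Longrightarrow> v \<in> L2_on S \<Longrightarrow> (\<lambda>x. u x + v x) \<in> L2_on S"
  unfolding L2_on_def by (auto intro: L2_add)

lemma L2_on_scale: "u \<in> L2_on S \<Longrightarrow> (\<lambda>x. c * u x) \<in> L2_on S"
  unfolding L2_on_def by (auto intro: L2_scale)

lemma L2_on_diff: "u \<in> L2_on S \<Longrightarrow> v \<in> L2_on S \<Longrightarrow> (\<lambda>x. u x - v x) \<in> L2_on S"
  using L2_on_add[OF _ L2_on_scale[of v S "-1"], of u] by simp

text \<open>The support condition survives because a subsequence converges almost
  everywhere.\<close>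

lemma L2_on_limit:
  assumes C: "L2.cauchy X" and X: "\<And>n. X n \<in> L2_on S"
  obtains u where "u \<in> L2_on S" "(\<lambda>n. L2_norm (\<lambda>x. X n x - u x)) \<longlonglongrightarrow> 0"
proof -
  obtain u r where u: "u \<in> L2" and AE: "AE x in lborel. (\<lambda>k. X (r k) x) \<longlonglongrightarrow> u x"
    and lim: "(\<lambda>n. L2_norm (\<lambda>x. X n x - u x)) \<longlonglongrightarrow> 0"
    by (rule Riesz_Fischer[OF C])
  have "AE x in lborel. \<forall>n. x \<notin> S \<longrightarrow> X n x = 0"
    using X by (subst AE_all_countable) (auto simp: L2_on_def)
  with AE have "AE x in lborel. x \<notin> S \<longrightarrow> u x = 0"
    by eventually_elim (auto dest: LIMSEQ_unique[OF _ tendsto_const])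
  with u lim that show thesis by (auto simp: L2_on_def)
qed

text \<open>Cauchy-Schwarz of |u| against the indicator of \<open>S\<close>. For bounded
  \<open>S\<close> the transform of \<open>u\<close> is thus a genuine integral, defined at every
  frequency.\<close>

lemma L2_on_integrable:
  assumes u: "u \<in> L2_on S" and S: "S \<in> sets borel" "bounded S"
  shows "integrable lborel u" "(\<integral>x. cmod (u x) \<partial>lborel) \<le> L2_norm u * L2_norm (indicator S :: 'b::euclidean_space \<Rightarrow> complex)"
proof -
  note uL = L2_onD[OF u]
  note [measurable] = L2D[OF uL] S(1)
  have AE: "AE x in lborel. indicator S x * u x = u x"
    using u unfolding L2_on_def by (auto elim!: eventually_mono simp: indicator_def)
  show ui: "integrable lborel u"
    using L2_integrable_bounded[OF uL S] AE by (subst integrable_cong_AE[of u _ "\<lambda>x. indicator S x * u x"]) auto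
  define a where "a = (\<lambda>x. complex_of_real (cmod (u x)))"
  have a: "a \<in> L2" unfolding a_def by (rule L2_bound[OF uL, of _ 1]) auto
  have "complex_of_real (\<integral>x. cmod (u x) \<partial>lborel) = L2_inner a (indicator S)"
    unfolding L2_inner_def integral_complex_of_real[symmetric] a_def
    using AE by (intro integral_cong_AE) (auto elim!: eventually_mono simp: indicator_def)
  then have "(\<integral>x. cmod (u x) \<partial>lborel) = Re (L2_inner a (indicator S))" by (metis Re_complex_of_real)
  also have "\<dots> \<le> cmod (L2_inner a (indicator S))" by (rule complex_Re_le_cmod)
  also have "\<dots> \<le> L2_norm a * L2_norm (indicator S :: 'b \<Rightarrow> complex)"
    using L2.Cauchy_Schwarz[OF a L2_indicator[OF S]] by (simp add: L2_nrm_eq)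
  also have "L2_norm a = L2_norm u" by (simp add: L2_norm_def a_def)
  finally show "(\<integral>x. cmod (u x) \<partial>lborel) \<le> L2_norm u * L2_norm (indicator S :: 'b \<Rightarrow> complex)" .
qed

subsection \<open>The form domain\<close>

text \<open>\<open>Ht\<close> only asks for vanishing outside the closure, which leaves the boundary
  of \<open>\<Omega>\<close> free; the intersection with \<open>L2_on\<close> is the set of test
  functions in \<open>frac_op\<close>.\<close>

definition form_dom :: "real \<Rightarrow> 'b::euclidean_space set \<Rightarrow> ('b \<Rightarrow> complex) set" where
  "form_dom s \<Omega> = Ht s \<Omega> \<inter> L2_on \<Omega>"

text \<open>The growth condition under which the form with symbol \<open>W\<close> is finite on the
  whole form domain.\<close>

definition admissible :: "real \<Rightarrow> ('b::euclidean_space \<Rightarrow> real) \<Rightarrow> bool" where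
  "admissible s W \<longleftrightarrow> W \<in> borel_measurable borel \<and> (\<exists>C. \<forall>\<xi>. \<bar>W \<xi>\<bar> \<le> C * (1 + norm \<xi> powr (2 * s)))"

text \<open>The transform in \<open>Hs\<close> is determined almost everywhere, so it may be taken
  to be \<open>FT u\<close>; the closure condition of \<open>Ht\<close> follows from the support
  condition of \<open>L2_on\<close>.\<close>

lemma form_dom_iff:
  "u \<in> form_dom s \<Omega> \<longleftrightarrow> u \<in> L2_on \<Omega> \<and> integrable lborel (\<lambda>\<xi>. norm \<xi> powr (2 * s) * (cmod (FT u \<xi>))\<^sup>2)"
proof -
  have sq: "(cmod (complex_of_real (norm \<xi> powr s) * z))\<^sup>2 = norm \<xi> powr (2 * s) * (cmod z)\<^sup>2" for \<xi> :: 'a and z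
    by (simp add: norm_mult power_mult_distrib power2_eq_square[of "norm \<xi> powr s"] powr_add[symmetric])
  have "(\<exists>g. is_fourier_L2 u g \<and> (\<lambda>\<xi>. complex_of_real (norm \<xi> powr s) * g \<xi>) \<in> L2)
    \<longleftrightarrow> integrable lborel (\<lambda>\<xi>. norm \<xi> powr (2 * s) * (cmod (FT u \<xi>))\<^sup>2)" if u: "u \<in> L2"
  proof
    note [measurable] = L2D[OF FT_L2[OF u]]
    assume "\<exists>g. is_fourier_L2 u g \<and> (\<lambda>\<xi>. complex_of_real (norm \<xi> powr s) * g \<xi>) \<in> L2"
    then obtain g where g: "is_fourier_L2 u g" "(\<lambda>\<xi>. complex_of_real (norm \<xi> powr s) * g \<xi>) \<in> L2" by blast
    have "(\<lambda>\<xi>. complex_of_real (norm \<xi> powr s) * FT u \<xi>) \<in> L2"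
      by (rule L2_cong_AE[OF g(2)]) (use FT_unique[OF u g(1)] in auto)
    from L2_integrable[OF this] show "integrable lborel (\<lambda>\<xi>. norm \<xi> powr (2 * s) * (cmod (FT u \<xi>))\<^sup>2)"
      unfolding sq .
  next
    note [measurable] = L2D[OF FT_L2[OF u]]
    assume "integrable lborel (\<lambda>\<xi>. norm \<xi> powr (2 * s) * (cmod (FT u \<xi>))\<^sup>2)"
    moreover have "(\<lambda>\<xi>. complex_of_real (norm \<xi> powr s) * FT u \<xi>) \<in> borel_measurable lborel"
      by measurable
    ultimately have "(\<lambda>\<xi>. complex_of_real (norm \<xi> powr s) * FT u \<xi>) \<in> L2"
      unfolding L2_def mem_Collect_eq sq by blast
    then show "\<exists>g. is_fourier_L2 u g \<and> (\<lambda>\<xi>. complex_of_real (norm \<xi> powr s) * g \<xi>) \<in> L2"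
      using FT[OF u] by blast
  qed
  moreover have "AE x in lborel. x \<notin> closure \<Omega> \<longrightarrow> u x = 0" if "u \<in> L2_on \<Omega>"
    using that closure_subset[of \<Omega>] unfolding L2_on_def by (auto elim!: eventually_mono)
  ultimately show ?thesis
    unfolding form_dom_def Ht_def Hs_def using L2_onD[of u \<Omega>] by auto
qed

lemma form_dom_L2_on: "u \<in> form_dom s \<Omega> \<Longrightarrow> u \<in> L2_on \<Omega>"
  by (simp add: form_dom_iff)

lemma form_dom_L2: "u \<in> form_dom s \<Omega> \<Longrightarrow> u \<in> L2"
  by (rule L2_onD[OF form_dom_L2_on])

lemma admissible_measurable [measurable_dest]: "admissible s W \<Longrightarrow> W \<in> borel_measurable borel"
  by (simp add: admissible_def)

lemma admissibleI: "W \<in> borel_measurable borel \<Longrightarrow> (\<And>\<xi>. \<bar>W \<xi>\<bar> \<le> C * (1 + norm \<xi> powr (2 * s))) \<Longrightarrow> admissible s W"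
  unfolding admissible_def by blast

lemma admissible_pw: "admissible s (pw s)"
  by (rule admissibleI[where C=1]) auto

lemma admissible_const: "admissible s (\<lambda>\<xi>. c)"
  by (rule admissibleI[where C="\<bar>c\<bar>"]) (auto simp: algebra_simps)

lemma admissible_add:
  assumes "admissible s W1" "admissible s W2"
  shows "admissible s (\<lambda>\<xi>. W1 \<xi> + W2 \<xi>)"
proof -
  obtain C1 C2 where "\<And>\<xi>. \<bar>W1 \<xi>\<bar> \<le> C1 * (1 + norm \<xi> powr (2 * s))" "\<And>\<xi>. \<bar>W2 \<xi>\<bar> \<le> C2 * (1 + norm \<xi> powr (2 * s))"
    using assms unfolding admissible_def by blast
  note b = add_mono[OF this]
  show ?thesis
  proof (rule admissibleI[where C="C1 + C2"])
    show "\<bar>W1 \<xi> + W2 \<xi>\<bar> \<le> (C1 + C2) * (1 + norm \<xi> powr (2 * s))" for \<xi>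
      using order_trans[OF abs_triangle_ineq b] by (simp only: distrib_right)
  qed (use assms in measurable)
qed

lemma admissible_uminus: "admissible s W \<Longrightarrow> admissible s (\<lambda>\<xi>. - W \<xi>)"
  by (auto simp: admissible_def)

lemma admissible_diff: "admissible s W1 \<Longrightarrow> admissible s W2 \<Longrightarrow> admissible s (\<lambda>\<xi>. W1 \<xi> - W2 \<xi>)"
  using admissible_add[OF _ admissible_uminus[of s W2], of W1] by simp

lemma form_dom_integrable:
  assumes u: "u \<in> form_dom s \<Omega>" and W: "admissible s W"
  shows "integrable lborel (\<lambda>\<xi>. W \<xi> * (cmod (FT u \<xi>))\<^sup>2)"
proof -
  note [measurable] = L2D[OF FT_L2[OF form_dom_L2[OF u]]] admissible_measurable[OF W]
  obtain C where C: "\<And>\<xi>. \<bar>W \<xi>\<bar> \<le> C * (1 + norm \<xi> powr (2 * s))" using W unfolding admissible_def by blast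
  show ?thesis
  proof (rule Bochner_Integration.integrable_bound)
    show "integrable lborel (\<lambda>\<xi>. C * ((cmod (FT u \<xi>))\<^sup>2 + norm \<xi> powr (2 * s) * (cmod (FT u \<xi>))\<^sup>2))"
      using L2_integrable[OF FT_L2[OF form_dom_L2[OF u]]] u by (auto simp: form_dom_iff)
    show "AE \<xi> in lborel. norm (W \<xi> * (cmod (FT u \<xi>))\<^sup>2) \<le> norm (C * ((cmod (FT u \<xi>))\<^sup>2 + norm \<xi> powr (2 * s) * (cmod (FT u \<xi>))\<^sup>2))"
    proof (intro always_eventually allI)
      fix \<xi>
      have "\<bar>W \<xi>\<bar> * (cmod (FT u \<xi>))\<^sup>2 \<le> C * (1 + norm \<xi> powr (2 * s)) * (cmod (FT u \<xi>))\<^sup>2"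
        by (intro mult_right_mono C) auto
      then show "norm (W \<xi> * (cmod (FT u \<xi>))\<^sup>2) \<le> norm (C * ((cmod (FT u \<xi>))\<^sup>2 + norm \<xi> powr (2 * s) * (cmod (FT u \<xi>))\<^sup>2))"
        by (simp add: abs_mult algebra_simps)
    qed
  qed measurable
qed

lemma form_dom_wform_integrable:
  assumes "u \<in> form_dom s \<Omega>" "v \<in> form_dom s \<Omega>" "admissible s W"
  shows "integrable lborel (\<lambda>\<xi>. complex_of_real (W \<xi>) * FT u \<xi> * cnj (FT v \<xi>))"
  using assms by (intro wform_integrable form_dom_integrable) (auto intro: form_dom_L2 admissible_measurable)

lemma form_dom_zero: "(\<lambda>x. 0) \<in> form_dom s \<Omega>"
proof -
  have "AE \<xi> in lborel. FT (\<lambda>x::'a. 0) \<xi> = 0"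
    using FT_scale[OF L2_zero, of 0] by simp
  moreover note [measurable] = L2D[OF FT_L2[OF L2_zero]]
  ultimately have "integrable lborel (\<lambda>\<xi>::'a. norm \<xi> powr (2 * s) * (cmod (FT (\<lambda>x. 0) \<xi>))\<^sup>2) \<longleftrightarrow> integrable lborel (\<lambda>\<xi>::'a. 0::real)"
    by (intro integrable_cong_AE) auto
  then show ?thesis by (simp add: form_dom_iff L2_on_zero)
qed

lemma form_dom_scale:
  assumes u: "u \<in> form_dom s \<Omega>"
  shows "(\<lambda>x. c * u x) \<in> form_dom s \<Omega>"
proof -
  note [measurable] = L2D[OF FT_L2[OF form_dom_L2[OF u]]] L2D[OF FT_L2[OF L2_scale[OF form_dom_L2[OF u], of c]]]
  have "integrable lborel (\<lambda>\<xi>. norm \<xi> powr (2 * s) * (cmod (FT (\<lambda>x. c * u x) \<xi>))\<^sup>2)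
    \<longleftrightarrow> integrable lborel (\<lambda>\<xi>. (cmod c)\<^sup>2 * (norm \<xi> powr (2 * s) * (cmod (FT u \<xi>))\<^sup>2))"
    using FT_scale[OF form_dom_L2[OF u], of c]
    by (intro integrable_cong_AE) (auto elim!: eventually_mono simp: norm_mult power_mult_distrib)
  then show ?thesis using u by (auto simp: form_dom_iff L2_on_scale)
qed

lemma form_dom_add:
  assumes u: "u \<in> form_dom s \<Omega>" and v: "v \<in> form_dom s \<Omega>"
  shows "(\<lambda>x. u x + v x) \<in> form_dom s \<Omega>"
proof -
  note uv = form_dom_L2[OF u] form_dom_L2[OF v]
  note [measurable] = L2D[OF FT_L2[OF L2_add[OF uv]]] L2D[OF FT_L2[OF uv(1)]] L2D[OF FT_L2[OF uv(2)]]
  have "integrable lborel (\<lambda>\<xi>. norm \<xi> powr (2 * s) * (cmod (FT (\<lambda>x. u x + v x) \<xi>))\<^sup>2)"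
  proof (rule Bochner_Integration.integrable_bound)
    show "integrable lborel (\<lambda>\<xi>. 2 * (norm \<xi> powr (2 * s) * (cmod (FT u \<xi>))\<^sup>2) + 2 * (norm \<xi> powr (2 * s) * (cmod (FT v \<xi>))\<^sup>2))"
      using u v by (auto simp: form_dom_iff)
    show "AE \<xi> in lborel. norm (norm \<xi> powr (2 * s) * (cmod (FT (\<lambda>x. u x + v x) \<xi>))\<^sup>2)
      \<le> norm (2 * (norm \<xi> powr (2 * s) * (cmod (FT u \<xi>))\<^sup>2) + 2 * (norm \<xi> powr (2 * s) * (cmod (FT v \<xi>))\<^sup>2))"
      using FT_add[OF uv]
    proof eventually_elim
      case (elim \<xi>)
      have "norm \<xi> powr (2 * s) * (cmod (FT u \<xi> + FT v \<xi>))\<^sup>2 \<le> norm \<xi> powr (2 * s) * (2 * (cmod (FT u \<xi>))\<^sup>2 + 2 * (cmod (FT v \<xi>))\<^sup>2)"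
        by (intro mult_left_mono cmod_add_sq_le) auto
      then show ?case using elim by (simp add: abs_mult algebra_simps)
    qed
  qed measurable
  then show ?thesis using u v by (auto simp: form_dom_iff L2_on_add)
qed

lemma form_dom_diff: "u \<in> form_dom s \<Omega> \<Longrightarrow> v \<in> form_dom s \<Omega> \<Longrightarrow> (\<lambda>x. u x - v x) \<in> form_dom s \<Omega>"
  using form_dom_add[OF _ form_dom_scale[of v s \<Omega> "-1"], of u] by simp

lemma semi_inner_form_dom:
  assumes "admissible s W" "\<And>u. u \<in> form_dom s \<Omega> \<Longrightarrow> 0 \<le> wquad W u"
  shows "semi_inner (form_dom s \<Omega>) (wform W)"
proof (rule semi_inner_wform)
  show "form_dom s \<Omega> \<noteq> {}" using form_dom_zero by blast
qed (use assms in \<open>auto intro: form_dom_L2 form_dom_add form_dom_scale form_dom_integrable admissible_measurable\<close>)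

section \<open>Dependence of the quadratic form on its symbol\<close>

lemma nn_integral_wquad:
  assumes "u \<in> form_dom s \<Omega>" "admissible s W" "\<And>\<xi>. 0 \<le> W \<xi>"
  shows "(\<integral>\<^sup>+\<xi>. ennreal (W \<xi> * (cmod (FT u \<xi>))\<^sup>2) \<partial>lborel) = ennreal (wquad W u)"
  unfolding wquad_def using assms by (intro nn_integral_eq_integral form_dom_integrable) auto

lemma wquad_mono:
  assumes "u \<in> form_dom s \<Omega>" "admissible s W1" "admissible s W2" "\<And>\<xi>. W1 \<xi> \<le> W2 \<xi>"
  shows "wquad W1 u \<le> wquad W2 u"
  unfolding wquad_def using assms by (intro integral_mono form_dom_integrable mult_right_mono) auto

lemma wquad_nonneg: "(\<And>\<xi>. 0 \<le> W \<xi>) \<Longrightarrow> 0 \<le> wquad W u"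
  unfolding wquad_def by (intro integral_nonneg_AE) auto

lemma wquad_add:
  assumes "u \<in> form_dom s \<Omega>" "admissible s W1" "admissible s W2"
  shows "wquad (\<lambda>\<xi>. W1 \<xi> + W2 \<xi>) u = wquad W1 u + wquad W2 u"
  using form_dom_integrable[OF assms(1,2)] form_dom_integrable[OF assms(1,3)] by (simp add: wquad_def distrib_right)

lemma wquad_diff:
  assumes "u \<in> form_dom s \<Omega>" "admissible s W1" "admissible s W2"
  shows "wquad (\<lambda>\<xi>. W1 \<xi> - W2 \<xi>) u = wquad W1 u - wquad W2 u"
  using form_dom_integrable[OF assms(1,2)] form_dom_integrable[OF assms(1,3)] by (simp add: wquad_def left_diff_distrib)

lemma wquad_const: "u \<in> L2 \<Longrightarrow> wquad (\<lambda>_. c) u = c * (L2_norm u)\<^sup>2"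
  using wquad_1[of u] by (simp add: wquad_def)

lemma wform_add:
  assumes "u \<in> form_dom s \<Omega>" "v \<in> form_dom s \<Omega>" "admissible s W1" "admissible s W2"
  shows "wform (\<lambda>\<xi>. W1 \<xi> + W2 \<xi>) u v = wform W1 u v + wform W2 u v"
  using form_dom_wform_integrable[OF assms(1,2,3)] form_dom_wform_integrable[OF assms(1,2,4)]
  by (simp add: wform_def distrib_right)

lemma wform_diff:
  assumes "u \<in> form_dom s \<Omega>" "v \<in> form_dom s \<Omega>" "admissible s W1" "admissible s W2"
  shows "wform (\<lambda>\<xi>. W1 \<xi> - W2 \<xi>) u v = wform W1 u v - wform W2 u v"
  using form_dom_wform_integrable[OF assms(1,2,3)] form_dom_wform_integrable[OF assms(1,2,4)]
  by (simp add: wform_def left_diff_distrib)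

lemma wform_const: "u \<in> L2 \<Longrightarrow> v \<in> L2 \<Longrightarrow> wform (\<lambda>_. c) u v = complex_of_real c * L2_inner u v"
  using wform_1[of u v] by (simp add: wform_def mult.assoc)

lemma FT_cauchy:
  assumes "L2.cauchy X"
  shows "L2.cauchy (\<lambda>n. FT (X n))"
proof -
  have X: "X n \<in> L2" for n using assms by (auto simp: L2.cauchy_def)
  have "L2_norm (\<lambda>\<xi>. FT (X m) \<xi> - FT (X n) \<xi>) = L2_norm (\<lambda>x. X m x - X n x)" for m n
  proof -
    have "L2_norm (\<lambda>\<xi>. FT (X m) \<xi> - FT (X n) \<xi>) = L2_norm (FT (\<lambda>x. X m x - X n x))"
      using FT_diff[OF X X, of m n]
      by (intro L2_norm_cong_AE) (auto intro!: L2D L2_diff FT_L2 X elim!: eventually_mono)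
    then show ?thesis by (simp add: FT_norm L2_diff X)
  qed
  then show ?thesis using assms by (auto simp: L2.cauchy_def L2_nrm_eq FT_L2)
qed

text \<open>\<open>1 \<le> W \<xi>\<close> makes a Cauchy sequence of the form Cauchy in L2, the
  other lower bound places the L2 limit in the form domain, and Fatou's lemma on the Fourier side
  gives convergence in the form norm.\<close>

lemma form_dom_form_complete:
  assumes W: "admissible s W" "\<And>\<xi>. 1 \<le> W \<xi>" "\<And>\<xi>. norm \<xi> powr (2 * s) \<le> W \<xi>"
  shows "semi_inner (form_dom s \<Omega>) (wform W)" "semi_inner.is_complete (form_dom s \<Omega>) (wform W)"
proof -
  note [measurable] = admissible_measurable[OF W(1)]
  have W0: "0 \<le> W \<xi>" for \<xi> using W(2)[of \<xi>] by simp
  show S: "semi_inner (form_dom s \<Omega>) (wform W)"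
    by (rule semi_inner_form_dom[OF W(1)]) (rule wquad_nonneg[OF W0])
  interpret W: semi_inner "form_dom s \<Omega>" "wform W" by (rule S)
  have nrm: "W.nrm u = sqrt (wquad W u)" for u by (simp add: W.nrm_def wform_self)
  have L2_le: "L2_norm u \<le> W.nrm u" if "u \<in> form_dom s \<Omega>" for u
    using wquad_mono[OF that admissible_const W(1), of 1] W(2) wquad_1[OF form_dom_L2[OF that]]
    unfolding nrm by (simp add: real_le_rsqrt)
  show "W.is_complete"
    unfolding W.is_complete_def
  proof (intro allI impI)
    fix X assume C: "W.cauchy X"
    then have X: "X n \<in> form_dom s \<Omega>" for n by (auto simp: W.cauchy_def)
    note XL = form_dom_L2[OF X]
    have C2: "L2.cauchy X"
      unfolding L2.cauchy_def L2_nrm_eq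
    proof (intro conjI allI impI XL)
      fix e :: real assume "e > 0"
      then obtain N where "\<forall>m\<ge>N. \<forall>n\<ge>N. W.nrm (\<lambda>x. X m x - X n x) < e" using C by (auto simp: W.cauchy_def)
      then show "\<exists>N. \<forall>m\<ge>N. \<forall>n\<ge>N. L2_norm (\<lambda>x. X m x - X n x) < e"
        using L2_le[OF form_dom_diff[OF X X]] by (meson le_less_trans)
    qed
    obtain u where u: "u \<in> L2_on \<Omega>" and lim: "(\<lambda>n. L2_norm (\<lambda>x. X n x - u x)) \<longlonglongrightarrow> 0"
      by (rule L2_on_limit[OF C2 form_dom_L2_on[OF X]])
    note uL = L2_onD[OF u]
    \<comment> \<open>The transforms converge almost everywhere along a subsequence; Plancherel will
      identify the limit with \<open>FT u\<close>.\<close>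
    obtain g r where g: "g \<in> L2" and r: "strict_mono r" and gAE: "AE \<xi> in lborel. (\<lambda>k. FT (X (r k)) \<xi>) \<longlonglongrightarrow> g \<xi>"
      and glim: "(\<lambda>n. L2_norm (\<lambda>\<xi>. FT (X n) \<xi> - g \<xi>)) \<longlonglongrightarrow> 0"
      by (rule Riesz_Fischer[OF FT_cauchy[OF C2]])
    have "L2_norm (\<lambda>\<xi>. FT (X n) \<xi> - FT u \<xi>) = L2_norm (\<lambda>x. X n x - u x)" for n
    proof -
      have "L2_norm (\<lambda>\<xi>. FT (X n) \<xi> - FT u \<xi>) = L2_norm (FT (\<lambda>x. X n x - u x))"
        using FT_diff[OF XL uL, of n]
        by (intro L2_norm_cong_AE) (auto intro!: L2D L2_diff FT_L2 XL uL elim!: eventually_mono)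
      then show ?thesis by (simp add: FT_norm L2_diff XL uL)
    qed
    then have "AE \<xi> in lborel. g \<xi> = FT u \<xi>"
      using lim by (intro L2_limit_unique[OF FT_L2[OF XL] g glim FT_L2[OF uL]]) simp
    with gAE have AE: "AE \<xi> in lborel. (\<lambda>k. FT (X (r k)) \<xi>) \<longlonglongrightarrow> FT u \<xi>" by eventually_elim simp
    note [measurable] = L2D[OF FT_L2[OF uL]] L2D[OF FT_L2[OF XL]] L2D[OF FT_L2[OF L2_diff[OF XL XL]]] L2D[OF FT_L2[OF L2_diff[OF XL uL]]]
    have fatou: "(\<integral>\<^sup>+\<xi>. ennreal (W \<xi> * (cmod (FT (\<lambda>x. X m x - u x) \<xi>))\<^sup>2) \<partial>lborel) \<le> ennreal (e\<^sup>2)"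
      if e: "e > 0" and M: "\<And>n. n \<ge> M \<Longrightarrow> W.nrm (\<lambda>x. X m x - X n x) < e" for m M e
    proof -
      have AE2: "AE \<xi> in lborel. \<forall>k. FT (\<lambda>x. X m x - X (r k) x) \<xi> = FT (X m) \<xi> - FT (X (r k)) \<xi>"
        by (subst AE_all_countable) (auto intro: FT_diff XL)
      have "(\<integral>\<^sup>+\<xi>. ennreal (W \<xi> * (cmod (FT (\<lambda>x. X m x - u x) \<xi>))\<^sup>2) \<partial>lborel)
         = (\<integral>\<^sup>+\<xi>. liminf (\<lambda>k. ennreal (W \<xi> * (cmod (FT (\<lambda>x. X m x - X (r k) x) \<xi>))\<^sup>2)) \<partial>lborel)"
        using AE AE2 FT_diff[OF XL[of m] uL]
      proof (intro nn_integral_cong_AE, eventually_elim)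
        case (elim \<xi>)
        have e: "(\<lambda>k. FT (X (r k)) \<xi>) \<longlonglongrightarrow> FT u \<xi>"
          "\<And>k. FT (\<lambda>x. X m x - X (r k) x) \<xi> = FT (X m) \<xi> - FT (X (r k)) \<xi>"
          "FT (\<lambda>x. X m x - u x) \<xi> = FT (X m) \<xi> - FT u \<xi>"
          by (fact elim, rule elim[rule_format], fact elim)
        have "(\<lambda>k. ennreal (W \<xi> * (cmod (FT (X m) \<xi> - FT (X (r k)) \<xi>))\<^sup>2))
            \<longlonglongrightarrow> ennreal (W \<xi> * (cmod (FT (X m) \<xi> - FT u \<xi>))\<^sup>2)"
          by (intro tendsto_intros e(1))
        then have "(\<lambda>k. ennreal (W \<xi> * (cmod (FT (\<lambda>x. X m x - X (r k) x) \<xi>))\<^sup>2))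
            \<longlonglongrightarrow> ennreal (W \<xi> * (cmod (FT (\<lambda>x. X m x - u x) \<xi>))\<^sup>2)"
          by (simp only: e)
        then show ?case by (rule lim_imp_Liminf[OF trivial_limit_sequentially, symmetric])
      qed
      also have "\<dots> \<le> liminf (\<lambda>k. \<integral>\<^sup>+\<xi>. ennreal (W \<xi> * (cmod (FT (\<lambda>x. X m x - X (r k) x) \<xi>))\<^sup>2) \<partial>lborel)"
        by (intro nn_integral_liminf) measurable
      also have "\<dots> \<le> liminf (\<lambda>k. ennreal (e\<^sup>2))"
      proof (rule Liminf_mono, rule eventually_sequentiallyI[of M])
        fix k assume "M \<le> k"
        then have "r k \<ge> M" using seq_suble[OF r, of k] by linarith
        then have "W.nrm (\<lambda>x. X m x - X (r k) x) \<le> e" using M by (simp add: less_imp_le)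
        then have "(W.nrm (\<lambda>x. X m x - X (r k) x))\<^sup>2 \<le> e\<^sup>2"
          by (intro power_mono W.nrm_nonneg form_dom_diff X)
        then have "wquad W (\<lambda>x. X m x - X (r k) x) \<le> e\<^sup>2"
          unfolding nrm by (simp add: wquad_nonneg W0)
        then show "(\<integral>\<^sup>+\<xi>. ennreal (W \<xi> * (cmod (FT (\<lambda>x. X m x - X (r k) x) \<xi>))\<^sup>2) \<partial>lborel) \<le> ennreal (e\<^sup>2)"
          using W0 by (subst nn_integral_eq_integral) (auto intro!: form_dom_integrable[OF form_dom_diff[OF X X] W(1)] ennreal_leI simp: wquad_def)
      qed
      finally show ?thesis by (simp add: Liminf_const)
    qed
    have dom: "(\<lambda>x. X m x - u x) \<in> form_dom s \<Omega>"
      if "e > 0" "\<And>n. n \<ge> M \<Longrightarrow> W.nrm (\<lambda>x. X m x - X n x) < e" for m M e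
    proof -
      have "integrable lborel (\<lambda>\<xi>. norm \<xi> powr (2 * s) * (cmod (FT (\<lambda>x. X m x - u x) \<xi>))\<^sup>2)"
      proof (rule integrableI_bounded)
        have "(\<integral>\<^sup>+\<xi>. ennreal (norm (norm \<xi> powr (2 * s) * (cmod (FT (\<lambda>x. X m x - u x) \<xi>))\<^sup>2)) \<partial>lborel)
           \<le> (\<integral>\<^sup>+\<xi>. ennreal (W \<xi> * (cmod (FT (\<lambda>x. X m x - u x) \<xi>))\<^sup>2) \<partial>lborel)"
          by (intro nn_integral_mono ennreal_leI) (auto simp: abs_mult intro!: mult_right_mono W)
        also have "\<dots> \<le> ennreal (e\<^sup>2)" by (rule fatou[OF that])
        finally show "(\<integral>\<^sup>+\<xi>. ennreal (norm (norm \<xi> powr (2 * s) * (cmod (FT (\<lambda>x. X m x - u x) \<xi>))\<^sup>2)) \<partial>lborel) < \<infinity>"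
          by (auto simp: top_unique intro: le_less_trans)
      qed measurable
      then show ?thesis using L2_on_diff[OF form_dom_L2_on[OF X] u] by (simp add: form_dom_iff)
    qed
    have CX: "\<exists>N. \<forall>m\<ge>N. \<forall>n\<ge>N. W.nrm (\<lambda>x. X m x - X n x) < e" if "e > 0" for e
      using C that by (auto simp: W.cauchy_def)
    obtain M where "\<And>n. n \<ge> M \<Longrightarrow> W.nrm (\<lambda>x. X M x - X n x) < 1" using CX[of 1] by auto
    then have "(\<lambda>x. X M x - u x) \<in> form_dom s \<Omega>" by (rule dom[OF zero_less_one])
    \<comment> \<open>Only the differences are controlled by \<open>fatou\<close>, so
      \<open>u\<close> is recovered as \<open>X M\<close> minus such a difference.\<close>
    from form_dom_diff[OF X[of M] this] have ud: "u \<in> form_dom s \<Omega>" by simp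
    have "(\<lambda>n. W.nrm (\<lambda>x. X n x - u x)) \<longlonglongrightarrow> 0"
    proof (rule LIMSEQ_I)
      fix e :: real assume e: "e > 0"
      obtain M where M: "\<And>m n. m \<ge> M \<Longrightarrow> n \<ge> M \<Longrightarrow> W.nrm (\<lambda>x. X m x - X n x) < e/2"
        using CX[of "e/2"] e by auto
      have "W.nrm (\<lambda>x. X n x - u x) \<le> e/2" if n: "n \<ge> M" for n
      proof -
        have "ennreal (wquad W (\<lambda>x. X n x - u x)) \<le> ennreal ((e/2)\<^sup>2)"
          unfolding nn_integral_wquad[OF form_dom_diff[OF X ud] W(1) W0, symmetric]
          by (rule fatou[OF _ M[OF n]]) (use e in auto)
        then have "wquad W (\<lambda>x. X n x - u x) \<le> (e/2)\<^sup>2" by simp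
        then show ?thesis unfolding nrm using e by (intro real_le_lsqrt) (auto simp: wquad_nonneg W0)
      qed
      then have "\<forall>n\<ge>M. norm (W.nrm (\<lambda>x. X n x - u x) - 0) < e"
        using e W.nrm_nonneg[OF form_dom_diff[OF X ud]] by fastforce
      then show "\<exists>no. \<forall>n\<ge>no. norm (W.nrm (\<lambda>x. X n x - u x) - 0) < e" by blast
    qed
    with ud show "\<exists>u\<in>form_dom s \<Omega>. (\<lambda>n. W.nrm (\<lambda>x. X n x - u x)) \<longlonglongrightarrow> 0" by blast
  qed
qed

subsection \<open>Compactness for bounded supports\<close>

lemma cmod_exp_diff_le: "cmod (exp (- \<i> * complex_of_real a) - exp (- \<i> * complex_of_real b)) \<le> \<bar>a - b\<bar>"
proof -
  have "exp (- \<i> * complex_of_real a) - exp (- \<i> * complex_of_real b)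
     = exp (- \<i> * complex_of_real b) * (iexp (b - a) - 1)"
    by (simp add: algebra_simps flip: exp_add)
  then have "cmod (exp (- \<i> * complex_of_real a) - exp (- \<i> * complex_of_real b)) = cmod (iexp (b - a) - 1)"
    by (simp add: norm_mult)
  also have "\<dots> \<le> \<bar>b - a\<bar>" using iexp_approx1[of "b - a" 0] by simp
  finally show ?thesis by simp
qed

text \<open>On a support of radius \<open>R\<close> the phases at two frequencies differ by at most
  \<open>dist \<xi> \<eta> * R\<close>. This supplies the equicontinuity in the compactness
  argument.\<close>

lemma fourier_L1_lipschitz:
  fixes f :: "'b::euclidean_space \<Rightarrow> complex"
  assumes f: "integrable lborel f" and R: "AE x in lborel. f x = 0 \<or> norm x \<le> R"
  shows "cmod (fourier_L1 f \<xi> - fourier_L1 f \<eta>) \<le> (2 * pi) powr (- real DIM('b) / 2) * (dist \<xi> \<eta> * R * (\<integral>x. cmod (f x) \<partial>lborel))"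
proof -
  let ?e = "\<lambda>\<xi> x. exp (- \<i> * complex_of_real (\<xi> \<bullet> x)) * f x"
  note i = integrable_exp_mult[OF f]
  have "fourier_L1 f \<xi> - fourier_L1 f \<eta> = complex_of_real ((2 * pi) powr (- real DIM('b) / 2)) * (\<integral>x. ?e \<xi> x - ?e \<eta> x \<partial>lborel)"
    unfolding fourier_L1_def Bochner_Integration.integral_diff[OF i i] by (simp add: right_diff_distrib)
  moreover have "cmod (\<integral>x. ?e \<xi> x - ?e \<eta> x \<partial>lborel) \<le> dist \<xi> \<eta> * R * (\<integral>x. cmod (f x) \<partial>lborel)"
  proof -
    have "cmod (\<integral>x. ?e \<xi> x - ?e \<eta> x \<partial>lborel) \<le> (\<integral>x. cmod (?e \<xi> x - ?e \<eta> x) \<partial>lborel)"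
      by (rule integral_norm_bound)
    also have "\<dots> \<le> (\<integral>x. dist \<xi> \<eta> * R * cmod (f x) \<partial>lborel)"
    proof (rule integral_mono_AE)
      show "AE x in lborel. cmod (?e \<xi> x - ?e \<eta> x) \<le> dist \<xi> \<eta> * R * cmod (f x)"
        using R
      proof eventually_elim
        case (elim x)
        show ?case
        proof (cases "f x = 0")
          case False
          with elim have x: "norm x \<le> R" by simp
          have "cmod (?e \<xi> x - ?e \<eta> x) = cmod (exp (- \<i> * complex_of_real (\<xi> \<bullet> x)) - exp (- \<i> * complex_of_real (\<eta> \<bullet> x))) * cmod (f x)"
            by (simp add: norm_mult flip: left_diff_distrib)
          also have "\<dots> \<le> \<bar>(\<xi> - \<eta>) \<bullet> x\<bar> * cmod (f x)"
            by (intro mult_right_mono order_trans[OF cmod_exp_diff_le]) (auto simp: inner_diff_left)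
          also have "\<dots> \<le> dist \<xi> \<eta> * R * cmod (f x)"
            using Cauchy_Schwarz_ineq2[of "\<xi> - \<eta>" x] mult_left_mono[OF x, of "dist \<xi> \<eta>"]
            by (intro mult_right_mono) (auto simp: dist_norm)
          finally show ?thesis .
        qed simp
      qed
    qed (use f i in auto)
    finally show ?thesis by simp
  qed
  ultimately show ?thesis by (simp add: norm_mult mult_left_mono)
qed

text \<open>Rellich's theorem on the Fourier side. Bounded support makes the transforms uniformly
  bounded and equi-Lipschitz, so a subsequence converges at every frequency and, by dominated
  convergence, in L2 of every ball; outside a large ball the energy bound controls the mass.\<close>

lemma form_dom_compact:
  fixes X :: "nat \<Rightarrow> 'b::euclidean_space \<Rightarrow> complex"
  assumes s: "0 < s" and S: "S \<in> sets borel" "bounded S" and X: "\<And>n. X n \<in> form_dom s S"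
    and X1: "\<And>n. L2_norm (X n) \<le> 1" and XM: "\<And>n. wquad (pw s) (X n) \<le> M"
  obtains r where "strict_mono r" "L2.cauchy (\<lambda>n. X (r n))"
proof -
  define c where "c = (2 * pi) powr (- real DIM('b) / 2)"
  define K where "K = L2_norm (indicator S :: 'b \<Rightarrow> complex)"
  define F where "F n = fourier_L1 (X n)" for n
  have c: "0 \<le> c" and K: "0 \<le> K" by (auto simp: c_def K_def)
  note XL = form_dom_L2[OF X]
  note XS = form_dom_L2_on[OF X]
  note Xint = L2_on_integrable(1)[OF XS S]
  have XK: "(\<integral>x. cmod (X n x) \<partial>lborel) \<le> K" for n
    using L2_on_integrable(2)[OF XS S, of n] mult_right_mono[OF X1 K, of n] by (simp add: K_def)
  have bd: "cmod (F n \<xi>) \<le> c * K" for n \<xi>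
    unfolding F_def c_def by (rule order_trans[OF fourier_L1_bound mult_left_mono[OF XK]]) simp
  obtain R where R: "R > 0" "\<And>x. x \<in> S \<Longrightarrow> norm x \<le> R" using S(2) bounded_pos by blast
  have lip: "cmod (F n \<xi> - F n \<eta>) \<le> c * (dist \<xi> \<eta> * R * K)" for n \<xi> \<eta>
  proof -
    have "AE x in lborel. X n x = 0 \<or> norm x \<le> R"
      using XS[of n] R(2) unfolding L2_on_def by (auto elim!: eventually_mono)
    from fourier_L1_lipschitz[OF Xint this, of \<xi> \<eta>]
    have "cmod (F n \<xi> - F n \<eta>) \<le> c * (dist \<xi> \<eta> * R * (\<integral>x. cmod (X n x) \<partial>lborel))"
      by (simp add: F_def c_def)
    also have "\<dots> \<le> c * (dist \<xi> \<eta> * R * K)" using c R XK by (intro mult_left_mono) auto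
    finally show ?thesis .
  qed
  obtain D :: "'b set" where D: "countable D" "\<And>U. open U \<Longrightarrow> U \<noteq> {} \<Longrightarrow> \<exists>d\<in>D. d \<in> U"
    by (rule countable_dense_setE) auto
  \<comment> \<open>Diagonal extraction over a countable dense set of frequencies.\<close>
  obtain k :: "nat \<Rightarrow> nat" where k: "strict_mono k" "\<And>x. x \<in> D \<Longrightarrow> \<exists>l. (\<lambda>n. F (k n) x) \<longlonglongrightarrow> l"
    by (rule function_convergent_subsequence[OF D(1), of F "c * K"]) (use bd in auto)
  have conv: "convergent (\<lambda>n. F (k n) \<xi>)" for \<xi>
  proof (rule Cauchy_convergent, rule metric_CauchyI)
    fix e :: real assume e: "e > 0"
    \<comment> \<open>\<open>c * R * K\<close> is the common Lipschitz constant; adding 1 keeps the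
      denominator positive.\<close>
    define d where "d = e / 3 / (c * R * K + 1)"
    have pos: "0 < c * R * K + 1" using c R K by (intro add_nonneg_pos mult_nonneg_nonneg) auto
    have d: "d > 0" using e pos by (simp add: d_def)
    then obtain y where y: "y \<in> D" "dist \<xi> y < d" using D(2)[of "ball \<xi> d"] by auto
    have small: "cmod (F n \<xi> - F n y) < e / 3" for n
    proof -
      have "c * (dist \<xi> y * R * K) = dist \<xi> y * (c * R * K)" by simp
      also have "\<dots> \<le> dist \<xi> y * (c * R * K + 1)" by (intro mult_left_mono) auto
      also have "\<dots> < d * (c * R * K + 1)" using y pos by (intro mult_strict_right_mono) auto
      also have "\<dots> = e / 3" using pos unfolding d_def by (intro nonzero_eq_divide_eq[THEN iffD1]) auto
      finally show ?thesis using lip[of n \<xi> y] by simp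
    qed
    have "Cauchy (\<lambda>n. F (k n) y)" using k(2)[OF y(1)] LIMSEQ_imp_Cauchy by blast
    then obtain N where N: "\<And>m n. m \<ge> N \<Longrightarrow> n \<ge> N \<Longrightarrow> dist (F (k m) y) (F (k n) y) < e / 3"
      using e unfolding Cauchy_def by (metis zero_less_divide_iff zero_less_numeral)
    have "dist (F (k m) \<xi>) (F (k n) \<xi>) < e" if "m \<ge> N" "n \<ge> N" for m n
    proof -
      have "dist (F (k m) \<xi>) (F (k n) \<xi>) \<le> dist (F (k m) \<xi>) (F (k m) y) + (dist (F (k m) y) (F (k n) y) + dist (F (k n) y) (F (k n) \<xi>))"
        by (meson add_left_mono dist_triangle order_trans)
      then show ?thesis using small[of "k m"] small[of "k n"] N[OF that]
        by (simp add: dist_norm norm_minus_commute)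
    qed
    then show "\<exists>N. \<forall>m\<ge>N. \<forall>n\<ge>N. dist (F (k m) \<xi>) (F (k n) \<xi>) < e" by blast
  qed
  define G where "G \<xi> = lim (\<lambda>n. F (k n) \<xi>)" for \<xi>
  have G: "(\<lambda>n. F (k n) \<xi>) \<longlonglongrightarrow> G \<xi>" for \<xi> using conv by (simp add: G_def convergent_LIMSEQ_iff)
  have FL: "F n \<in> L2" for n unfolding F_def by (intro plancherel_L1_L2 XL Xint)
  note [measurable] = L2D[OF FL] L2D[OF FT_L2[OF XL]]
  have [measurable]: "G \<in> borel_measurable borel" unfolding G_def by measurable
  have FGm: "(\<lambda>\<xi>. (cmod (F n \<xi> - G \<xi>))\<^sup>2) \<in> borel_measurable borel" for n by measurable
  have GK: "cmod (G \<xi>) \<le> c * K" for \<xi>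
    by (rule tendsto_upperbound[OF tendsto_norm[OF G]]) (use bd in auto)
  define I where "I \<rho> n = (\<integral>\<xi>. indicator (cball 0 \<rho>) \<xi> * (cmod (F (k n) \<xi> - G \<xi>))\<^sup>2 \<partial>lborel)" for \<rho> n
  have FG: "(cmod (F n \<xi> - G \<xi>))\<^sup>2 \<le> (2 * (c * K))\<^sup>2" for n \<xi>
    using norm_triangle_ineq4[of "F n \<xi>" "G \<xi>"] bd[of n \<xi>] GK[of \<xi>] by (intro power_mono) auto
  have ball_int: "integrable lborel (\<lambda>\<xi>::'b. indicator (cball 0 \<rho>) \<xi> * (2 * (c * K))\<^sup>2)" for \<rho>
    using emeasure_bounded_finite[OF bounded_cball[of "0::'b" \<rho>]]
    by (intro integrable_mult_left integrable_real_indicator) auto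
  have I_int: "integrable lborel (\<lambda>\<xi>. indicator (cball 0 \<rho>) \<xi> * (cmod (F (k n) \<xi> - G \<xi>))\<^sup>2)" for \<rho> n
  proof (rule Bochner_Integration.integrable_bound[OF ball_int[of \<rho>]])
    show "AE \<xi> in lborel. norm (indicator (cball 0 \<rho>) \<xi> * (cmod (F (k n) \<xi> - G \<xi>))\<^sup>2) \<le> norm (indicator (cball 0 \<rho>) \<xi> * (2 * (c * K))\<^sup>2)"
      using FG[of "k n"] by (auto intro!: always_eventually mult_left_mono simp: abs_mult)
  qed (use FGm[of "k n"] in \<open>intro borel_measurable_times borel_measurable_indicator; simp\<close>)
  have I: "I \<rho> \<longlonglongrightarrow> 0" for \<rho>
  proof -
    have "(\<lambda>n. \<integral>\<xi>. indicator (cball 0 \<rho>) \<xi> * (cmod (F (k n) \<xi> - G \<xi>))\<^sup>2 \<partial>lborel) \<longlonglongrightarrow> (\<integral>\<xi>. 0 \<partial>(lborel :: 'b measure))"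
    proof (rule integral_dominated_convergence[where w="\<lambda>\<xi>. indicator (cball 0 \<rho>) \<xi> * (2 * (c * K))\<^sup>2"])
      show "AE \<xi> in lborel. (\<lambda>n. indicator (cball 0 \<rho>) \<xi> * (cmod (F (k n) \<xi> - G \<xi>))\<^sup>2) \<longlonglongrightarrow> 0"
      proof (intro always_eventually allI)
        fix \<xi>
        have "(\<lambda>n. indicator (cball 0 \<rho>) \<xi> * (cmod (F (k n) \<xi> - G \<xi>))\<^sup>2) \<longlonglongrightarrow> indicator (cball 0 \<rho>) \<xi> * (cmod (G \<xi> - G \<xi>))\<^sup>2"
          by (intro tendsto_intros G)
        then show "(\<lambda>n. indicator (cball 0 \<rho>) \<xi> * (cmod (F (k n) \<xi> - G \<xi>))\<^sup>2) \<longlonglongrightarrow> 0" by simp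
      qed
      show "AE \<xi> in lborel. norm (indicator (cball 0 \<rho>) \<xi> * (cmod (F (k n) \<xi> - G \<xi>))\<^sup>2) \<le> indicator (cball 0 \<rho>) \<xi> * (2 * (c * K))\<^sup>2" for n
        using FG[of "k n"] by (auto intro!: always_eventually mult_left_mono simp: abs_mult)
    qed (use ball_int I_int in auto)
    then show ?thesis by (simp add: I_def[abs_def])
  qed
  have FTF: "AE \<xi> in lborel. FT (X n) \<xi> = F n \<xi>" for n unfolding F_def by (rule FT_eq_fourier_L1[OF XL Xint])
  let ?p = "\<lambda>\<xi>::'b. norm \<xi> powr (2 * s)"
  have p_int: "integrable lborel (\<lambda>\<xi>. ?p \<xi> * (cmod (F n \<xi>))\<^sup>2)" for n
    using form_dom_integrable[OF X admissible_pw, of n] FTF[of n]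
    by (subst integrable_cong_AE[of _ _ "\<lambda>\<xi>. ?p \<xi> * (cmod (FT (X n) \<xi>))\<^sup>2"]) (auto elim!: eventually_mono)
  have p_le: "(\<integral>\<xi>. ?p \<xi> * (cmod (F n \<xi>))\<^sup>2 \<partial>lborel) \<le> M" for n
  proof -
    have "(\<integral>\<xi>. ?p \<xi> * (cmod (F n \<xi>))\<^sup>2 \<partial>lborel) = wquad ?p (X n)"
      unfolding wquad_def using FTF[of n] by (intro integral_cong_AE) (auto elim!: eventually_mono)
    then show ?thesis using XM[of n] by simp
  qed
  have M: "0 \<le> M" using XM[of 0] wquad_nonneg[of ?p "X 0"] by (meson order_trans powr_ge_zero)
  \<comment> \<open>Inside the ball of radius \<open>\<rho>\<close> both transforms are compared
    with \<open>G\<close>; outside it 1 is at most \<rho>^(-2s) |\<xi>|^(2s), which brings in the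
    energies.\<close>
  have main: "(L2_norm (\<lambda>x. X (k m) x - X (k n) x))\<^sup>2 \<le> (2 * I \<rho> m + 2 * I \<rho> n) + \<rho> powr (- 2 * s) * (4 * M)"
    if \<rho>: "\<rho> > 0" for \<rho> m n
  proof -
    let ?i = "\<lambda>n \<xi>. indicator (cball 0 \<rho>) \<xi> * (cmod (F (k n) \<xi> - G \<xi>))\<^sup>2"
    let ?q = "\<lambda>n \<xi>. ?p \<xi> * (cmod (F (k n) \<xi>))\<^sup>2"
    have pt: "(cmod (F (k m) \<xi> - F (k n) \<xi>))\<^sup>2 \<le> (2 * ?i m \<xi> + 2 * ?i n \<xi>) + \<rho> powr (- 2 * s) * (2 * ?q m \<xi> + 2 * ?q n \<xi>)" for \<xi>
    proof (cases "norm \<xi> \<le> \<rho>")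
      case True
      have "(cmod (F (k m) \<xi> - F (k n) \<xi>))\<^sup>2 \<le> 2 * (cmod (F (k m) \<xi> - G \<xi>))\<^sup>2 + 2 * (cmod (G \<xi> - F (k n) \<xi>))\<^sup>2"
        using cmod_add_sq_le[of "F (k m) \<xi> - G \<xi>" "G \<xi> - F (k n) \<xi>"] by simp
      also have "\<dots> = 2 * ?i m \<xi> + 2 * ?i n \<xi>" using True by (simp add: indicator_def norm_minus_commute)
      also have "\<dots> \<le> (2 * ?i m \<xi> + 2 * ?i n \<xi>) + \<rho> powr (- 2 * s) * (2 * ?q m \<xi> + 2 * ?q n \<xi>)"
      proof -
        have "0 \<le> \<rho> powr (- 2 * s) * (2 * ?q m \<xi> + 2 * ?q n \<xi>)"
          by (intro mult_nonneg_nonneg add_nonneg_nonneg) auto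
        then show ?thesis by linarith
      qed
      finally show ?thesis .
    next
      case False
      have 1: "1 \<le> \<rho> powr (- 2 * s) * ?p \<xi>"
      proof -
        have "\<rho> powr (- 2 * s) * \<rho> powr (2 * s) \<le> \<rho> powr (- 2 * s) * ?p \<xi>"
          using False \<rho> s by (intro mult_left_mono powr_mono2) auto
        then show ?thesis using \<rho> by (simp flip: powr_add)
      qed
      have "(cmod (F (k m) \<xi> - F (k n) \<xi>))\<^sup>2 \<le> 2 * (cmod (F (k m) \<xi>))\<^sup>2 + 2 * (cmod (F (k n) \<xi>))\<^sup>2"
        using cmod_add_sq_le[of "F (k m) \<xi>" "- F (k n) \<xi>"] by simp
      also have "\<dots> \<le> (\<rho> powr (- 2 * s) * ?p \<xi>) * (2 * (cmod (F (k m) \<xi>))\<^sup>2 + 2 * (cmod (F (k n) \<xi>))\<^sup>2)"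
        using mult_right_mono[OF 1, of "2 * (cmod (F (k m) \<xi>))\<^sup>2 + 2 * (cmod (F (k n) \<xi>))\<^sup>2"] by simp
      finally show ?thesis using False by (simp add: indicator_def algebra_simps)
    qed
    have "(L2_norm (\<lambda>x. X (k m) x - X (k n) x))\<^sup>2 = (L2_norm (\<lambda>\<xi>. F (k m) \<xi> - F (k n) \<xi>))\<^sup>2"
      unfolding F_def by (simp add: plancherel_diff XL Xint)
    also have "\<dots> = (\<integral>\<xi>. (cmod (F (k m) \<xi> - F (k n) \<xi>))\<^sup>2 \<partial>lborel)" by (rule L2_norm_sq)
    also have "\<dots> \<le> (\<integral>\<xi>. (2 * ?i m \<xi> + 2 * ?i n \<xi>) + \<rho> powr (- 2 * s) * (2 * ?q m \<xi> + 2 * ?q n \<xi>) \<partial>lborel)"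
      by (rule integral_mono[OF _ _ pt])
        (intro L2_integrable L2_diff FL Bochner_Integration.integrable_add integrable_mult_right I_int p_int)+
    also have "\<dots> = (2 * I \<rho> m + 2 * I \<rho> n) + \<rho> powr (- 2 * s) * (2 * (\<integral>\<xi>. ?q m \<xi> \<partial>lborel) + 2 * (\<integral>\<xi>. ?q n \<xi> \<partial>lborel))"
      using I_int p_int by (simp add: I_def)
    also have "\<dots> \<le> (2 * I \<rho> m + 2 * I \<rho> n) + \<rho> powr (- 2 * s) * (4 * M)"
      using p_le[of "k m"] p_le[of "k n"] by (intro add_left_mono mult_left_mono) auto
    finally show ?thesis .
  qed
  have "L2.cauchy (\<lambda>n. X (k n))"
    unfolding L2.cauchy_def L2_nrm_eq
  proof (intro conjI allI impI XL)
    fix e :: real assume e: "e > 0"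
    \<comment> \<open>Chosen so that \<rho>^(2s) = 8 (M + 1) / e^2: the tail is then at most half of
      e^2, and the two ball terms, each below 2 (e^2 / 8), fill the other half.\<close>
    define \<rho> where "\<rho> = (8 * (M + 1) / e\<^sup>2) powr (1 / (2 * s))"
    have "\<rho> > 0" using e M by (simp add: \<rho>_def)
    have "\<rho> powr (2 * s) = 8 * (M + 1) / e\<^sup>2"
      unfolding \<rho>_def powr_powr using s e M by simp
    then have "\<rho> powr (- 2 * s) = e\<^sup>2 / (8 * (M + 1))" by (simp add: powr_minus)
    then have "\<rho> powr (- 2 * s) * (4 * M) = (e\<^sup>2 / 2) * (M / (M + 1))" using M by (simp add: field_simps)
    also have "\<dots> \<le> (e\<^sup>2 / 2) * 1" using M by (intro mult_left_mono) auto
    finally have tail: "\<rho> powr (- 2 * s) * (4 * M) \<le> e\<^sup>2 / 2" by simp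
    have "eventually (\<lambda>n. I \<rho> n < e\<^sup>2 / 8) sequentially" using I e by (intro order_tendstoD(2)[where y=0]) auto
    then obtain N where N: "\<And>n. n \<ge> N \<Longrightarrow> I \<rho> n < e\<^sup>2 / 8" by (auto simp: eventually_sequentially)
    have "L2_norm (\<lambda>x. X (k m) x - X (k n) x) < e" if "m \<ge> N" "n \<ge> N" for m n
    proof -
      have "(L2_norm (\<lambda>x. X (k m) x - X (k n) x))\<^sup>2 < e\<^sup>2"
        using main[OF \<open>\<rho> > 0\<close>, of m n] tail N[OF that(1)] N[OF that(2)] by linarith
      then show ?thesis using e by (meson less_imp_le power_less_imp_less_base)
    qed
    then show "\<exists>N. \<forall>m\<ge>N. \<forall>n\<ge>N. L2_norm (\<lambda>x. X (k m) x - X (k n) x) < e" by blast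
  qed
  with k(1) show thesis by (rule that)
qed

subsection \<open>The lowest eigenvalue of a shifted symbol\<close>

text \<open>After division by \<open>a + b\<close> both terms lie in [0, 1], where x \<le> x^s, and
  the two quotients sum to 1.\<close>

lemma powr_add_le:
  fixes a b s :: real
  assumes "0 \<le> a" "0 \<le> b" "0 < s" "s \<le> 1"
  shows "(a + b) powr s \<le> a powr s + b powr s"
proof (cases "a + b = 0")
  case False
  with assms have T: "a + b > 0" by simp
  have *: "x / (a + b) \<le> (x / (a + b)) powr s" if "0 \<le> x" "x \<le> a + b" for x
    using powr_mono'[of s 1 "x / (a + b)"] that T assms by simp
  have "1 = a / (a + b) + b / (a + b)" using T by (simp add: add_divide_distrib[symmetric])
  also have "\<dots> \<le> (a / (a + b)) powr s + (b / (a + b)) powr s"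
    using assms by (intro add_mono *) auto
  also have "\<dots> = (a powr s + b powr s) / (a + b) powr s"
    using assms T by (simp add: powr_divide add_divide_distrib)
  finally show ?thesis using T by (simp add: pos_le_divide_eq)
qed (use assms in auto)

text \<open>Hoelder continuity with constant 1. It gives both the continuity of
  \<open>bottom\<close> in \<open>t\<close> and the size of the error symbol on the
  cylinder.\<close>

lemma abs_powr_diff_le:
  fixes a b s :: real
  assumes "0 \<le> a" "0 \<le> b" "0 < s" "s \<le> 1"
  shows "\<bar>a powr s - b powr s\<bar> \<le> \<bar>a - b\<bar> powr s"
proof (cases "a \<le> b")
  case True
  then show ?thesis using powr_add_le[of a "b - a" s] assms powr_mono2[of s a b] by simp
next
  case False
  then show ?thesis using powr_add_le[of b "a - b" s] assms powr_mono2[of s b a] by simp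
qed

definition symb :: "real \<Rightarrow> real \<Rightarrow> 'b::euclidean_space \<Rightarrow> real" where
  "symb s t \<xi> = ((norm \<xi>)\<^sup>2 + t\<^sup>2) powr s"

lemma norm_sq_powr: "((norm x)\<^sup>2) powr s = norm x powr (2 * s)"
proof (cases "norm x = 0")
  case False
  then have "(norm x)\<^sup>2 = norm x powr 2" by simp
  then show ?thesis by (simp only: powr_powr)
qed simp

lemma symb_0: "symb s 0 = pw s"
  by (simp add: fun_eq_iff symb_def norm_sq_powr)

lemma symb_ge: "0 < s \<Longrightarrow> norm \<xi> powr (2 * s) \<le> symb s t \<xi>"
  unfolding symb_def norm_sq_powr[symmetric] by (intro powr_mono2) auto

lemma symb_ge_t: "0 < s \<Longrightarrow> (t\<^sup>2) powr s \<le> symb s t \<xi>"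
  unfolding symb_def by (intro powr_mono2) auto

lemma symb_le: "0 < s \<Longrightarrow> s \<le> 1 \<Longrightarrow> symb s t \<xi> \<le> norm \<xi> powr (2 * s) + (t\<^sup>2) powr s"
  unfolding symb_def norm_sq_powr[symmetric] by (intro powr_add_le) auto

lemma symb_nonneg: "0 \<le> symb s t \<xi>"
  by (simp add: symb_def)

lemma admissible_symb:
  assumes "0 < s" "s \<le> 1"
  shows "admissible s (symb s t)"
proof (rule admissibleI[where C="1 + (t\<^sup>2) powr s"])
  show "symb s t \<in> borel_measurable borel" unfolding symb_def by measurable
  fix \<xi> :: 'a
  have "symb s t \<xi> \<le> norm \<xi> powr (2 * s) + (t\<^sup>2) powr s" by (rule symb_le[OF assms])
  also have "\<dots> \<le> (1 + (t\<^sup>2) powr s) * (1 + norm \<xi> powr (2 * s))" by (simp add: algebra_simps)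
  finally show "\<bar>symb s t \<xi>\<bar> \<le> (1 + (t\<^sup>2) powr s) * (1 + norm \<xi> powr (2 * s))" by (simp add: symb_nonneg)
qed

text \<open>The \<Lambda>(t) of the overview, taken as an infimum of energies, so that it is defined
  before any eigenfunction is known to exist.\<close>

definition bottom :: "real \<Rightarrow> 'b::euclidean_space set \<Rightarrow> real \<Rightarrow> real" where
  "bottom s S t = Inf {wquad (symb s t) u |u. u \<in> form_dom s S \<and> L2_norm u = 1}"

lemma bottom_le_1:
  assumes "u \<in> form_dom s S" "L2_norm u = 1"
  shows "bottom s S t \<le> wquad (symb s t) u"
  unfolding bottom_def
  by (rule cInf_lower) (use assms wquad_nonneg[OF symb_nonneg] in \<open>auto intro!: bdd_belowI[of _ 0]\<close>)

lemma wquad_scale: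
  assumes u: "u \<in> form_dom s S" and W: "admissible s W"
  shows "wquad W (\<lambda>x. c * u x) = (cmod c)\<^sup>2 * wquad W u"
proof -
  note [measurable] = L2D[OF FT_L2[OF form_dom_L2[OF u]]] L2D[OF FT_L2[OF L2_scale[OF form_dom_L2[OF u], of c]]] admissible_measurable[OF W]
  have "wquad W (\<lambda>x. c * u x) = (\<integral>\<xi>. (cmod c)\<^sup>2 * (W \<xi> * (cmod (FT u \<xi>))\<^sup>2) \<partial>lborel)"
    unfolding wquad_def using FT_scale[OF form_dom_L2[OF u], of c]
    by (intro integral_cong_AE) (auto elim!: eventually_mono simp: norm_mult power_mult_distrib)
  then show ?thesis by (simp add: wquad_def)
qed

lemma L2_norm_normalise:
  assumes "u \<in> L2" "L2_norm u \<noteq> 0"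
  shows "L2_norm (\<lambda>x. complex_of_real (inverse (L2_norm u)) * u x) = 1"
  using L2.nrm_scale[OF assms(1), of "complex_of_real (inverse (L2_norm u))"] assms(2)
  by (simp add: L2_nrm_eq norm_inverse)

lemma bottom_le:
  assumes s: "0 < s" "s \<le> 1" and u: "u \<in> form_dom s S"
  shows "bottom s S t * (L2_norm u)\<^sup>2 \<le> wquad (symb s t) u"
proof (cases "L2_norm u = 0")
  case True
  then show ?thesis by (simp add: wquad_nonneg symb_nonneg)
next
  case False
  let ?c = "complex_of_real (inverse (L2_norm u))"
  have "bottom s S t \<le> wquad (symb s t) (\<lambda>x. ?c * u x)"
    by (intro bottom_le_1 form_dom_scale u L2_norm_normalise form_dom_L2[OF u] False)
  also have "\<dots> = wquad (symb s t) u / (L2_norm u)\<^sup>2"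
    unfolding wquad_scale[OF u admissible_symb[OF s]] by (simp add: norm_inverse norm_divide power_divide divide_inverse power_inverse)
  finally show ?thesis using False by (simp add: pos_le_divide_eq)
qed

lemma bottom_ge:
  assumes s: "0 < s" "s \<le> 1" and ex: "\<exists>u\<in>form_dom s S. L2_norm u \<noteq> 0"
  shows "(t\<^sup>2) powr s \<le> bottom s S t"
proof -
  obtain u where u: "u \<in> form_dom s S" "L2_norm u \<noteq> 0" using ex by blast
  show ?thesis
    unfolding bottom_def
  proof (rule cInf_greatest)
    show "{wquad (symb s t) u |u. u \<in> form_dom s S \<and> L2_norm u = 1} \<noteq> {}"
      using form_dom_scale[OF u(1)] L2_norm_normalise[OF form_dom_L2[OF u(1)] u(2)] by blast
    fix x assume "x \<in> {wquad (symb s t) u |u. u \<in> form_dom s S \<and> L2_norm u = 1}"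
    then obtain v where v: "v \<in> form_dom s S" "L2_norm v = 1" "x = wquad (symb s t) v" by blast
    have "wquad (\<lambda>_. (t\<^sup>2) powr s) v \<le> wquad (symb s t) v"
      by (rule wquad_mono[OF v(1) admissible_const admissible_symb[OF s] symb_ge_t[OF s(1)]])
    then show "(t\<^sup>2) powr s \<le> x" using v by (simp add: wquad_const form_dom_L2)
  qed
qed

text \<open>The symbol may be negative at low frequencies; the form is nonnegative on the form
  domain because \<open>bottom\<close> is the infimum of the Rayleigh quotients there.\<close>

lemma semi_inner_bottom:
  assumes s: "0 < s" "s \<le> 1"
  shows "semi_inner (form_dom s S) (wform (\<lambda>\<xi>. symb s t \<xi> - bottom s S t))"
proof (rule semi_inner_form_dom)
  show "admissible s (\<lambda>\<xi>. symb s t \<xi> - bottom s S t)" by (intro admissible_diff admissible_symb admissible_const s)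
  show "0 \<le> wquad (\<lambda>\<xi>. symb s t \<xi> - bottom s S t) u" if "u \<in> form_dom s S" for u
    using bottom_le[OF s that, of t] wquad_diff[OF that admissible_symb[OF s] admissible_const, of t "bottom s S t"]
    by (simp add: wquad_const form_dom_L2[OF that])
qed

text \<open>A minimising sequence is a Cauchy sequence for the positive form \<open>symb - bottom\<close>, and along a subsequence
  also in \<open>L\<^sup>2\<close>; hence it converges in the form domain.\<close>

theorem bottom_attained:
  fixes S :: "'b::euclidean_space set"
  assumes s: "0 < s" "s \<le> 1" and S: "S \<in> sets borel" "bounded S"
    and ex: "\<exists>u\<in>form_dom s S. L2_norm u \<noteq> 0"
  obtains \<phi> where "\<phi> \<in> form_dom s S" "L2_norm \<phi> = 1" "wquad (symb s t) \<phi> = bottom s S t"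
proof -
  define L where "L = bottom s S t"
  have L0: "0 \<le> L" using bottom_ge[OF s ex, of t] order_trans[OF powr_ge_zero] unfolding L_def by blast
  interpret B: semi_inner "form_dom s S" "wform (\<lambda>\<xi>. symb s t \<xi> - L)"
    unfolding L_def by (rule semi_inner_bottom[OF s])
  have Bsq: "(B.nrm u)\<^sup>2 = wquad (symb s t) u - L * (L2_norm u)\<^sup>2" if "u \<in> form_dom s S" for u
    using B.nrm_sq[OF that] wquad_diff[OF that admissible_symb[OF s] admissible_const, of t L]
    by (simp add: wform_self wquad_const form_dom_L2[OF that])
  let ?W = "\<lambda>\<xi>::'b. 1 + symb s t \<xi>"
  have W: "admissible s ?W" by (intro admissible_add admissible_const admissible_symb s)
  have W1: "1 \<le> ?W \<xi>" for \<xi> by (simp add: symb_nonneg)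
  have Wp: "norm \<xi> powr (2 * s) \<le> ?W \<xi>" for \<xi>
    using symb_ge[OF s(1), of \<xi> t] by simp
  interpret W: semi_inner "form_dom s S" "wform ?W" by (rule form_dom_form_complete(1)[OF W W1 Wp])
  have complete: "W.is_complete" by (rule form_dom_form_complete(2)[OF W W1 Wp])
  have Wsq: "(W.nrm u)\<^sup>2 = (L2_norm u)\<^sup>2 + wquad (symb s t) u" if "u \<in> form_dom s S" for u
    using W.nrm_sq[OF that] wquad_add[OF that admissible_const admissible_symb[OF s], of 1 t]
    by (simp add: wform_self wquad_const form_dom_L2[OF that])
  \<comment> \<open>In fact \<open>(W.nrm u)\<^sup>2 = (1 + L) * (L2_norm u)\<^sup>2 + (B.nrm
    u)\<^sup>2\<close>, so Cauchy in L2 and Cauchy for the shifted form together mean Cauchy for the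
    complete form.\<close>
  have Wle: "W.nrm u \<le> sqrt (1 + L) * L2_norm u + B.nrm u" if u: "u \<in> form_dom s S" for u
  proof (rule power2_le_imp_le)
    have "(W.nrm u)\<^sup>2 = (sqrt (1 + L) * L2_norm u)\<^sup>2 + (B.nrm u)\<^sup>2"
      unfolding Wsq[OF u] Bsq[OF u] using L0 by (simp add: power_mult_distrib algebra_simps)
    also have "\<dots> \<le> (sqrt (1 + L) * L2_norm u + B.nrm u)\<^sup>2"
      using L0 B.nrm_nonneg[OF u] by (simp add: power2_sum)
    finally show "(W.nrm u)\<^sup>2 \<le> (sqrt (1 + L) * L2_norm u + B.nrm u)\<^sup>2" .
  qed (use L0 u in simp)
  have "\<exists>u\<in>form_dom s S. L2_norm u = 1 \<and> wquad (symb s t) u < L + inverse (real (Suc n))" for n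
  proof -
    have ne: "{wquad (symb s t) u |u. u \<in> form_dom s S \<and> L2_norm u = 1} \<noteq> {}"
      using ex form_dom_scale L2_norm_normalise[OF form_dom_L2] by blast
    have "Inf {wquad (symb s t) u |u. u \<in> form_dom s S \<and> L2_norm u = 1} < L + inverse (real (Suc n))"
      by (simp add: L_def bottom_def)
    from cInf_lessD[OF ne this] show ?thesis by blast
  qed
  then obtain X where X: "\<And>n. X n \<in> form_dom s S" "\<And>n. L2_norm (X n) = 1"
    "\<And>n. wquad (symb s t) (X n) < L + inverse (real (Suc n))" by metis
  have XM: "wquad (pw s) (X n) \<le> L + 1" for n
  proof -
    have "wquad (pw s) (X n) \<le> wquad (symb s t) (X n)"
      by (rule wquad_mono[OF X(1) admissible_pw admissible_symb[OF s] symb_ge[OF s(1)]])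
    also have "\<dots> \<le> L + inverse (real (Suc n))" using X(3)[of n] by simp
    also have "\<dots> \<le> L + 1" by (simp add: inverse_eq_divide divide_le_eq)
    finally show ?thesis .
  qed
  have X1: "L2_norm (X n) \<le> 1" for n by (simp add: X(2))
  obtain r where r: "strict_mono r" "L2.cauchy (\<lambda>n. X (r n))"
    by (rule form_dom_compact[OF s(1) S X(1) X1 XM])
  define Y where "Y n = X (r n)" for n
  have Y: "Y n \<in> form_dom s S" "L2_norm (Y n) = 1" for n using X by (auto simp: Y_def)
  \<comment> \<open>For unit vectors the squared \<open>B.nrm\<close> is the excess of the energy
    over the infimum, which tends to 0 along a minimising sequence.\<close>
  have BY: "(\<lambda>n. B.nrm (Y n)) \<longlonglongrightarrow> 0"
  proof (rule Lim_null_comparison[OF always_eventually])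
    have "(\<lambda>n. sqrt (inverse (real (Suc n)))) \<longlonglongrightarrow> sqrt 0" by (intro tendsto_intros LIMSEQ_inverse_real_of_nat)
    then show "(\<lambda>n. sqrt (inverse (real (Suc n)))) \<longlonglongrightarrow> 0" by simp
    show "\<forall>n. norm (B.nrm (Y n)) \<le> sqrt (inverse (real (Suc n)))"
    proof
      fix n
      have "(B.nrm (Y n))\<^sup>2 \<le> inverse (real (Suc (r n)))"
        using X(3)[of "r n"] unfolding Bsq[OF Y(1)] Y(2) by (simp add: Y_def)
      also have "\<dots> \<le> inverse (real (Suc n))" using seq_suble[OF r(1), of n] by (intro le_imp_inverse_le) auto
      finally show "norm (B.nrm (Y n)) \<le> sqrt (inverse (real (Suc n)))"
        using B.nrm_nonneg[OF Y(1), of n] by (simp add: real_le_rsqrt)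
    qed
  qed
  have "W.cauchy Y"
    unfolding W.cauchy_def
  proof (intro conjI allI impI Y)
    fix e :: real assume e: "e > 0"
    define d where "d = e / (2 * sqrt (1 + L))"
    have sq: "sqrt (1 + L) > 0" using L0 by simp
    then have "d > 0" using e by (simp add: d_def)
    then obtain N1 where N1: "\<And>m n. m \<ge> N1 \<Longrightarrow> n \<ge> N1 \<Longrightarrow> L2_norm (\<lambda>x. Y m x - Y n x) < d"
      using r(2) unfolding L2.cauchy_def L2_nrm_eq Y_def by meson
    have "eventually (\<lambda>n. B.nrm (Y n) < e / 4) sequentially" using BY e by (intro order_tendstoD(2)[where y=0]) auto
    then obtain N2 where N2: "\<And>n. n \<ge> N2 \<Longrightarrow> B.nrm (Y n) < e / 4" by (auto simp: eventually_sequentially)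
    have "W.nrm (\<lambda>x. Y m x - Y n x) < e" if mn: "m \<ge> max N1 N2" "n \<ge> max N1 N2" for m n
    proof -
      have "B.nrm (\<lambda>x. Y m x - Y n x) \<le> B.nrm (Y m) + B.nrm (Y n)"
        using B.nrm_triangle[OF Y(1) B.scale_mem[OF Y(1), of "-1"], of m n] B.nrm_scale[OF Y(1), of "-1" n] by simp
      also have "\<dots> < e / 2" using N2[of m] N2[of n] mn by auto
      finally have "B.nrm (\<lambda>x. Y m x - Y n x) < e / 2" .
      moreover have "sqrt (1 + L) * L2_norm (\<lambda>x. Y m x - Y n x) \<le> sqrt (1 + L) * d"
        using N1[of m n] mn sq by (intro mult_left_mono) auto
      moreover have "sqrt (1 + L) * d = e / 2" using sq by (simp add: d_def)
      ultimately show ?thesis using Wle[OF form_dom_diff[OF Y(1) Y(1)], of m n] by linarith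
    qed
    then show "\<exists>N. \<forall>m\<ge>N. \<forall>n\<ge>N. W.nrm (\<lambda>x. Y m x - Y n x) < e" by blast
  qed
  then obtain \<phi> where \<phi>: "\<phi> \<in> form_dom s S" and lim: "(\<lambda>n. W.nrm (\<lambda>x. Y n x - \<phi> x)) \<longlonglongrightarrow> 0"
    using complete unfolding W.is_complete_def by blast
  note d = form_dom_diff[OF Y(1) \<phi>]
  have "(\<lambda>n. L2_norm (\<lambda>x. Y n x - \<phi> x)) \<longlonglongrightarrow> 0"
  proof (rule Lim_null_comparison[OF always_eventually lim], intro allI)
    fix n
    have "(L2_norm (\<lambda>x. Y n x - \<phi> x))\<^sup>2 \<le> (W.nrm (\<lambda>x. Y n x - \<phi> x))\<^sup>2"
      unfolding Wsq[OF d] by (simp add: wquad_nonneg symb_nonneg)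
    then show "norm (L2_norm (\<lambda>x. Y n x - \<phi> x)) \<le> W.nrm (\<lambda>x. Y n x - \<phi> x)"
      using W.nrm_nonneg[OF d] by (auto intro: power2_le_imp_le)
  qed
  then have "(\<lambda>n. L2_norm (Y n)) \<longlonglongrightarrow> L2_norm \<phi>"
    using L2.tendsto_nrm[OF form_dom_L2[OF Y(1)] form_dom_L2[OF \<phi>]] by (simp add: L2_nrm_eq)
  then have \<phi>1: "L2_norm \<phi> = 1" using LIMSEQ_unique[OF _ tendsto_const] by (simp add: Y(2))
  have "(\<lambda>n. B.nrm (\<lambda>x. Y n x - \<phi> x)) \<longlonglongrightarrow> 0"
  proof (rule Lim_null_comparison[OF always_eventually lim], intro allI)
    fix n
    have "(B.nrm (\<lambda>x. Y n x - \<phi> x))\<^sup>2 \<le> (W.nrm (\<lambda>x. Y n x - \<phi> x))\<^sup>2"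
      unfolding Wsq[OF d] Bsq[OF d] using mult_nonneg_nonneg[OF L0 zero_le_power2[of "L2_norm (\<lambda>x. Y n x - \<phi> x)"]]
      by (smt (verit) zero_le_power2)
    then show "norm (B.nrm (\<lambda>x. Y n x - \<phi> x)) \<le> W.nrm (\<lambda>x. Y n x - \<phi> x)"
      using W.nrm_nonneg[OF d] B.nrm_nonneg[OF d] by (auto intro: power2_le_imp_le)
  qed
  from LIMSEQ_unique[OF B.tendsto_nrm[OF Y(1) \<phi> this] BY] have "B.nrm \<phi> = 0" .
  then have "wquad (symb s t) \<phi> = L" using Bsq[OF \<phi>] \<phi>1 by simp
  with \<phi> \<phi>1 show thesis unfolding L_def by (rule that)
qed

text \<open>A minimiser is a null vector of the nonnegative form \<open>symb - bottom\<close>; by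
  Cauchy-Schwarz it is orthogonal to every \<open>v\<close> for that form, which is the eigenvalue
  equation in weak form.\<close>

lemma bottom_eigen:
  assumes s: "0 < s" "s \<le> 1" and \<phi>: "\<phi> \<in> form_dom s S" "L2_norm \<phi> = 1" "wquad (symb s t) \<phi> = bottom s S t"
    and v: "v \<in> form_dom s S"
  shows "wform (symb s t) \<phi> v = complex_of_real (bottom s S t) * L2_inner \<phi> v"
proof -
  interpret B: semi_inner "form_dom s S" "wform (\<lambda>\<xi>. symb s t \<xi> - bottom s S t)"
    by (rule semi_inner_bottom[OF s])
  have "(B.nrm \<phi>)\<^sup>2 = 0"
    using B.nrm_sq[OF \<phi>(1)] wquad_diff[OF \<phi>(1) admissible_symb[OF s] admissible_const, of t "bottom s S t"] \<phi>(2,3)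
    by (simp add: wform_self wquad_const form_dom_L2[OF \<phi>(1)])
  then have "wform (\<lambda>\<xi>. symb s t \<xi> - bottom s S t) \<phi> v = 0"
    using B.Cauchy_Schwarz[OF \<phi>(1) v] by simp
  then show ?thesis
    using wform_diff[OF \<phi>(1) v admissible_symb[OF s] admissible_const, of t "bottom s S t"]
    by (simp add: wform_const form_dom_L2[OF \<phi>(1)] form_dom_L2[OF v])
qed

text \<open>The minimiser for \<open>r\<close> serves as trial function for \<open>t\<close>, and
  the two symbols differ by at most the stated constant.\<close>

lemma bottom_diff_le:
  assumes s: "0 < s" "s \<le> 1" and S: "S \<in> sets borel" "bounded S" and ex: "\<exists>u\<in>form_dom s S. L2_norm u \<noteq> 0"
  shows "bottom s S t \<le> bottom s S r + \<bar>t\<^sup>2 - r\<^sup>2\<bar> powr s"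
proof -
  obtain \<phi> where \<phi>: "\<phi> \<in> form_dom s S" "L2_norm \<phi> = 1" "wquad (symb s r) \<phi> = bottom s S r"
    by (rule bottom_attained[OF s S ex])
  have "bottom s S t \<le> wquad (symb s t) \<phi>" by (rule bottom_le_1[OF \<phi>(1,2)])
  also have "\<dots> \<le> wquad (\<lambda>\<xi>. symb s r \<xi> + \<bar>t\<^sup>2 - r\<^sup>2\<bar> powr s) \<phi>"
  proof (rule wquad_mono[OF \<phi>(1) admissible_symb[OF s] admissible_add[OF admissible_symb[OF s] admissible_const]])
    show "symb s t \<xi> \<le> symb s r \<xi> + \<bar>t\<^sup>2 - r\<^sup>2\<bar> powr s" for \<xi> :: 'a
      using abs_powr_diff_le[of "(norm \<xi>)\<^sup>2 + t\<^sup>2" "(norm \<xi>)\<^sup>2 + r\<^sup>2" s] s by (simp add: symb_def)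
  qed
  also have "\<dots> = bottom s S r + \<bar>t\<^sup>2 - r\<^sup>2\<bar> powr s"
    using wquad_add[OF \<phi>(1) admissible_symb[OF s] admissible_const, of r "\<bar>t\<^sup>2 - r\<^sup>2\<bar> powr s"] \<phi>
    by (simp add: wquad_const form_dom_L2[OF \<phi>(1)])
  finally show ?thesis .
qed

lemma bottom_surj:
  assumes s: "0 < s" "s \<le> 1" and S: "S \<in> sets borel" "bounded S" and ex: "\<exists>u\<in>form_dom s S. L2_norm u \<noteq> 0"
    and \<mu>: "bottom s S 0 \<le> \<mu>"
  obtains t where "bottom s S t = \<mu>"
proof -
  have \<mu>0: "0 \<le> \<mu>" using bottom_ge[OF s ex, of 0] \<mu> by simp
  \<comment> \<open>The solution of T^(2s) = \<mu>, so that \<open>bottom_ge\<close> puts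
    \<open>bottom s S T\<close> above \<open>\<mu>\<close> and the intermediate value theorem
    applies on [0, T].\<close>
  define T where "T = \<mu> powr (1 / (2 * s))"
  have T0: "0 \<le> T" by (simp add: T_def)
  have "(T\<^sup>2) powr s = \<mu>"
  proof (cases "\<mu> = 0")
    case False
    then have "T\<^sup>2 = T powr 2" using \<mu>0 by (simp add: T_def)
    then show ?thesis using \<mu>0 s by (simp add: T_def powr_powr)
  qed (simp add: T_def)
  then have "\<mu> \<le> bottom s S T" using bottom_ge[OF s ex, of T] by simp
  moreover have "continuous_on {0..T} (bottom s S)"
  proof (intro continuous_at_imp_continuous_on ballI)
    fix t
    show "isCont (bottom s S) t"
      unfolding isCont_def
    proof (rule LIM_zero_cancel, rule Lim_null_comparison[OF always_eventually])
      have "((\<lambda>r. \<bar>r\<^sup>2 - t\<^sup>2\<bar> powr s) \<longlongrightarrow> \<bar>t\<^sup>2 - t\<^sup>2\<bar> powr s) (at t)"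
        by (intro tendsto_powr' tendsto_intros) (use s in auto)
      then show "((\<lambda>r. \<bar>r\<^sup>2 - t\<^sup>2\<bar> powr s) \<longlongrightarrow> 0) (at t)" by simp
      show "\<forall>r. norm (bottom s S r - bottom s S t) \<le> \<bar>r\<^sup>2 - t\<^sup>2\<bar> powr s"
        using bottom_diff_le[OF s S ex] by (smt (verit) real_norm_def)
    qed
  qed
  ultimately show thesis
    using IVT'[of "bottom s S" 0 \<mu> T] \<mu> T0 that by blast
qed

section \<open>Partial Fourier transform on a cylinder\<close>

lemma pair_measurable:
  fixes f :: "'a::second_countable_topology \<times> 'b::second_countable_topology \<Rightarrow> 'c::topological_space"
  shows "f \<in> borel_measurable borel \<Longrightarrow> f \<in> borel_measurable (borel \<Otimes>\<^sub>M borel)"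
  by (simp add: borel_prod)

lemma nn_integral_lborel_fst:
  fixes f :: "'a::euclidean_space \<times> 'b::euclidean_space \<Rightarrow> ennreal"
  assumes "f \<in> borel_measurable borel"
  shows "(\<integral>\<^sup>+p. f p \<partial>lborel) = (\<integral>\<^sup>+x. (\<integral>\<^sup>+y. f (x, y) \<partial>lborel) \<partial>lborel)"
proof -
  have "f \<in> borel_measurable (lborel \<Otimes>\<^sub>M lborel)" using assms by (simp add: lborel_prod)
  from lborel.nn_integral_fst[OF this] show ?thesis by (simp add: lborel_prod)
qed

lemma nn_integral_lborel_snd:
  fixes f :: "'a::euclidean_space \<times> 'b::euclidean_space \<Rightarrow> ennreal"
  assumes "f \<in> borel_measurable borel"
  shows "(\<integral>\<^sup>+p. f p \<partial>lborel) = (\<integral>\<^sup>+y. (\<integral>\<^sup>+x. f (x, y) \<partial>lborel) \<partial>lborel)"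
proof -
  have "f \<in> borel_measurable (lborel \<Otimes>\<^sub>M lborel)" using assms by (simp add: lborel_prod)
  from lborel_pair.nn_integral_snd[OF this] show ?thesis by (simp add: lborel_prod)
qed

text \<open>Only the cross-section variable is transformed, and by a genuine integral: for a bounded
  cross-section almost every slice is integrable.\<close>

definition partial_fourier :: "('a::euclidean_space \<times> real \<Rightarrow> complex) \<Rightarrow> 'a \<Rightarrow> real \<Rightarrow> complex" where
  "partial_fourier u \<xi> z = fourier_L1 (\<lambda>x. u (x, z)) \<xi>"

lemma partial_fourier_measurable:
  assumes "u \<in> borel_measurable borel"
  shows "(\<lambda>(\<xi>, z). partial_fourier u \<xi> z) \<in> borel_measurable (borel \<Otimes>\<^sub>M borel)"
proof -
  note [measurable] = pair_measurable[OF assms]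
  show ?thesis unfolding partial_fourier_def fourier_L1_def by measurable
qed

text \<open>Fubini for the norm gives finiteness on almost every slice; the null set in the support
  condition is handled by exchanging the order of the two almost-everywhere quantifiers.\<close>

lemma slice_L2_on:
  fixes u :: "'a::euclidean_space \<times> real \<Rightarrow> complex"
  assumes u: "u \<in> L2_on (S \<times> UNIV)" and S: "S \<in> sets borel"
  shows "AE z in lborel. (\<lambda>x. u (x, z)) \<in> L2_on S"
proof -
  note uL = L2_onD[OF u]
  note [measurable] = L2D[OF uL] pair_measurable[OF L2D[OF uL]] S
  have "(\<integral>\<^sup>+z. (\<integral>\<^sup>+x. ennreal ((cmod (u (x, z)))\<^sup>2) \<partial>lborel) \<partial>lborel) = ennreal ((L2_norm u)\<^sup>2)"
    using nn_integral_lborel_snd[of "\<lambda>p. ennreal ((cmod (u p))\<^sup>2)"] by (simp add: nn_integral_L2[OF uL])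
  then have fin: "AE z in lborel. (\<integral>\<^sup>+x. ennreal ((cmod (u (x, z)))\<^sup>2) \<partial>lborel) \<noteq> \<infinity>"
    by (intro nn_integral_PInf_AE) auto
  have "AE p in lborel \<Otimes>\<^sub>M lborel. fst p \<notin> S \<longrightarrow> u p = 0"
    using u unfolding lborel_prod L2_on_def by (auto elim!: eventually_mono)
  then have "AE x in lborel. AE z in lborel. x \<notin> S \<longrightarrow> u (x, z) = 0"
    by (auto dest!: lborel_pair.AE_pair)
  then have "AE z in lborel. AE x in lborel. x \<notin> S \<longrightarrow> u (x, z) = 0"
  proof (subst (asm) lborel_pair.AE_commute)
    show "{p \<in> space (lborel \<Otimes>\<^sub>M lborel). fst p \<notin> S \<longrightarrow> u (fst p, snd p) = 0} \<in> sets (lborel \<Otimes>\<^sub>M lborel)"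
      by measurable
  qed
  with fin show ?thesis
  proof eventually_elim
    case (elim z)
    have "(\<lambda>x. u (x, z)) \<in> borel_measurable borel" by measurable
    moreover have "integrable lborel (\<lambda>x. (cmod (u (x, z)))\<^sup>2)"
      by (rule integrableI_bounded) (use elim in \<open>auto simp: less_top\<close>)
    ultimately show ?case using elim by (simp add: L2_on_def L2_def)
  qed
qed

text \<open>Fubini: the exponential factors over the two variables, and the normalising powers of 2
  pi add up to the one for the product space.\<close>

lemma fourier_L1_pair:
  fixes u :: "'a::euclidean_space \<times> real \<Rightarrow> complex"
  assumes u: "integrable lborel u"
  shows "integrable lborel (partial_fourier u \<xi>)" "fourier_L1 u (\<xi>, \<zeta>) = fourier_L1 (partial_fourier u \<xi>) \<zeta>"
proof -
  let ?e = "\<lambda>\<zeta> (x, z). exp (- \<i> * complex_of_real ((\<xi>, \<zeta>) \<bullet> (x, z))) * u (x, z)"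
  have e_eq: "?e \<zeta> = (\<lambda>p. exp (- \<i> * complex_of_real ((\<xi>, \<zeta>) \<bullet> p)) * u p)" for \<zeta>
    by (auto simp: fun_eq_iff)
  have e: "integrable (lborel \<Otimes>\<^sub>M lborel) (?e \<zeta>)" for \<zeta>
  proof -
    show ?thesis using e_eq[of \<zeta>] integrable_exp_mult[OF u, of "(\<xi>, \<zeta>)"] by (simp only: lborel_prod)
  qed
  let ?ca = "complex_of_real ((2 * pi) powr (- real DIM('a) / 2))"
  let ?c1 = "complex_of_real ((2 * pi) powr (- real DIM(real) / 2))"
  \<comment> \<open>At last frequency 0 the exponential no longer depends on \<open>z\<close>, and
    the inner integral is the partial transform up to its constant.\<close>
  have "integrable lborel (\<lambda>z. \<integral>x. ?e 0 (x, z) \<partial>lborel)"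
    using lborel_pair.integrable_snd[of "\<lambda>x z. ?e 0 (x, z)"] e[of 0] by simp
  then show "integrable lborel (partial_fourier u \<xi>)" unfolding partial_fourier_def[abs_def] fourier_L1_def by (simp add: inner_Pair)
  have "fourier_L1 u (\<xi>, \<zeta>) = ?ca * ?c1 * (\<integral>p. ?e \<zeta> p \<partial>(lborel \<Otimes>\<^sub>M lborel))"
  proof -
    have "(2 * pi) powr (- real DIM('a) / 2) * (2 * pi) powr (- real DIM(real) / 2) = (2 * pi) powr (- real DIM('a \<times> real) / 2)"
      unfolding powr_add[symmetric] by (rule arg_cong[of _ _ "(powr) (2 * pi)"]) (simp add: field_simps)
    then show ?thesis unfolding fourier_L1_def e_eq lborel_prod of_real_mult[symmetric] by (simp only:)
  qed
  also have "(\<integral>p. ?e \<zeta> p \<partial>(lborel \<Otimes>\<^sub>M lborel)) = (\<integral>z. (\<integral>x. ?e \<zeta> (x, z) \<partial>lborel) \<partial>lborel)"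
    using lborel_pair.integral_snd[of "\<lambda>x z. ?e \<zeta> (x, z)"] e[of \<zeta>] by simp
  also have "\<dots> = (\<integral>z. exp (- \<i> * complex_of_real (\<zeta> \<bullet> z)) * (\<integral>x. exp (- \<i> * complex_of_real (\<xi> \<bullet> x)) * u (x, z) \<partial>lborel) \<partial>lborel)"
  proof (intro Bochner_Integration.integral_cong refl)
    fix z
    have "exp (- \<i> * complex_of_real ((\<xi>, \<zeta>) \<bullet> (x, z)))
        = exp (- \<i> * complex_of_real (\<zeta> \<bullet> z)) * exp (- \<i> * complex_of_real (\<xi> \<bullet> x))" for x
      unfolding exp_add[symmetric] by (rule arg_cong[of _ _ exp]) (simp add: algebra_simps)
    then have "?e \<zeta> (x, z) = exp (- \<i> * complex_of_real (\<zeta> \<bullet> z)) * (exp (- \<i> * complex_of_real (\<xi> \<bullet> x)) * u (x, z))" for x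
      by (simp only: prod.case mult.assoc)
    then show "(\<integral>x. ?e \<zeta> (x, z) \<partial>lborel) = exp (- \<i> * complex_of_real (\<zeta> \<bullet> z)) * (\<integral>x. exp (- \<i> * complex_of_real (\<xi> \<bullet> x)) * u (x, z) \<partial>lborel)"
      by (simp only: integral_mult_right_zero)
  qed
  finally show "fourier_L1 u (\<xi>, \<zeta>) = fourier_L1 (partial_fourier u \<xi>) \<zeta>"
    unfolding partial_fourier_def[abs_def] fourier_L1_def mult.left_commute[of _ ?ca] integral_mult_right_zero
    by (simp only: mult_ac)
qed

text \<open>This holds for every \<xi>: on a bounded cross-section the transform of a slice is
  bounded pointwise by a constant times the L2 norm of the slice.\<close>

lemma partial_fourier_L2:
  fixes u :: "'a::euclidean_space \<times> real \<Rightarrow> complex"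
  assumes u: "u \<in> L2_on (S \<times> UNIV)" and S: "S \<in> sets borel" "bounded S"
  shows "partial_fourier u \<xi> \<in> L2"
proof -
  note uL = L2_onD[OF u]
  note [measurable] = L2D[OF uL] pair_measurable[OF L2D[OF uL]] S partial_fourier_measurable[OF L2D[OF uL]]
  define c where "c = (2 * pi) powr (- real DIM('a) / 2)"
  define K where "K = L2_norm (indicator S :: 'a \<Rightarrow> complex)"
  have c: "0 \<le> c" and K: "0 \<le> K" by (auto simp: c_def K_def)
  have m: "(\<lambda>z. partial_fourier u \<xi> z) \<in> borel_measurable borel" by measurable
  have "AE z in lborel. ennreal ((cmod (partial_fourier u \<xi> z))\<^sup>2) \<le> ennreal ((c * K)\<^sup>2) * (\<integral>\<^sup>+x. ennreal ((cmod (u (x, z)))\<^sup>2) \<partial>lborel)"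
    using slice_L2_on[OF u S(1)]
  proof eventually_elim
    case (elim z)
    have "cmod (partial_fourier u \<xi> z) \<le> c * (L2_norm (\<lambda>x. u (x, z)) * K)"
      unfolding partial_fourier_def c_def K_def
      by (rule order_trans[OF fourier_L1_bound mult_left_mono[OF L2_on_integrable(2)[OF elim S]]]) simp
    then have "(cmod (partial_fourier u \<xi> z))\<^sup>2 \<le> (c * (L2_norm (\<lambda>x. u (x, z)) * K))\<^sup>2" by (intro power_mono) auto
    also have "\<dots> = (c * K)\<^sup>2 * (L2_norm (\<lambda>x. u (x, z)))\<^sup>2" by (simp add: power_mult_distrib)
    finally show ?case
      unfolding nn_integral_L2[OF L2_onD[OF elim]] by (simp add: ennreal_leI flip: ennreal_mult)
  qed
  then have "(\<integral>\<^sup>+z. ennreal ((cmod (partial_fourier u \<xi> z))\<^sup>2) \<partial>lborel)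
    \<le> (\<integral>\<^sup>+z. ennreal ((c * K)\<^sup>2) * (\<integral>\<^sup>+x. ennreal ((cmod (u (x, z)))\<^sup>2) \<partial>lborel) \<partial>lborel)"
    by (rule nn_integral_mono_AE)
  also have "\<dots> = ennreal ((c * K)\<^sup>2) * (\<integral>\<^sup>+z. (\<integral>\<^sup>+x. ennreal ((cmod (u (x, z)))\<^sup>2) \<partial>lborel) \<partial>lborel)"
    by (intro nn_integral_cmult) measurable
  also have "\<dots> = ennreal ((c * K)\<^sup>2 * (L2_norm u)\<^sup>2)"
    using nn_integral_lborel_snd[of "\<lambda>p. ennreal ((cmod (u p))\<^sup>2)"] by (simp add: nn_integral_L2[OF uL] ennreal_mult)
  finally show ?thesis by (rule L2I_nn_integral[OF m])
qed

text \<open>Plancherel's theorem in the last variable is applied to the truncations of \<open>u\<close> to \<open>|z| \<le> N\<close>, which are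
  integrable; letting \<open>N \<rightarrow> \<infinity>\<close>, both sides have the same integral over every Borel set of \<open>\<xi>\<close>.\<close>

theorem partial_fourier_plancherel:
  fixes u :: "'a::euclidean_space \<times> real \<Rightarrow> complex"
  assumes u: "u \<in> L2_on (S \<times> UNIV)" and S: "S \<in> sets borel" "bounded S"
  shows "AE \<xi> in lborel. (\<integral>\<^sup>+\<zeta>. ennreal ((cmod (FT u (\<xi>, \<zeta>)))\<^sup>2) \<partial>lborel) = (\<integral>\<^sup>+z. ennreal ((cmod (partial_fourier u \<xi> z))\<^sup>2) \<partial>lborel)"
    (is "AE \<xi> in lborel. ?p \<xi> = ?q \<xi>")
proof -
  note uL = L2_onD[OF u]
  define J where "J N = {- real N..real N}" for N :: nat
  define v where "v N = (\<lambda>p. indicator (UNIV \<times> J N) p * u p)" for N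
  have Jm: "UNIV \<times> J N \<in> sets (borel :: ('a \<times> real) measure)" for N
    unfolding J_def by (intro borel_closed closed_Times) auto
  have vL: "v N \<in> L2" for N unfolding v_def by (rule L2_indicator_mult[OF uL Jm])
  have von: "v N \<in> L2_on (S \<times> UNIV)" for N
    using u vL[of N] unfolding L2_on_def by (auto simp: v_def elim!: eventually_mono)
  have "v N \<in> L2_on (S \<times> J N)" for N
    using u vL[of N] unfolding L2_on_def by (auto simp: v_def indicator_def elim!: eventually_mono)
  moreover have "S \<times> J N \<in> sets borel" for N
    using S unfolding borel_prod[symmetric] by (auto simp: J_def)
  moreover have "bounded (S \<times> J N)" for N using S by (auto simp: J_def intro: bounded_Times)
  ultimately have vI: "integrable lborel (v N)" for N by (rule L2_on_integrable(1))
  note [measurable] = pair_measurable[OF L2D[OF uL]] pair_measurable[OF L2D[OF vL]] S partial_fourier_measurable[OF L2D[OF uL]]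
    pair_measurable[OF L2D[OF FT_L2[OF uL]]] L2D[OF FT_L2[OF uL]] pair_measurable[OF L2D[OF FT_L2[OF vL]]] L2D[OF FT_L2[OF vL]]
    pair_measurable[OF L2D[OF plancherel_L1_L2(1)[OF vL vI]]] L2D[OF plancherel_L1_L2(1)[OF vL vI]]
  have pf_v: "partial_fourier (v N) \<xi> z = indicator (J N) z * partial_fourier u \<xi> z" for N \<xi> z
    unfolding partial_fourier_def by (subst fourier_L1_scale[symmetric]) (simp add: v_def indicator_def)
  have inner: "(\<integral>\<^sup>+\<zeta>. ennreal ((cmod (fourier_L1 (v N) (\<xi>, \<zeta>)))\<^sup>2) \<partial>lborel)
      = (\<integral>\<^sup>+z. ennreal (indicator (J N) z * (cmod (partial_fourier u \<xi> z))\<^sup>2) \<partial>lborel)" for N \<xi>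
  proof -
    have "(\<integral>\<^sup>+\<zeta>. ennreal ((cmod (fourier_L1 (v N) (\<xi>, \<zeta>)))\<^sup>2) \<partial>lborel)
      = (\<integral>\<^sup>+\<zeta>. ennreal ((cmod (fourier_L1 (partial_fourier (v N) \<xi>) \<zeta>))\<^sup>2) \<partial>lborel)"
      by (simp add: fourier_L1_pair(2)[OF vI])
    also have "\<dots> = ennreal ((L2_norm (partial_fourier (v N) \<xi>))\<^sup>2)"
      by (simp add: nn_integral_L2 plancherel_L1_L2 partial_fourier_L2[OF von S] fourier_L1_pair(1)[OF vI])
    also have "\<dots> = (\<integral>\<^sup>+z. ennreal ((cmod (partial_fourier (v N) \<xi> z))\<^sup>2) \<partial>lborel)"
      by (simp add: nn_integral_L2 partial_fourier_L2[OF von S])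
    also have "\<dots> = (\<integral>\<^sup>+z. ennreal (indicator (J N) z * (cmod (partial_fourier u \<xi> z))\<^sup>2) \<partial>lborel)"
    proof (intro nn_integral_cong)
      show "ennreal ((cmod (partial_fourier (v N) \<xi> z))\<^sup>2) = ennreal (indicator (J N) z * (cmod (partial_fourier u \<xi> z))\<^sup>2)" for z
        unfolding pf_v by (cases "z \<in> J N") auto
    qed
    finally show ?thesis .
  qed
  \<comment> \<open>Both sides are limits of one sequence. The left one follows from L2 continuity
    of \<open>FT\<close> restricted to \<open>A \<times> UNIV\<close>, the right one from monotone
    convergence in the truncation.\<close>
  have eqA: "(\<integral>\<^sup>+\<xi>. ?p \<xi> * indicator A \<xi> \<partial>lborel) = (\<integral>\<^sup>+\<xi>. ?q \<xi> * indicator A \<xi> \<partial>lborel)" if A: "A \<in> sets borel" for A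
  proof (rule LIMSEQ_unique)
    note [measurable] = A
    have Am: "A \<times> UNIV \<in> sets (borel :: ('a \<times> real) measure)" using A unfolding borel_prod[symmetric] by auto
    let ?r = "\<lambda>g (p :: 'a \<times> real). indicator (A \<times> UNIV) p * (g p :: complex)"
    have r: "(\<integral>\<^sup>+\<xi>. (\<integral>\<^sup>+\<zeta>. ennreal ((cmod (g (\<xi>, \<zeta>)))\<^sup>2) \<partial>lborel) * indicator A \<xi> \<partial>lborel) = ennreal ((L2_norm (?r g))\<^sup>2)"
      if g: "g \<in> L2" for g
    proof -
      note [measurable] = pair_measurable[OF L2D[OF g]] L2D[OF L2_indicator_mult[OF g Am]]
      have "ennreal ((L2_norm (?r g))\<^sup>2) = (\<integral>\<^sup>+p. ennreal ((cmod (?r g p))\<^sup>2) \<partial>lborel)"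
        by (rule nn_integral_L2[OF L2_indicator_mult[OF g Am], symmetric])
      also have "\<dots> = (\<integral>\<^sup>+\<xi>. (\<integral>\<^sup>+\<zeta>. ennreal ((cmod (?r g (\<xi>, \<zeta>)))\<^sup>2) \<partial>lborel) \<partial>lborel)"
        by (intro nn_integral_lborel_fst) measurable
      also have "\<dots> = (\<integral>\<^sup>+\<xi>. (\<integral>\<^sup>+\<zeta>. ennreal ((cmod (g (\<xi>, \<zeta>)))\<^sup>2) \<partial>lborel) * indicator A \<xi> \<partial>lborel)"
        by (intro nn_integral_cong) (auto simp: indicator_def)
      finally show ?thesis ..
    qed
    have "(\<lambda>N. L2_norm (?r (FT (v N)))) \<longlonglongrightarrow> L2_norm (?r (FT u))"
      unfolding L2_nrm_eq[symmetric]
    proof (rule L2.tendsto_nrm)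
      show "?r (FT (v N)) \<in> L2" for N by (intro L2_indicator_mult FT_L2 vL Am)
      show "?r (FT u) \<in> L2" by (intro L2_indicator_mult FT_L2 uL Am)
      show "(\<lambda>N. L2.nrm (\<lambda>p. ?r (FT (v N)) p - ?r (FT u) p)) \<longlonglongrightarrow> 0"
        unfolding L2_nrm_eq
      proof (rule Lim_null_comparison[OF always_eventually])
        have "(\<lambda>N. \<integral>p. (cmod (v N p - u p))\<^sup>2 \<partial>lborel) \<longlonglongrightarrow> (\<integral>p. 0 \<partial>(lborel :: ('a \<times> real) measure))"
        proof (rule integral_dominated_convergence[where w="\<lambda>p. (cmod (u p))\<^sup>2"])
          show "AE p in lborel. (\<lambda>N. (cmod (v N p - u p))\<^sup>2) \<longlonglongrightarrow> 0"
          proof (intro always_eventually allI)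
            fix p :: "'a \<times> real"
            have "eventually (\<lambda>N. (cmod (v N p - u p))\<^sup>2 = 0) sequentially"
              using eventually_ge_at_top[of "nat \<lceil>\<bar>snd p\<bar>\<rceil>"]
            proof eventually_elim
              case (elim N)
              then have "\<bar>snd p\<bar> \<le> real N" by linarith
              then have "p \<in> UNIV \<times> J N" by (cases p) (auto simp: J_def)
              then show ?case by (simp add: v_def)
            qed
            then show "(\<lambda>N. (cmod (v N p - u p))\<^sup>2) \<longlonglongrightarrow> 0" by (rule tendsto_eventually)
          qed
          show "AE p in lborel. norm ((cmod (v N p - u p))\<^sup>2) \<le> (cmod (u p))\<^sup>2" for N
            by (auto simp: v_def indicator_def)
          show "(\<lambda>p. (cmod (v N p - u p))\<^sup>2) \<in> borel_measurable lborel" for N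
            using L2D[OF L2_diff[OF vL[of N] uL]] by measurable
        qed (use L2_integrable[OF uL] in auto)
        then have "(\<lambda>N. sqrt (\<integral>p. (cmod (v N p - u p))\<^sup>2 \<partial>lborel)) \<longlonglongrightarrow> sqrt 0"
          by (intro tendsto_intros) simp
        then show "(\<lambda>N. L2_norm (\<lambda>p. v N p - u p)) \<longlonglongrightarrow> 0" by (simp add: L2_norm_def)
        show "\<forall>N. norm (L2_norm (\<lambda>p. ?r (FT (v N)) p - ?r (FT u) p)) \<le> L2_norm (\<lambda>p. v N p - u p)"
        proof
          fix N
          have d: "(\<lambda>p. FT (v N) p - FT u p) \<in> L2" by (intro L2_diff FT_L2 vL uL)
          have "(L2_norm (\<lambda>p. ?r (FT (v N)) p - ?r (FT u) p))\<^sup>2 \<le> (L2_norm (\<lambda>p. FT (v N) p - FT u p))\<^sup>2"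
            unfolding L2_norm_sq
            by (rule integral_mono) (use L2_integrable[OF d] L2_integrable[OF L2_diff[OF L2_indicator_mult[OF FT_L2[OF vL] Am] L2_indicator_mult[OF FT_L2[OF uL] Am]], of N]
                in \<open>auto simp: indicator_def\<close>)
          then have "L2_norm (\<lambda>p. ?r (FT (v N)) p - ?r (FT u) p) \<le> L2_norm (\<lambda>p. FT (v N) p - FT u p)"
            by (rule power2_le_imp_le) simp
          also have "\<dots> = L2_norm (FT (\<lambda>p. v N p - u p))"
            by (rule L2_norm_cong_AE[OF L2D[OF d] L2D[OF FT_L2[OF L2_diff[OF vL uL]]]])
              (use FT_diff[OF vL uL, of N] in \<open>auto elim!: eventually_mono\<close>)
          also have "\<dots> = L2_norm (\<lambda>p. v N p - u p)" by (rule FT_norm[OF L2_diff[OF vL uL]])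
          finally show "norm (L2_norm (\<lambda>p. ?r (FT (v N)) p - ?r (FT u) p)) \<le> L2_norm (\<lambda>p. v N p - u p)" by simp
        qed
      qed
    qed
    then have "(\<lambda>N. ennreal ((L2_norm (?r (FT (v N))))\<^sup>2)) \<longlonglongrightarrow> ennreal ((L2_norm (?r (FT u)))\<^sup>2)"
      by (intro tendsto_intros)
    moreover have "L2_norm (?r (FT (v N))) = L2_norm (?r (fourier_L1 (v N)))" for N
      by (rule L2_norm_cong_AE[OF L2D[OF L2_indicator_mult[OF FT_L2[OF vL] Am]] L2D[OF L2_indicator_mult[OF plancherel_L1_L2(1)[OF vL vI] Am]]])
        (use FT_eq_fourier_L1[OF vL vI, of N] in \<open>auto elim!: eventually_mono\<close>)
    ultimately show "(\<lambda>N. (\<integral>\<^sup>+\<xi>. (\<integral>\<^sup>+\<zeta>. ennreal ((cmod (fourier_L1 (v N) (\<xi>, \<zeta>)))\<^sup>2) \<partial>lborel) * indicator A \<xi> \<partial>lborel))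
        \<longlonglongrightarrow> (\<integral>\<^sup>+\<xi>. ?p \<xi> * indicator A \<xi> \<partial>lborel)"
      unfolding r[OF FT_L2[OF uL]] r[OF plancherel_L1_L2(1)[OF vL vI]] by simp
    have mono: "J M \<subseteq> J N" if "M \<le> N" for M N using that by (auto simp: J_def)
    have lim: "(\<lambda>N. ennreal (indicator (J N) z * (cmod (partial_fourier u \<xi> z))\<^sup>2)) \<longlonglongrightarrow> ennreal ((cmod (partial_fourier u \<xi> z))\<^sup>2)" for \<xi> z
    proof (rule tendsto_eventually)
      show "eventually (\<lambda>N. ennreal (indicator (J N) z * (cmod (partial_fourier u \<xi> z))\<^sup>2) = ennreal ((cmod (partial_fourier u \<xi> z))\<^sup>2)) sequentially"
        using eventually_ge_at_top[of "nat \<lceil>\<bar>z\<bar>\<rceil>"]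
      proof eventually_elim
        case (elim N)
        then have "\<bar>z\<bar> \<le> real N" by linarith
        then have "z \<in> J N" by (auto simp: J_def)
        then show ?case by simp
      qed
    qed
    have Jb [measurable]: "J N \<in> sets borel" for N by (simp add: J_def)
    show "(\<lambda>N. (\<integral>\<^sup>+\<xi>. (\<integral>\<^sup>+\<zeta>. ennreal ((cmod (fourier_L1 (v N) (\<xi>, \<zeta>)))\<^sup>2) \<partial>lborel) * indicator A \<xi> \<partial>lborel))
        \<longlonglongrightarrow> (\<integral>\<^sup>+\<xi>. ?q \<xi> * indicator A \<xi> \<partial>lborel)"
      unfolding inner
    proof (rule nn_integral_LIMSEQ)
      have le: "ennreal (indicator (J M) z * (cmod (partial_fourier u \<xi> z))\<^sup>2) \<le> ennreal (indicator (J N) z * (cmod (partial_fourier u \<xi> z))\<^sup>2)" if "M \<le> N" for M N z \<xi>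
        using mono[OF that] by (intro ennreal_leI mult_right_mono) (auto simp: indicator_def)
      show "incseq (\<lambda>N \<xi>. (\<integral>\<^sup>+z. ennreal (indicator (J N) z * (cmod (partial_fourier u \<xi> z))\<^sup>2) \<partial>lborel) * indicator A \<xi>)"
        by (auto simp: incseq_def le_fun_def intro!: mult_right_mono nn_integral_mono le)
      fix \<xi>
      have "(\<lambda>N. (\<integral>\<^sup>+z. ennreal (indicator (J N) z * (cmod (partial_fourier u \<xi> z))\<^sup>2) \<partial>lborel)) \<longlonglongrightarrow> ?q \<xi>"
      proof (rule nn_integral_LIMSEQ)
        show "incseq (\<lambda>N z. ennreal (indicator (J N) z * (cmod (partial_fourier u \<xi> z))\<^sup>2))"
          unfolding incseq_def le_fun_def by (intro allI impI le)
      qed (measurable, rule lim)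
      then show "(\<lambda>N. (\<integral>\<^sup>+z. ennreal (indicator (J N) z * (cmod (partial_fourier u \<xi> z))\<^sup>2) \<partial>lborel) * indicator A \<xi>) \<longlonglongrightarrow> ?q \<xi> * indicator A \<xi>"
        by (auto simp: indicator_def)
    qed measurable
  qed
  show ?thesis
  proof (rule sigma_finite_measure.density_unique[OF sigma_finite_lborel])
    show "density lborel ?p = density lborel ?q"
    proof (rule measure_eqI)
      fix A assume "A \<in> sets (density lborel ?p)"
      then have A: "A \<in> sets borel" by simp
      then show "emeasure (density lborel ?p) A = emeasure (density lborel ?q) A"
        using eqA[OF A] by (simp add: emeasure_density)
    qed simp
  qed measurable
qed

section \<open>Lower bound for the form on the cylinder\<close>

lemma admissible_symb_fst:
  fixes s t :: real
  assumes "0 < s" "s \<le> 1"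
  shows "admissible s (\<lambda>p :: 'a::euclidean_space \<times> real. symb s t (fst p))"
proof (rule admissibleI[where C="1 + (t\<^sup>2) powr s"])
  have "(\<lambda>p :: 'a \<times> real. norm (fst p)) \<in> borel_measurable borel"
    by (intro borel_measurable_continuous_onI continuous_intros)
  then show "(\<lambda>p :: 'a \<times> real. symb s t (fst p)) \<in> borel_measurable borel" unfolding symb_def by measurable
  fix \<xi> :: "'a \<times> real"
  have "symb s t (fst \<xi>) \<le> norm (fst \<xi>) powr (2 * s) + (t\<^sup>2) powr s" by (rule symb_le[OF assms])
  also have "\<dots> \<le> norm \<xi> powr (2 * s) + (t\<^sup>2) powr s"
    using assms norm_fst_le[of "fst \<xi>" "snd \<xi>"] by (intro add_right_mono powr_mono2) auto
  also have "\<dots> \<le> (1 + (t\<^sup>2) powr s) * (1 + norm \<xi> powr (2 * s))" by (simp add: algebra_simps)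
  finally show "\<bar>symb s t (fst \<xi>)\<bar> \<le> (1 + (t\<^sup>2) powr s) * (1 + norm \<xi> powr (2 * s))" by (simp add: symb_nonneg)
qed

text \<open>Outside the form domain the right-hand side is infinite. Working with the extended
  integral lets the bound be applied to slices whose membership in the form domain is not known in
  advance.\<close>

lemma bottom_le_nn_integral:
  assumes s: "0 < s" "s \<le> 1" and ex: "\<exists>u\<in>form_dom s S. L2_norm u \<noteq> 0" and v: "v \<in> L2_on S"
  shows "ennreal (bottom s S t) * ennreal ((L2_norm v)\<^sup>2) \<le> (\<integral>\<^sup>+\<xi>. ennreal (symb s t \<xi> * (cmod (FT v \<xi>))\<^sup>2) \<partial>lborel)"
proof (cases "v \<in> form_dom s S")
  case True
  have b0: "0 \<le> bottom s S t" using bottom_ge[OF s ex, of t] by (meson order_trans powr_ge_zero)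
  have "ennreal (bottom s S t * (L2_norm v)\<^sup>2) \<le> ennreal (wquad (symb s t) v)"
    by (intro ennreal_leI bottom_le s True)
  then show ?thesis using b0 by (simp add: nn_integral_wquad[OF True admissible_symb[OF s] symb_nonneg] ennreal_mult)
next
  case False
  note [measurable] = L2D[OF FT_L2[OF L2_onD[OF v]]]
  have "(\<integral>\<^sup>+\<xi>. ennreal (norm (norm \<xi> powr (2 * s) * (cmod (FT v \<xi>))\<^sup>2)) \<partial>lborel) = \<infinity>"
  proof (rule ccontr)
    assume "\<not> ?thesis"
    then have "integrable lborel (\<lambda>\<xi>. norm \<xi> powr (2 * s) * (cmod (FT v \<xi>))\<^sup>2)"
      by (intro integrableI_bounded) (auto simp: less_top)
    with False v show False by (simp add: form_dom_iff)
  qed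
  moreover have "(\<integral>\<^sup>+\<xi>. ennreal (norm (norm \<xi> powr (2 * s) * (cmod (FT v \<xi>))\<^sup>2)) \<partial>lborel)
     \<le> (\<integral>\<^sup>+\<xi>. ennreal (symb s t \<xi> * (cmod (FT v \<xi>))\<^sup>2) \<partial>lborel)"
    using symb_ge[OF s(1)] by (intro nn_integral_mono ennreal_leI) (auto simp: abs_mult intro!: mult_right_mono)
  ultimately show ?thesis by (simp add: top_unique)
qed

text \<open>The symbol does not depend on the last frequency, so Plancherel in that variable returns
  to the position \<open>z\<close>; each slice is then an L2 function on \<open>S\<close> to which
  the definition of \<open>bottom\<close> applies, and the result is integrated over
  \<open>z\<close>.\<close>

theorem cylinder_bound:
  fixes u :: "'a::euclidean_space \<times> real \<Rightarrow> complex"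
  assumes s: "0 < s" "s \<le> 1" and S: "S \<in> sets borel" "bounded S" and ex: "\<exists>u\<in>form_dom s S. L2_norm u \<noteq> 0"
    and u: "u \<in> form_dom s (S \<times> UNIV)"
  shows "bottom s S t * (L2_norm u)\<^sup>2 \<le> wquad (\<lambda>p. symb s t (fst p)) u"
proof -
  note uS = form_dom_L2_on[OF u]
  note uL = form_dom_L2[OF u]
  note [measurable] = pair_measurable[OF L2D[OF uL]] S partial_fourier_measurable[OF L2D[OF uL]]
    pair_measurable[OF L2D[OF FT_L2[OF uL]]] L2D[OF FT_L2[OF uL]] admissible_measurable[OF admissible_symb[OF s, of t]]
    admissible_measurable[OF admissible_symb_fst[OF s, of t]]
  have b0: "0 \<le> bottom s S t" using bottom_ge[OF s ex, of t] by (meson order_trans powr_ge_zero)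
  have "ennreal (wquad (\<lambda>p. symb s t (fst p)) u) = (\<integral>\<^sup>+p. ennreal (symb s t (fst p) * (cmod (FT u p))\<^sup>2) \<partial>lborel)"
    by (rule nn_integral_wquad[OF u admissible_symb_fst[OF s] symb_nonneg, symmetric])
  also have "\<dots> = (\<integral>\<^sup>+\<xi>. (\<integral>\<^sup>+\<zeta>. ennreal (symb s t \<xi> * (cmod (FT u (\<xi>, \<zeta>)))\<^sup>2) \<partial>lborel) \<partial>lborel)"
    by (subst nn_integral_lborel_fst) auto
  also have "\<dots> = (\<integral>\<^sup>+\<xi>. ennreal (symb s t \<xi>) * (\<integral>\<^sup>+\<zeta>. ennreal ((cmod (FT u (\<xi>, \<zeta>)))\<^sup>2) \<partial>lborel) \<partial>lborel)"
    by (simp add: ennreal_mult symb_nonneg nn_integral_cmult)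
  also have "\<dots> = (\<integral>\<^sup>+\<xi>. ennreal (symb s t \<xi>) * (\<integral>\<^sup>+z. ennreal ((cmod (partial_fourier u \<xi> z))\<^sup>2) \<partial>lborel) \<partial>lborel)"
    using partial_fourier_plancherel[OF uS S] by (intro nn_integral_cong_AE) (auto elim!: eventually_mono)
  also have "\<dots> = (\<integral>\<^sup>+\<xi>. (\<integral>\<^sup>+z. ennreal (symb s t \<xi> * (cmod (partial_fourier u \<xi> z))\<^sup>2) \<partial>lborel) \<partial>lborel)"
    by (simp add: ennreal_mult symb_nonneg nn_integral_cmult)
  also have "\<dots> = (\<integral>\<^sup>+z. (\<integral>\<^sup>+\<xi>. ennreal (symb s t \<xi> * (cmod (partial_fourier u \<xi> z))\<^sup>2) \<partial>lborel) \<partial>lborel)"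
    by (rule lborel_pair.Fubini'[symmetric]) measurable
  finally have lhs: "ennreal (wquad (\<lambda>p. symb s t (fst p)) u) = (\<integral>\<^sup>+z. (\<integral>\<^sup>+\<xi>. ennreal (symb s t \<xi> * (cmod (partial_fourier u \<xi> z))\<^sup>2) \<partial>lborel) \<partial>lborel)" .
  have "AE z in lborel. ennreal (bottom s S t) * (\<integral>\<^sup>+x. ennreal ((cmod (u (x, z)))\<^sup>2) \<partial>lborel)
     \<le> (\<integral>\<^sup>+\<xi>. ennreal (symb s t \<xi> * (cmod (partial_fourier u \<xi> z))\<^sup>2) \<partial>lborel)"
    using slice_L2_on[OF uS S(1)]
  proof eventually_elim
    case (elim z)
    have "(\<integral>\<^sup>+\<xi>. ennreal (symb s t \<xi> * (cmod (FT (\<lambda>x. u (x, z)) \<xi>))\<^sup>2) \<partial>lborel)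
        = (\<integral>\<^sup>+\<xi>. ennreal (symb s t \<xi> * (cmod (partial_fourier u \<xi> z))\<^sup>2) \<partial>lborel)"
      using FT_eq_fourier_L1[OF L2_onD[OF elim] L2_on_integrable(1)[OF elim S]]
      by (intro nn_integral_cong_AE) (auto elim!: eventually_mono simp: partial_fourier_def)
    then show ?case using bottom_le_nn_integral[OF s ex elim, of t] by (simp add: nn_integral_L2[OF L2_onD[OF elim]])
  qed
  then have "(\<integral>\<^sup>+z. ennreal (bottom s S t) * (\<integral>\<^sup>+x. ennreal ((cmod (u (x, z)))\<^sup>2) \<partial>lborel) \<partial>lborel)
    \<le> ennreal (wquad (\<lambda>p. symb s t (fst p)) u)"
    unfolding lhs by (rule nn_integral_mono_AE)
  also have "(\<integral>\<^sup>+z. ennreal (bottom s S t) * (\<integral>\<^sup>+x. ennreal ((cmod (u (x, z)))\<^sup>2) \<partial>lborel) \<partial>lborel)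
     = ennreal (bottom s S t) * (\<integral>\<^sup>+z. (\<integral>\<^sup>+x. ennreal ((cmod (u (x, z)))\<^sup>2) \<partial>lborel) \<partial>lborel)"
    by (intro nn_integral_cmult) measurable
  also have "\<dots> = ennreal (bottom s S t * (L2_norm u)\<^sup>2)"
    using nn_integral_lborel_snd[of "\<lambda>p. ennreal ((cmod (u p))\<^sup>2)"] L2D[OF uL] b0
    by (simp add: nn_integral_L2[OF uL] ennreal_mult)
  finally show ?thesis by (simp add: wquad_nonneg symb_nonneg)
qed

section \<open>The resolvent\<close>

lemma frac_op_iff:
  "frac_op s \<Omega> u f \<longleftrightarrow> u \<in> form_dom s \<Omega> \<and> f \<in> L2_on \<Omega> \<and>
    (\<forall>v\<in>form_dom s \<Omega>. wform (pw s) u v = L2_inner f v)"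
  by (simp add: frac_op_def form_dom_def frac_form_eq)

lemma L2_inner_cong_AE:
  assumes "f \<in> borel_measurable borel" "g \<in> borel_measurable borel" "v \<in> borel_measurable borel"
    and "AE x in lborel. f x = g x"
  shows "L2_inner f v = L2_inner g v"
  unfolding L2_inner_def using assms by (intro integral_cong_AE) auto

text \<open>Needed for the fixed point of the Neumann iteration, which is obtained up to a null set
  only.\<close>

lemma frac_op_cong_AE:
  assumes u: "frac_op s \<Omega> u f" and g: "g \<in> L2_on \<Omega>" and AE: "AE x in lborel. f x = g x"
  shows "frac_op s \<Omega> u g"
  unfolding frac_op_iff
proof (intro conjI ballI g)
  have f: "f \<in> L2_on \<Omega>" using u by (simp add: frac_op_iff)
  show "u \<in> form_dom s \<Omega>" using u by (simp add: frac_op_iff)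
  fix v assume v: "v \<in> form_dom s \<Omega>"
  have "L2_inner f v = L2_inner g v"
    by (rule L2_inner_cong_AE[OF L2D[OF L2_onD[OF f]] L2D[OF L2_onD[OF g]] L2D[OF form_dom_L2[OF v]] AE])
  then show "wform (pw s) u v = L2_inner g v" using u v by (simp add: frac_op_iff)
qed

lemma semi_inner_form: "semi_inner (form_dom s \<Omega>) (wform (pw s))"
  by (intro semi_inner_form_dom admissible_pw wquad_nonneg) auto

lemma frac_op_diff:
  assumes u: "frac_op s \<Omega> u f" and v: "frac_op s \<Omega> v g"
  shows "frac_op s \<Omega> (\<lambda>x. u x - v x) (\<lambda>x. f x - g x)"
proof -
  interpret F: semi_inner "form_dom s \<Omega>" "wform (pw s)" by (rule semi_inner_form)
  have ud: "u \<in> form_dom s \<Omega>" "v \<in> form_dom s \<Omega>" "f \<in> L2_on \<Omega>" "g \<in> L2_on \<Omega>"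
    using u v by (auto simp: frac_op_iff)
  show ?thesis
    unfolding frac_op_iff
  proof (intro conjI ballI form_dom_diff L2_on_diff ud)
    fix w assume w: "w \<in> form_dom s \<Omega>"
    show "wform (pw s) (\<lambda>x. u x - v x) w = L2_inner (\<lambda>x. f x - g x) w"
      using u v w F.B_diff[OF ud(1,2) w] L2.B_diff[OF L2_onD[OF ud(3)] L2_onD[OF ud(4)] form_dom_L2[OF w]]
      by (simp add: frac_op_iff)
  qed
qed

lemma frac_op_self:
  assumes "frac_op s \<Omega> u f"
  shows "complex_of_real (wquad (pw s) u) = L2_inner f u"
  using assms by (auto simp: frac_op_iff wform_self[symmetric])

text \<open>Numerical range: testing the equation with \<open>u\<close> gives (r - z) |u|^2 = (f,
  u), where \<open>r\<close> is the Rayleigh quotient of \<open>u\<close> and hence at least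
  \<open>l\<close>.\<close>

lemma frac_op_resolvent_bound:
  assumes low: "\<And>u. u \<in> form_dom s \<Omega> \<Longrightarrow> l * (L2_norm u)\<^sup>2 \<le> wquad (pw s) u"
    and d: "\<And>r. r \<ge> l \<Longrightarrow> d \<le> cmod (complex_of_real r - z)"
    and f: "f \<in> L2_on \<Omega>" and u: "frac_op s \<Omega> u (\<lambda>x. f x + z * u x)"
  shows "d * L2_norm u \<le> L2_norm f"
proof (cases "L2_norm u = 0")
  case False
  then have pos: "L2_norm u > 0" using L2_norm_nonneg[of u] by linarith
  have ud: "u \<in> form_dom s \<Omega>" using u by (simp add: frac_op_iff)
  note uL = form_dom_L2[OF ud] and fL = L2_onD[OF f]
  define r where "r = wquad (pw s) u / (L2_norm u)\<^sup>2"
  have r: "r \<ge> l" using low[OF ud] pos by (simp add: r_def pos_le_divide_eq)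
  have "complex_of_real (r * (L2_norm u)\<^sup>2) = L2_inner (\<lambda>x. f x + z * u x) u"
    using frac_op_self[OF u] pos by (simp add: r_def)
  also have "\<dots> = L2_inner f u + z * complex_of_real ((L2_norm u)\<^sup>2)"
    using L2.B_add[OF fL L2_scale[OF uL] uL, of z] L2.B_scale[OF uL uL, of z] L2.B_self[OF uL]
    by (simp add: L2_nrm_eq)
  finally have "(complex_of_real r - z) * complex_of_real ((L2_norm u)\<^sup>2) = L2_inner f u"
    by (simp add: algebra_simps)
  then have "cmod (complex_of_real r - z) * (L2_norm u)\<^sup>2 = cmod (L2_inner f u)"
    by (metis norm_mult norm_of_real abs_power2)
  also have "\<dots> \<le> L2_norm f * L2_norm u"
    using L2.Cauchy_Schwarz[OF fL uL] by (simp add: L2_nrm_eq)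
  finally have "d * (L2_norm u)\<^sup>2 \<le> L2_norm f * L2_norm u"
    using mult_right_mono[OF d[OF r], of "(L2_norm u)\<^sup>2"] by simp
  then have "(d * L2_norm u) * L2_norm u \<le> L2_norm f * L2_norm u" by (simp add: power2_eq_square mult.assoc)
  then show ?thesis using pos by (rule mult_right_le_imp_le)
qed simp

text \<open>The existence clause of \<open>op_resolvent_set\<close> alone; uniqueness and
  boundedness are supplied by the numerical range estimate.\<close>

definition solvable :: "real \<Rightarrow> 'b::euclidean_space set \<Rightarrow> complex \<Rightarrow> bool" where
  "solvable s \<Omega> z \<longleftrightarrow> (\<forall>f\<in>L2_on \<Omega>. \<exists>u. frac_op s \<Omega> u (\<lambda>x. f x + z * u x))"

text \<open>For \<open>N \<ge> 1\<close> the form with symbol N + |\<xi>|^(2s) is complete and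
  dominates the L2 norm, so the functional given by \<open>f\<close> is represented by a vector of
  the form domain, which solves the equation.\<close>

lemma solvable_negative:
  fixes \<Omega> :: "'b::euclidean_space set"
  assumes N: "1 \<le> N"
  shows "solvable s \<Omega> (complex_of_real (- N))"
  unfolding solvable_def
proof
  fix f assume f: "f \<in> L2_on \<Omega>"
  let ?p = "\<lambda>\<xi>::'b. norm \<xi> powr (2 * s)"
  let ?W = "\<lambda>\<xi>. N + ?p \<xi>"
  have W: "admissible s ?W" by (intro admissible_add admissible_const admissible_pw)
  have W1: "1 \<le> ?W \<xi>" "?p \<xi> \<le> ?W \<xi>" for \<xi> using N by (auto intro: add_increasing2)
  interpret W: semi_inner "form_dom s \<Omega>" "wform ?W" by (rule form_dom_form_complete(1)[OF W W1])
  interpret F: semi_inner "form_dom s \<Omega>" "wform ?p" by (rule semi_inner_form)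
  have L2_le: "L2_norm v \<le> W.nrm v" if v: "v \<in> form_dom s \<Omega>" for v
  proof (rule power2_le_imp_le)
    have "(L2_norm v)\<^sup>2 = wquad (\<lambda>_. 1) v" by (simp add: wquad_const form_dom_L2[OF v])
    also have "\<dots> \<le> wquad ?W v" by (rule wquad_mono[OF v admissible_const W W1(1)])
    finally show "(L2_norm v)\<^sup>2 \<le> (W.nrm v)\<^sup>2" by (simp add: W.nrm_sq[OF v] wform_self)
  qed (simp add: v)
  have "\<exists>u\<in>form_dom s \<Omega>. \<forall>v\<in>form_dom s \<Omega>. wform ?W v u = L2_inner v f"
  proof (rule W.Riesz)
    show "W.is_complete" by (rule form_dom_form_complete(2)[OF W W1])
    fix u v :: "'b \<Rightarrow> complex" and c
    assume u: "u \<in> form_dom s \<Omega>"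
    show "L2_inner (\<lambda>x. c * u x) f = c * L2_inner u f" by (rule L2.B_scale[OF form_dom_L2[OF u] L2_onD[OF f]])
    show "cmod (L2_inner u f) \<le> L2_norm f * W.nrm u"
      using L2.Cauchy_Schwarz[OF form_dom_L2[OF u] L2_onD[OF f]] mult_left_mono[OF L2_le[OF u] L2_norm_nonneg[of f]]
      by (simp add: L2_nrm_eq mult.commute)
    assume v: "v \<in> form_dom s \<Omega>"
    show "L2_inner (\<lambda>x. u x + v x) f = L2_inner u f + L2_inner v f"
      by (rule L2.B_add[OF form_dom_L2[OF u] form_dom_L2[OF v] L2_onD[OF f]])
  qed
  then obtain u where u: "u \<in> form_dom s \<Omega>" and eq: "\<And>v. v \<in> form_dom s \<Omega> \<Longrightarrow> wform ?W v u = L2_inner v f" by blast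
  have "frac_op s \<Omega> u (\<lambda>x. f x + complex_of_real (- N) * u x)"
    unfolding frac_op_iff
  proof (intro conjI ballI u L2_on_add L2_on_scale f form_dom_L2_on[OF u])
    fix v assume v: "v \<in> form_dom s \<Omega>"
    note uL = form_dom_L2[OF u] and vL = form_dom_L2[OF v] and fL = L2_onD[OF f]
    have "wform ?W u v = L2_inner f v"
      using W.B_cnj[OF v u] L2.B_cnj[OF vL fL] eq[OF v] by simp
    moreover have "wform ?W u v = complex_of_real N * L2_inner u v + wform ?p u v"
      using wform_add[OF u v admissible_const admissible_pw, of N] by (simp add: wform_const uL vL)
    moreover have "L2_inner (\<lambda>x. f x + complex_of_real (- N) * u x) v = L2_inner f v + complex_of_real (- N) * L2_inner u v"
      by (simp only: L2.B_add[OF fL L2_scale[OF uL] vL] L2.B_scale[OF uL vL])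
    ultimately show "wform ?p u v = L2_inner (\<lambda>x. f x + complex_of_real (- N) * u x) v" by (simp add: algebra_simps)
  qed
  then show "\<exists>u. frac_op s \<Omega> u (\<lambda>x. f x + complex_of_real (- N) * u x)" by blast
qed

text \<open>Neumann series: \<open>u \<mapsto> R (f + (z - z0) u)\<close> is a contraction, \<open>R\<close> being the resolvent at \<open>z0\<close>.\<close>

lemma solvable_step:
  fixes \<Omega> :: "'b::euclidean_space set"
  assumes low: "\<And>u. u \<in> form_dom s \<Omega> \<Longrightarrow> l * (L2_norm u)\<^sup>2 \<le> wquad (pw s) u"
    and d: "\<And>r. r \<ge> l \<Longrightarrow> d \<le> cmod (complex_of_real r - z0)"
    and z0: "solvable s \<Omega> z0" and z: "cmod (z - z0) < d"
  shows "solvable s \<Omega> z"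
  unfolding solvable_def
proof
  fix f assume f: "f \<in> L2_on \<Omega>"
  have d0: "d > 0" using z norm_ge_zero[of "z - z0"] by linarith
  \<comment> \<open>By \<open>frac_op_resolvent_bound\<close> the solution operator at
    \<open>z0\<close> has norm at most \<open>1 / d\<close>, and this is the resulting contraction
    factor.\<close>
  define q where "q = cmod (z - z0) / d"
  have q: "0 \<le> q" "q < 1" using z d0 by (auto simp: q_def)
  obtain R where R: "\<And>g. g \<in> L2_on \<Omega> \<Longrightarrow> frac_op s \<Omega> (R g) (\<lambda>x. g x + z0 * R g x)"
    using z0 unfolding solvable_def by metis
  define T where "T = (\<lambda>u. R (\<lambda>x. f x + (z - z0) * u x))"
  have g: "(\<lambda>x. f x + (z - z0) * u x) \<in> L2_on \<Omega>" if "u \<in> L2_on \<Omega>" for u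
    using that f by (intro L2_on_add L2_on_scale)
  have T: "T u \<in> L2_on \<Omega>" if "u \<in> L2_on \<Omega>" for u
    using R[OF g[OF that]] form_dom_L2_on by (auto simp: T_def frac_op_iff)
  have contr: "L2_norm (\<lambda>x. T u x - T v x) \<le> q * L2_norm (\<lambda>x. u x - v x)"
    if u: "u \<in> L2_on \<Omega>" and v: "v \<in> L2_on \<Omega>" for u v
  proof -
    let ?h = "\<lambda>x. (z - z0) * (u x - v x)"
    have "frac_op s \<Omega> (\<lambda>x. T u x - T v x) (\<lambda>x. ?h x + z0 * (T u x - T v x))"
      using frac_op_diff[OF R[OF g[OF u]] R[OF g[OF v]]] by (simp add: T_def algebra_simps)
    then have "d * L2_norm (\<lambda>x. T u x - T v x) \<le> L2_norm ?h"
      by (intro frac_op_resolvent_bound[OF low d]) (auto intro!: L2_on_scale L2_on_diff u v)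
    also have "\<dots> = cmod (z - z0) * L2_norm (\<lambda>x. u x - v x)"
      using L2.nrm_scale[OF L2_diff[OF L2_onD[OF u] L2_onD[OF v]]] by (simp add: L2_nrm_eq)
    finally show ?thesis using d0 by (simp add: q_def field_simps)
  qed
  define X where "X n = (T ^^ n) (\<lambda>x. 0)" for n
  have X: "X n \<in> L2_on \<Omega>" for n by (induction n) (auto simp: X_def L2_on_zero T)
  note XL = L2_onD[OF X]
  have XS: "X (Suc n) = T (X n)" for n by (simp add: X_def)
  \<comment> \<open>The fixed point of x \<mapsto> |X 1| + q x, the recursion that bounds the norms
    of the iterates.\<close>
  define M where "M = L2_norm (X 1) / (1 - q)"
  have XM: "L2_norm (X n) \<le> M" for n
  proof (induction n)
    case 0
    then show ?case using q by (simp add: X_def M_def L2_norm_def)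
  next
    case (Suc n)
    have "L2_norm (X (Suc n)) \<le> L2_norm (X 1) + L2_norm (\<lambda>x. X (Suc n) x - X 1 x)"
      using L2.nrm_triangle_diff[OF XL XL, of "Suc n" 1] by (simp add: L2_nrm_eq)
    also have "L2_norm (\<lambda>x. X (Suc n) x - X 1 x) \<le> q * L2_norm (X n)"
      using contr[OF X[of n] X[of 0]] XS[of 0] by (simp add: XS) (simp add: X_def)
    also have "\<dots> \<le> q * M" using Suc q by (intro mult_left_mono)
    finally have "L2_norm (X (Suc n)) \<le> L2_norm (X 1) + q * M" by simp
    also have "\<dots> = M" using q by (simp add: M_def field_simps)
    finally show ?case .
  qed
  have diff: "L2_norm (\<lambda>x. X (n + k) x - X n x) \<le> q ^ n * M" for n k
  proof (induction n)
    case 0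
    show ?case using XM[of k] by (simp add: X_def)
  next
    case (Suc n)
    have "L2_norm (\<lambda>x. X (Suc n + k) x - X (Suc n) x) \<le> q * L2_norm (\<lambda>x. X (n + k) x - X n x)"
      using contr[OF X X, of "n + k" n] by (simp add: XS)
    also have "\<dots> \<le> q * (q ^ n * M)" using Suc q by (intro mult_left_mono)
    finally show ?case by simp
  qed
  have "L2.cauchy X"
  proof (rule L2.cauchyI_bound)
    show "X n \<in> L2" for n by (rule XL)
    have "(\<lambda>m. (q ^ m * M)\<^sup>2) \<longlonglongrightarrow> (0 * M)\<^sup>2"
      using q by (intro tendsto_intros LIMSEQ_power_zero) auto
    then show "(\<lambda>m. (q ^ m * M)\<^sup>2) \<longlonglongrightarrow> 0" by simp
    fix m n :: nat assume "m \<le> n"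
    then obtain k where n: "n = m + k" using le_Suc_ex by blast
    show "(L2.nrm (\<lambda>x. X m x - X n x))\<^sup>2 \<le> (q ^ m * M)\<^sup>2"
      unfolding L2.nrm_minus[OF XL XL, of m n] unfolding n L2_nrm_eq by (intro power_mono diff) auto
  qed
  then obtain u where u: "u \<in> L2_on \<Omega>" and lim: "(\<lambda>n. L2_norm (\<lambda>x. X n x - u x)) \<longlonglongrightarrow> 0"
    by (rule L2_on_limit[OF _ X])
  have AE: "AE x in lborel. T u x = u x"
  proof (rule L2_limit_unique[of "\<lambda>n. X (Suc n)"])
    show "(\<lambda>n. L2_norm (\<lambda>x. X (Suc n) x - u x)) \<longlonglongrightarrow> 0" using LIMSEQ_Suc[OF lim] .
    show "(\<lambda>n. L2_norm (\<lambda>x. X (Suc n) x - T u x)) \<longlonglongrightarrow> 0"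
    proof (rule Lim_null_comparison[OF always_eventually])
      show "(\<lambda>n. q * L2_norm (\<lambda>x. X n x - u x)) \<longlonglongrightarrow> 0" using tendsto_mult[OF tendsto_const lim, of q] by simp
      show "\<forall>n. norm (L2_norm (\<lambda>x. X (Suc n) x - T u x)) \<le> q * L2_norm (\<lambda>x. X n x - u x)"
        using contr[OF X u] by (simp add: XS)
    qed
  qed (auto intro: XL L2_onD[OF u] L2_onD[OF T[OF u]])
  have "frac_op s \<Omega> (T u) (\<lambda>x. (f x + (z - z0) * u x) + z0 * T u x)"
    using R[OF g[OF u]] by (simp add: T_def)
  \<comment> \<open>\<open>T u\<close> and not \<open>u\<close> is known to be in the operator
    domain, so \<open>u\<close> on the right-hand side is exchanged for \<open>T u\<close>.\<close>
  then have "frac_op s \<Omega> (T u) (\<lambda>x. f x + z * T u x)"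
    by (rule frac_op_cong_AE) (use AE in \<open>auto intro!: L2_on_add L2_on_scale f T u elim!: eventually_mono simp: algebra_simps\<close>)
  then show "\<exists>u. frac_op s \<Omega> u (\<lambda>x. f x + z * u x)" by blast
qed

text \<open>At most two Neumann steps reach any point. Discs about far negative points exhaust the
  half-plane to the left of \<open>l\<close>; discs centred on the line of real part
  \<open>l - 1\<close>, with radius the distance from the centre to \<open>l\<close>, reach the
  remaining nonreal points.\<close>

lemma solvable_off_ray:
  fixes \<Omega> :: "'b::euclidean_space set"
  assumes low: "\<And>u. u \<in> form_dom s \<Omega> \<Longrightarrow> l * (L2_norm u)\<^sup>2 \<le> wquad (pw s) u"
    and z: "z \<notin> complex_of_real ` {l..}"
  shows "solvable s \<Omega> z"
proof -
  have left: "solvable s \<Omega> z" if z: "Re z < l" for z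
  proof -
    \<comment> \<open>The last summand makes |z|^2 < 2 N (l - Re z), which puts \<open>z\<close> in
      the disc of radius \<open>l + N\<close> about \<open>- N\<close>; the others ensure
      \<open>1 \<le> N\<close> and \<open>l + N > 0\<close>.\<close>
    define N where "N = 1 + \<bar>l\<bar> + (cmod z)\<^sup>2 / (2 * (l - Re z))"
    have "0 \<le> (cmod z)\<^sup>2 / (2 * (l - Re z))" using z by (intro divide_nonneg_nonneg) auto
    then have N: "1 \<le> N" "l + N > 0" by (auto simp: N_def)
    show ?thesis
    proof (rule solvable_step[OF low _ solvable_negative[OF N(1)]])
      show "l + N \<le> cmod (complex_of_real r - complex_of_real (- N))" if "r \<ge> l" for r
        using that abs_Re_le_cmod[of "complex_of_real r - complex_of_real (- N)"] by simp
      have "(cmod z)\<^sup>2 = (cmod z)\<^sup>2 / (2 * (l - Re z)) * (2 * (l - Re z))" using z by simp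
      also have "\<dots> < N * (2 * (l - Re z))" using z by (intro mult_strict_right_mono) (auto simp: N_def)
      finally have "(cmod z)\<^sup>2 < 2 * N * (l - Re z)" by (simp only: mult_ac)
      then have "(cmod (z - complex_of_real (- N)))\<^sup>2 < (l + N)\<^sup>2"
        by (simp add: cmod_power2 power2_sum algebra_simps) (smt (verit) zero_le_power2)
      then show "cmod (z - complex_of_real (- N)) < l + N"
        using N(2) by (meson less_imp_le power_less_imp_less_base)
    qed
  qed
  show ?thesis
  proof (cases "Re z < l")
    case True
    then show ?thesis by (rule left)
  next
    case False
    have y: "Im z \<noteq> 0"
    proof
      assume "Im z = 0"
      then have "z = complex_of_real (Re z)" by (simp add: complex_eq_iff)
      with False z show False by (metis atLeast_iff imageI linorder_not_less)
    qed
    \<comment> \<open>The solution of |z - z0|^2 = K^2 for \<open>z0 = Complex (l - 1) K\<close>,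
      while the ray is at distance \<open>sqrt (1 + K\<^sup>2)\<close> from
      \<open>z0\<close>.\<close>
    define K where "K = ((Re z - l + 1)\<^sup>2 + (Im z)\<^sup>2) / (2 * Im z)"
    define z0 where "z0 = Complex (l - 1) K"
    show ?thesis
    proof (rule solvable_step[OF low _ left])
      show "Re z0 < l" by (simp add: z0_def)
      show "sqrt (1 + K\<^sup>2) \<le> cmod (complex_of_real r - z0)" if "r \<ge> l" for r
      proof -
        have "1\<^sup>2 \<le> (r - (l - 1))\<^sup>2" using that by (intro power_mono) auto
        then show ?thesis by (simp add: cmod_def z0_def)
      qed
      have "2 * Im z * K = (Re z - l + 1)\<^sup>2 + (Im z)\<^sup>2" using y by (simp add: K_def)
      moreover have "(cmod (z - z0))\<^sup>2 = (Re z - l + 1)\<^sup>2 + (Im z)\<^sup>2 - 2 * Im z * K + K\<^sup>2"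
        unfolding cmod_power2 by (simp add: z0_def power2_eq_square algebra_simps)
      ultimately have "(cmod (z - z0))\<^sup>2 < 1 + K\<^sup>2" by simp
      then show "cmod (z - z0) < sqrt (1 + K\<^sup>2)" by (rule real_less_rsqrt)
    qed
  qed
qed

text \<open>Solvability comes from the Neumann steps. Uniqueness and the norm bound both follow from
  the numerical range estimate, uniqueness being the case of right-hand side 0.\<close>

theorem resolvent_off_ray:
  fixes \<Omega> :: "'b::euclidean_space set"
  assumes low: "\<And>u. u \<in> form_dom s \<Omega> \<Longrightarrow> l * (L2_norm u)\<^sup>2 \<le> wquad (pw s) u"
    and z: "z \<notin> complex_of_real ` {l..}"
  shows "z \<in> op_resolvent_set (L2_on \<Omega>) (frac_op s \<Omega>)"
proof -
  obtain d where d: "d > 0" "\<And>r. r \<ge> l \<Longrightarrow> d \<le> cmod (complex_of_real r - z)"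
  proof (cases "Re z < l")
    case True
    have "l - Re z \<le> cmod (complex_of_real r - z)" if "r \<ge> l" for r
      using that complex_Re_le_cmod[of "complex_of_real r - z"] by simp
    then show thesis using True by (intro that[of "l - Re z"]) auto
  next
    case False
    have y: "Im z \<noteq> 0"
    proof
      assume "Im z = 0"
      then have "z = complex_of_real (Re z)" by (simp add: complex_eq_iff)
      with False z show False by (metis atLeast_iff imageI linorder_not_less)
    qed
    have "\<bar>Im z\<bar> \<le> cmod (complex_of_real r - z)" for r
      using abs_Im_le_cmod[of "complex_of_real r - z"] by simp
    then show thesis using y by (intro that[of "\<bar>Im z\<bar>"]) auto
  qed
  have bound: "d * L2_norm u \<le> L2_norm f" if "f \<in> L2_on \<Omega>" "frac_op s \<Omega> u (\<lambda>x. f x + z * u x)" for u f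
    by (rule frac_op_resolvent_bound[OF low d(2)]) (use that in auto)
  show ?thesis
    unfolding op_resolvent_set_def
  proof (intro CollectI conjI allI impI)
    show "\<forall>f\<in>L2_on \<Omega>. \<exists>u. frac_op s \<Omega> u (\<lambda>x. f x + z * u x)"
      using solvable_off_ray[OF low z] by (simp add: solvable_def)
    show "AE x in lborel. u x = 0" if u: "frac_op s \<Omega> u (\<lambda>x. z * u x)" for u
    proof -
      have "d * L2_norm u \<le> L2_norm (\<lambda>x::'b. 0)" using bound[of "\<lambda>x. 0" u, OF L2_on_zero] u by simp
      then have "d * L2_norm u \<le> 0" by (simp add: L2_norm_def)
      then have "L2_norm u = 0" using d(1) by (simp add: mult_le_0_iff order_antisym)
      moreover have "u \<in> L2" using u form_dom_L2 by (auto simp: frac_op_iff)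
      ultimately show ?thesis using L2_norm_eq_0_iff by blast
    qed
    show "\<exists>C. \<forall>u f. f \<in> L2_on \<Omega> \<longrightarrow> frac_op s \<Omega> u (\<lambda>x. f x + z * u x) \<longrightarrow> L2_norm u \<le> C * L2_norm f"
      using bound d(1) by (intro exI[of _ "1 / d"]) (auto simp: field_simps)
  qed
qed

text \<open>Weyl's criterion in weak form. The resolvent equation is solved for \<open>u\<close>
  with right-hand side \<open>w\<close> and tested with \<open>w\<close>; by symmetry the result is
  the defect of \<open>w\<close> tested against \<open>u\<close>, and \<open>u\<close> is bounded by
  a multiple of \<open>w\<close>.\<close>

lemma not_resolvent_of_approximate_eigenvector:
  fixes \<Omega> :: "'b::euclidean_space set"
  assumes weyl: "\<And>d. d > 0 \<Longrightarrow> \<exists>w\<in>form_dom s \<Omega>. L2_norm w > 0 \<and> (\<forall>v\<in>form_dom s \<Omega>.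
      cmod (wform (pw s) w v - complex_of_real \<mu> * L2_inner w v) \<le> d * L2_norm w * L2_norm v)"
  shows "complex_of_real \<mu> \<notin> op_resolvent_set (L2_on \<Omega>) (frac_op s \<Omega>)"
proof
  let ?p = "\<lambda>\<xi>::'b. norm \<xi> powr (2 * s)"
  let ?z = "complex_of_real \<mu>"
  assume *: "?z \<in> op_resolvent_set (L2_on \<Omega>) (frac_op s \<Omega>)"
  then obtain C0 where C0: "\<And>u f. f \<in> L2_on \<Omega> \<Longrightarrow> frac_op s \<Omega> u (\<lambda>x. f x + ?z * u x) \<Longrightarrow> L2_norm u \<le> C0 * L2_norm f"
    unfolding op_resolvent_set_def by blast
  define C where "C = \<bar>C0\<bar> + 1"
  have C: "C > 0" "C0 \<le> C" by (auto simp: C_def)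
  \<comment> \<open>With tolerance \<open>1 / (2 * C)\<close> the resolvent bound will give |w|^2
    \<le> |w|^2 / 2.\<close>
  obtain w where w: "w \<in> form_dom s \<Omega>" "L2_norm w > 0"
    and wv: "\<And>v. v \<in> form_dom s \<Omega> \<Longrightarrow> cmod (wform ?p w v - ?z * L2_inner w v) \<le> 1 / (2 * C) * L2_norm w * L2_norm v"
    using weyl[of "1 / (2 * C)"] C by auto
  note wS = form_dom_L2_on[OF w(1)] and wL = form_dom_L2[OF w(1)]
  obtain u where u: "frac_op s \<Omega> u (\<lambda>x. w x + ?z * u x)"
    using * wS unfolding op_resolvent_set_def by blast
  have ud: "u \<in> form_dom s \<Omega>" using u by (simp add: frac_op_iff)
  note uL = form_dom_L2[OF ud]
  interpret F: semi_inner "form_dom s \<Omega>" "wform ?p" by (rule semi_inner_form)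
  have "wform ?p u w = L2_inner (\<lambda>x. w x + ?z * u x) w" using u w(1) by (simp add: frac_op_iff)
  also have "\<dots> = complex_of_real ((L2_norm w)\<^sup>2) + ?z * L2_inner u w"
    using L2.B_add[OF wL L2_scale[OF uL] wL, of ?z] L2.B_scale[OF uL wL, of ?z] L2.B_self[OF wL]
    by (simp add: L2_nrm_eq)
  finally have "complex_of_real ((L2_norm w)\<^sup>2) = wform ?p u w - ?z * L2_inner u w" by simp
  also have "\<dots> = cnj (wform ?p w u - ?z * L2_inner w u)"
    using F.B_cnj[OF w(1) ud] L2.B_cnj[OF wL uL] by simp
  finally have "(L2_norm w)\<^sup>2 = cmod (wform ?p w u - ?z * L2_inner w u)"
    by (metis complex_mod_cnj norm_of_real abs_power2)
  also have "\<dots> \<le> 1 / (2 * C) * L2_norm w * L2_norm u" by (rule wv[OF ud])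
  also have "\<dots> \<le> 1 / (2 * C) * L2_norm w * (C * L2_norm w)"
  proof (intro mult_left_mono)
    have "L2_norm u \<le> C0 * L2_norm w" by (rule C0[OF wS u])
    also have "\<dots> \<le> C * L2_norm w" using C by (intro mult_right_mono) auto
    finally show "L2_norm u \<le> C * L2_norm w" .
  qed (use C w in auto)
  also have "\<dots> = (L2_norm w)\<^sup>2 / 2" using C by (simp add: power2_eq_square)
  finally show False using w(2) by (simp add: power2_eq_square)
qed

section \<open>Approximate eigenfunctions on the cylinder\<close>

lemma AE_lborel_fst:
  assumes "AE x in (lborel :: 'a::euclidean_space measure). P x" "{x. P x} \<in> sets borel"
  shows "AE p in (lborel :: ('a \<times> 'b::euclidean_space) measure). P (fst p)"
  unfolding lborel_prod[symmetric]
proof (rule lborel_pair.AE_pair_measure)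
  show "{p \<in> space ((lborel :: 'a measure) \<Otimes>\<^sub>M (lborel :: 'b measure)). P (fst p)} \<in> sets (lborel \<Otimes>\<^sub>M lborel)"
    using measurable_sets[OF measurable_fst, of "{x. P x}" lborel "lborel :: 'b measure"] assms(2)
    by (simp add: vimage_def Int_def conj_commute)
  show "AE x in lborel. AE y in lborel. P (fst (x, y))" using assms(1) by eventually_elim simp
qed

lemma integral_fst_snd:
  fixes a :: "'a::euclidean_space \<Rightarrow> real" and b :: "'b::euclidean_space \<Rightarrow> real"
  assumes "integrable lborel a" "integrable lborel b"
  shows "integrable lborel (\<lambda>p. a (fst p) * b (snd p))"
    and "(\<integral>p. a (fst p) * b (snd p) \<partial>lborel) = (\<integral>x. a x \<partial>lborel) * (\<integral>y. b y \<partial>lborel)"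
  using lborel_pair.integrable_pair_mult[OF assms]
    lborel_pair.integral_fst'[OF lborel_pair.integrable_pair_mult[OF assms]]
  by (simp_all add: lborel_prod case_prod_unfold)

definition tensor :: "('a \<Rightarrow> complex) \<Rightarrow> (real \<Rightarrow> complex) \<Rightarrow> 'a \<times> real \<Rightarrow> complex" where
  "tensor \<phi> \<psi> = (\<lambda>p. \<phi> (fst p) * \<psi> (snd p))"

text \<open>\<open>\<phi>\<close> is integrable because \<open>S\<close> is bounded, so the
  transform of the product is a genuine integral and splits by
  \<open>fourier_L1_pair\<close>.\<close>

lemma tensor_L2_on:
  fixes \<phi> :: "'a::euclidean_space \<Rightarrow> complex"
  assumes \<phi>: "\<phi> \<in> L2_on S" and S: "S \<in> sets borel" "bounded S" and \<psi>: "\<psi> \<in> L2" "integrable lborel \<psi>"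
  shows "tensor \<phi> \<psi> \<in> L2_on (S \<times> UNIV)" "integrable lborel (tensor \<phi> \<psi>)"
    "AE p in lborel. FT (tensor \<phi> \<psi>) p = FT \<phi> (fst p) * fourier_L1 \<psi> (snd p)"
    "L2_norm (tensor \<phi> \<psi>) = L2_norm \<phi> * L2_norm \<psi>"
proof -
  note \<phi>L = L2_onD[OF \<phi>] and \<phi>1 = L2_on_integrable(1)[OF \<phi> S]
  note [measurable] = L2D[OF \<phi>L] L2D[OF FT_L2[OF \<phi>L]] L2D[OF \<psi>(1)] S(1)
  show int: "integrable lborel (tensor \<phi> \<psi>)"
    using lborel_pair.integrable_pair_mult[OF \<phi>1 \<psi>(2)] by (simp add: lborel_prod case_prod_unfold tensor_def)
  have sq: "(cmod (tensor \<phi> \<psi> p))\<^sup>2 = (cmod (\<phi> (fst p)))\<^sup>2 * (cmod (\<psi> (snd p)))\<^sup>2" for p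
    by (simp add: tensor_def norm_mult power_mult_distrib)
  note prod = integral_fst_snd[OF L2_integrable[OF \<phi>L] L2_integrable[OF \<psi>(1)]]
  have L: "tensor \<phi> \<psi> \<in> L2"
    unfolding L2_def using borel_measurable_integrable[OF int] prod(1) by (simp add: sq)
  have "AE p in (lborel :: ('a \<times> real) measure). fst p \<notin> S \<longrightarrow> \<phi> (fst p) = 0"
    by (rule AE_lborel_fst) (use \<phi> in \<open>auto simp: L2_on_def\<close>)
  with L show "tensor \<phi> \<psi> \<in> L2_on (S \<times> UNIV)"
    unfolding L2_on_def by (auto simp: tensor_def elim!: eventually_mono)
  have F: "fourier_L1 (tensor \<phi> \<psi>) (\<xi>, \<zeta>) = fourier_L1 \<phi> \<xi> * fourier_L1 \<psi> \<zeta>" for \<xi> \<zeta>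
  proof -
    have "partial_fourier (tensor \<phi> \<psi>) \<xi> = (\<lambda>z. fourier_L1 \<phi> \<xi> * \<psi> z)"
      using fourier_L1_scale[of "\<psi> _" \<phi> \<xi>] by (simp add: fun_eq_iff partial_fourier_def tensor_def mult.commute)
    then show ?thesis using fourier_L1_pair(2)[OF int] by (simp add: fourier_L1_scale)
  qed
  have "AE p in (lborel :: ('a \<times> real) measure). FT \<phi> (fst p) = fourier_L1 \<phi> (fst p)"
    by (rule AE_lborel_fst[OF FT_eq_fourier_L1[OF \<phi>L \<phi>1]]) measurable
  with FT_eq_fourier_L1[OF L int] show "AE p in lborel. FT (tensor \<phi> \<psi>) p = FT \<phi> (fst p) * fourier_L1 \<psi> (snd p)"
    by eventually_elim (metis F prod.collapse)
  show "L2_norm (tensor \<phi> \<psi>) = L2_norm \<phi> * L2_norm \<psi>"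
    unfolding L2_norm_def sq prod(2) by (rule real_sqrt_mult)
qed

text \<open>A plane wave of frequency \<open>t\<close> under a Gaussian of width of order
  \<open>1 / e\<close>; its transform is a Gaussian of width of order \<open>e\<close> about
  \<open>t\<close>.\<close>

definition wave :: "real \<Rightarrow> real \<Rightarrow> real \<Rightarrow> complex" where
  "wave t e z = exp (\<i> * complex_of_real (t * z)) * complex_of_real (exp (- (norm (e *\<^sub>R z))\<^sup>2 / 2))"

lemma wave_fourier:
  assumes e: "e > 0"
  shows "wave t e \<in> L2" "integrable lborel (wave t e)"
    "fourier_L1 (wave t e) \<zeta> = complex_of_real (inverse e * exp (- (norm (inverse e *\<^sub>R (\<zeta> - t)))\<^sup>2 / 2))"
proof -
  have [measurable]: "wave t e \<in> borel_measurable borel" unfolding wave_def by measurable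
  have norm: "cmod (wave t e z) = exp (- (norm (e *\<^sub>R z))\<^sup>2 / 2)" for z
    by (simp add: wave_def norm_mult)
  note G = gaussian_fourier_scaled(1)[OF e, where 'b=real]
  show "integrable lborel (wave t e)"
    by (rule Bochner_Integration.integrable_bound[OF G]) (auto simp: norm)
  have "integrable lborel (\<lambda>z. (cmod (wave t e z))\<^sup>2)"
  proof (rule Bochner_Integration.integrable_bound[OF G])
    show "AE z in lborel. norm ((cmod (wave t e z))\<^sup>2) \<le> norm (exp (- (norm (e *\<^sub>R z))\<^sup>2 / 2))"
      unfolding norm by (auto intro!: always_eventually power_le_one simp: power2_eq_square[of "exp _"] mult_le_cancel_left1)
  qed measurable
  then show "wave t e \<in> L2" by (simp add: L2_def)
  have ex: "exp (- \<i> * complex_of_real (\<zeta> \<bullet> z)) * wave t e z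
    = exp (- \<i> * complex_of_real (z \<bullet> (\<zeta> - t))) * complex_of_real (exp (- (norm (e *\<^sub>R z))\<^sup>2 / 2))" for z
    unfolding wave_def mult.assoc[symmetric] exp_add[symmetric]
    by (rule arg_cong[of _ _ "\<lambda>x. exp x * _"]) (simp add: algebra_simps)
  have "fourier_L1 (wave t e) \<zeta> = complex_of_real ((2 * pi) powr (- real DIM(real) / 2)) *
     complex_of_real (inverse e ^ DIM(real) * ((2 * pi) powr (real DIM(real) / 2) * exp (- (norm (inverse e *\<^sub>R (\<zeta> - t)))\<^sup>2 / 2)))"
    unfolding fourier_L1_def ex gaussian_fourier_scaled(2)[OF e] ..
  also have "\<dots> = complex_of_real (inverse e * exp (- (norm (inverse e *\<^sub>R (\<zeta> - t)))\<^sup>2 / 2))"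
    unfolding of_real_mult[symmetric] by (rule arg_cong[of _ _ complex_of_real]) (simp add: powr_minus)
  finally show "fourier_L1 (wave t e) \<zeta> = complex_of_real (inverse e * exp (- (norm (inverse e *\<^sub>R (\<zeta> - t)))\<^sup>2 / 2))" .
qed

lemma integrable_poly_gaussian:
  "integrable lborel (\<lambda>y::real. (1 + a * y ^ 2 + b * y ^ 4) * exp (- y\<^sup>2 / 2))"
proof -
  have int: "integrable lborel (\<lambda>y. sqrt (2 * pi) * (std_normal_density y * y ^ 0 + a * (std_normal_density y * y ^ 2) + b * (std_normal_density y * y ^ 4)))"
    by (intro integrable_mult_right Bochner_Integration.integrable_add integrable_std_normal_moment)
  have eq: "sqrt (2 * pi) * (std_normal_density y * y ^ 0 + a * (std_normal_density y * y ^ 2) + b * (std_normal_density y * y ^ 4))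
      = (1 + a * y ^ 2 + b * y ^ 4) * exp (- y\<^sup>2 / 2)" for y
    by (simp add: normal_density_def field_simps)
  show ?thesis using int unfolding eq .
qed

text \<open>Under \<zeta> = t + e y the weight gains a factor e^(2s), since |\<zeta>^2 - t^2| \<le>
  e |y| (2|t| + |y|) for e \<le> 1, while the squared norm is g0 / e and the weighted integral at
  most e^(2s) H / e. Their quotient tends to 0 with e.\<close>

lemma wave_concentrates:
  fixes s t d :: real
  assumes s: "0 < s" "s < 1" and d: "d > 0"
  obtains e where "e > 0" "L2_norm (wave t e) > 0"
    "integrable lborel (\<lambda>\<zeta>. \<bar>\<zeta>\<^sup>2 - t\<^sup>2\<bar> powr (2 * s) * (cmod (fourier_L1 (wave t e) \<zeta>))\<^sup>2)"
    "(\<integral>\<zeta>. \<bar>\<zeta>\<^sup>2 - t\<^sup>2\<bar> powr (2 * s) * (cmod (fourier_L1 (wave t e) \<zeta>))\<^sup>2 \<partial>lborel) \<le> (d * L2_norm (wave t e))\<^sup>2"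
proof -
  define m where "m = (\<lambda>y::real. (\<bar>y\<bar> * (2 * \<bar>t\<bar> + \<bar>y\<bar>)) powr (2 * s))"
  define g where "g = (\<lambda>y::real. m y * exp (- y\<^sup>2))"
  have [measurable]: "m \<in> borel_measurable borel" "g \<in> borel_measurable borel" unfolding m_def g_def by measurable
  have m_le: "m y \<le> 1 + 8 * t\<^sup>2 * y ^ 2 + 2 * y ^ 4" for y
  proof -
    define a where "a = \<bar>y\<bar> * (2 * \<bar>t\<bar> + \<bar>y\<bar>)"
    have a: "0 \<le> a" by (simp add: a_def)
    have "a powr (2 * s) \<le> 1 + a\<^sup>2"
    proof (cases "a \<le> 1")
      case True
      then have "a powr (2 * s) \<le> 1" using a s by (intro powr_le1) auto
      then show ?thesis by (simp add: add_increasing2)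
    next
      case False
      then have "a powr (2 * s) \<le> a powr 2" using s by (intro powr_mono) auto
      then show ?thesis using False by simp
    qed
    also have "a\<^sup>2 = \<bar>y\<bar>\<^sup>2 * (2 * \<bar>t\<bar> + \<bar>y\<bar>)\<^sup>2" by (simp add: a_def power_mult_distrib)
    also have "(2 * \<bar>t\<bar> + \<bar>y\<bar>)\<^sup>2 \<le> 8 * t\<^sup>2 + 2 * y\<^sup>2"
      using zero_le_power2[of "2 * \<bar>t\<bar> - \<bar>y\<bar>"] unfolding power2_diff power2_sum by (simp add: power_mult_distrib)
    finally have "a powr (2 * s) \<le> 1 + \<bar>y\<bar>\<^sup>2 * (8 * t\<^sup>2 + 2 * y\<^sup>2)" by (simp add: mult_left_mono)
    also have "\<dots> = 1 + 8 * t\<^sup>2 * y ^ 2 + 2 * y ^ 4" by (simp add: algebra_simps power4_eq_xxxx power2_eq_square)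
    finally show ?thesis by (simp add: m_def a_def)
  qed
  have g_int: "integrable lborel g"
  proof (rule Bochner_Integration.integrable_bound[OF integrable_poly_gaussian[of "8 * t\<^sup>2" 2]])
    show "AE y in lborel. norm (g y) \<le> norm ((1 + 8 * t\<^sup>2 * y ^ 2 + 2 * y ^ 4) * exp (- y\<^sup>2 / 2))"
    proof (intro always_eventually allI)
      fix y :: real
      have m0: "0 \<le> m y" by (simp add: m_def)
      have "g y \<le> (1 + 8 * t\<^sup>2 * y ^ 2 + 2 * y ^ 4) * exp (- y\<^sup>2 / 2)"
        unfolding g_def using m_le[of y] m0 by (intro mult_mono) auto
      then show "norm (g y) \<le> norm ((1 + 8 * t\<^sup>2 * y ^ 2 + 2 * y ^ 4) * exp (- y\<^sup>2 / 2))"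
        using m0 by (simp add: g_def abs_mult)
    qed
  qed measurable
  define H where "H = (\<integral>y. g y \<partial>lborel)"
  have H: "0 \<le> H" unfolding H_def by (intro integral_nonneg_AE) (simp add: g_def m_def)
  define g0 where "g0 = (\<integral>y. exp (- y\<^sup>2) \<partial>(lborel :: real measure))"
  have sq2: "- (norm (sqrt 2 *\<^sub>R y))\<^sup>2 / 2 = - y\<^sup>2" for y :: real
    by (simp add: power_mult_distrib)
  have g0_int: "integrable lborel (\<lambda>y::real. exp (- y\<^sup>2))"
    using gaussian_fourier_scaled(1)[of "sqrt 2", where 'b=real] unfolding sq2 by simp
  have g0: "g0 > 0"
  proof -
    have "(2 * pi) powr (real DIM(real) / 2) = (\<integral>x. exp (- (norm (x::real))\<^sup>2 / 2) \<partial>lborel)"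
      by (rule integral_gaussian[symmetric])
    also have "\<dots> = \<bar>sqrt 2\<bar> ^ DIM(real) *\<^sub>R (\<integral>x. exp (- (norm (0 + sqrt 2 *\<^sub>R (x::real)))\<^sup>2 / 2) \<partial>lborel)"
      by (rule integral_lborel_affine) auto
    also have "\<dots> = sqrt 2 * g0" unfolding add_0 sq2 by (simp add: g0_def)
    finally have "0 < sqrt 2 * g0" by (metis powr_gt_zero mult_pos_pos pi_gt_zero zero_less_numeral less_irrefl)
    then show ?thesis by (simp add: zero_less_mult_iff)
  qed
  \<comment> \<open>The target for e^(2s), so that e^(2s) H \<le> d^2 g0; \<open>H + 1\<close>
    avoids a division by zero.\<close>
  define k where "k = d\<^sup>2 * g0 / (H + 1)"
  have k: "k > 0" using d g0 H by (simp add: k_def)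
  \<comment> \<open>The bound \<open>e \<le> 1\<close> lets \<open>e * \<bar>y\<bar>\<close> be
    replaced by \<open>\<bar>y\<bar>\<close> in the estimate of the weight.\<close>
  define e where "e = min 1 (k powr (1 / (2 * s)))"
  have e: "e > 0" "e \<le> 1" using k by (auto simp: e_def)
  have "e powr (2 * s) \<le> (k powr (1 / (2 * s))) powr (2 * s)"
    using s e by (intro powr_mono2) (auto simp: e_def)
  also have "\<dots> = k" using s k by (simp add: powr_powr)
  finally have ek: "e powr (2 * s) * H \<le> d\<^sup>2 * g0"
  proof -
    assume "e powr (2 * s) \<le> k"
    then have "e powr (2 * s) * H \<le> k * H" using H by (intro mult_right_mono)
    also have "\<dots> = (d\<^sup>2 * g0) * (H / (H + 1))" by (simp add: k_def)
    also have "\<dots> \<le> (d\<^sup>2 * g0) * 1" using H d g0 by (intro mult_left_mono) auto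
    finally show ?thesis by simp
  qed
  define h where "h = (\<lambda>\<zeta>. (cmod (fourier_L1 (wave t e) \<zeta>))\<^sup>2)"
  have [measurable]: "h \<in> borel_measurable borel"
    unfolding h_def using L2D[OF wave_fourier(1)[OF e(1)]] by measurable
  have h_aff: "h (t + e *\<^sub>R y) = inverse e ^ 2 * exp (- y\<^sup>2)" for y
  proof -
    have "norm (inverse e *\<^sub>R (t + e *\<^sub>R y - t)) = \<bar>y\<bar>"
      using e(1) by (simp add: mult.assoc[symmetric])
    then have "h (t + e *\<^sub>R y) = (inverse e * exp (- y\<^sup>2 / 2))\<^sup>2"
      unfolding h_def wave_fourier(3)[OF e(1)] norm_of_real by (simp only: power2_abs)
    also have "\<dots> = inverse e ^ 2 * (exp (- y\<^sup>2 / 2) * exp (- y\<^sup>2 / 2))" by (simp only: power2_eq_square mult_ac)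
    also have "exp (- y\<^sup>2 / 2) * exp (- y\<^sup>2 / 2) = exp (- y\<^sup>2)" unfolding exp_add[symmetric] by simp
    finally show ?thesis .
  qed
  have "(L2_norm (wave t e))\<^sup>2 = (\<integral>\<zeta>. h \<zeta> \<partial>lborel)"
    unfolding h_def L2_norm_sq[symmetric] plancherel_L1_L2(2)[OF wave_fourier(1,2)[OF e(1)]] ..
  also have "\<dots> = \<bar>e\<bar> ^ DIM(real) *\<^sub>R (\<integral>y. h (t + e *\<^sub>R y) \<partial>lborel)"
    using e(1) by (intro integral_lborel_affine) auto
  also have "\<dots> = inverse e * g0"
    unfolding h_aff integral_mult_right_zero g0_def[symmetric] using e(1) by (simp add: power2_eq_square)
  finally have norm: "(L2_norm (wave t e))\<^sup>2 = inverse e * g0" .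
  let ?B = "\<lambda>\<zeta>. \<bar>\<zeta>\<^sup>2 - t\<^sup>2\<bar> powr (2 * s) * h \<zeta>"
  have pt: "?B (t + e *\<^sub>R y) \<le> inverse e ^ 2 * e powr (2 * s) * g y" for y
  proof -
    have "\<bar>(t + e *\<^sub>R y)\<^sup>2 - t\<^sup>2\<bar> = e * (\<bar>y\<bar> * \<bar>2 * t + e * y\<bar>)"
      using e(1) by (simp add: power2_eq_square algebra_simps flip: abs_mult) (simp add: abs_mult flip: distrib_left)
    also have "\<dots> \<le> e * (\<bar>y\<bar> * (2 * \<bar>t\<bar> + \<bar>y\<bar>))"
    proof (intro mult_left_mono)
      have "\<bar>2 * t + e * y\<bar> \<le> 2 * \<bar>t\<bar> + e * \<bar>y\<bar>"
        using abs_triangle_ineq[of "2 * t" "e * y"] e(1) by (simp add: abs_mult)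
      also have "e * \<bar>y\<bar> \<le> 1 * \<bar>y\<bar>" using e(2) by (intro mult_right_mono) auto
      finally show "\<bar>2 * t + e * y\<bar> \<le> 2 * \<bar>t\<bar> + \<bar>y\<bar>" by simp
    qed (use e(1) in auto)
    finally have "\<bar>(t + e *\<^sub>R y)\<^sup>2 - t\<^sup>2\<bar> powr (2 * s) \<le> (e * (\<bar>y\<bar> * (2 * \<bar>t\<bar> + \<bar>y\<bar>))) powr (2 * s)"
      using s by (intro powr_mono2) auto
    also have "\<dots> = e powr (2 * s) * m y" using e(1) by (simp add: powr_mult m_def)
    finally have "?B (t + e *\<^sub>R y) \<le> (e powr (2 * s) * m y) * (inverse e ^ 2 * exp (- y\<^sup>2))"
      unfolding h_aff by (intro mult_right_mono) auto
    then show ?thesis by (simp only: g_def mult_ac)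
  qed
  have B0: "0 \<le> ?B \<zeta>" for \<zeta> by (simp add: h_def)
  have B_int': "integrable lborel (\<lambda>y. ?B (t + e *\<^sub>R y))"
  proof (rule Bochner_Integration.integrable_bound)
    show "integrable lborel (\<lambda>y. inverse e ^ 2 * e powr (2 * s) * g y)" by (intro integrable_mult_right g_int)
    show "AE y in lborel. norm (?B (t + e *\<^sub>R y)) \<le> norm (inverse e ^ 2 * e powr (2 * s) * g y)"
    proof (intro always_eventually allI)
      fix y show "norm (?B (t + e *\<^sub>R y)) \<le> norm (inverse e ^ 2 * e powr (2 * s) * g y)"
        unfolding real_norm_def using pt[of y] B0[of "t + e *\<^sub>R y"] by linarith
    qed
  qed measurable
  have B_int: "integrable lborel ?B"
    using B_int' e(1) by (subst integrable_lborel_affine_iff[of _ e t]) auto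
  have "(\<integral>\<zeta>. ?B \<zeta> \<partial>lborel) = \<bar>e\<bar> ^ DIM(real) *\<^sub>R (\<integral>y. ?B (t + e *\<^sub>R y) \<partial>lborel)"
    using e(1) by (intro integral_lborel_affine) auto
  also have "\<dots> \<le> \<bar>e\<bar> ^ DIM(real) *\<^sub>R (\<integral>y. inverse e ^ 2 * e powr (2 * s) * g y \<partial>lborel)"
    by (intro scaleR_left_mono integral_mono B_int' pt integrable_mult_right g_int) auto
  also have "\<dots> = inverse e * (e powr (2 * s) * H)" using e(1) by (simp add: H_def power2_eq_square)
  also have "\<dots> \<le> inverse e * (d\<^sup>2 * g0)" using e(1) by (intro mult_left_mono ek) auto
  also have "\<dots> = (d * L2_norm (wave t e))\<^sup>2" unfolding power_mult_distrib norm by simp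
  finally have B_le: "(\<integral>\<zeta>. ?B \<zeta> \<partial>lborel) \<le> (d * L2_norm (wave t e))\<^sup>2" .
  have "L2_norm (wave t e) \<noteq> 0" using norm e(1) g0 by auto
  then have "L2_norm (wave t e) > 0" using L2_norm_nonneg[of "wave t e"] by linarith
  then show thesis using e(1) B_int B_le that unfolding h_def by blast
qed

text \<open>The support condition restricts the cross-section variable only, so the minimiser times
  a Gaussian wave lies in the form domain of the cylinder and has an explicit transform.\<close>

theorem cylinder_weyl:
  fixes S :: "'a::euclidean_space set"
  assumes s: "0 < s" "s < 1" and S: "S \<in> sets borel" "bounded S" and ex: "\<exists>u\<in>form_dom s S. L2_norm u \<noteq> 0"
    and d: "d > 0"
  shows "\<exists>w\<in>form_dom s (S \<times> (UNIV :: real set)). L2_norm w > 0 \<and> (\<forall>v\<in>form_dom s (S \<times> UNIV).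
      cmod (wform (pw s) w v - complex_of_real (bottom s S t) * L2_inner w v) \<le> d * L2_norm w * L2_norm v)"
proof -
  have s1: "s \<le> 1" using s by simp
  obtain \<phi> where \<phi>: "\<phi> \<in> form_dom s S" "L2_norm \<phi> = 1" "wquad (symb s t) \<phi> = bottom s S t"
    by (rule bottom_attained[OF s(1) s1 S ex])
  obtain e where e: "e > 0" "L2_norm (wave t e) > 0"
    and B: "integrable lborel (\<lambda>\<zeta>. \<bar>\<zeta>\<^sup>2 - t\<^sup>2\<bar> powr (2 * s) * (cmod (fourier_L1 (wave t e) \<zeta>))\<^sup>2)"
    "(\<integral>\<zeta>. \<bar>\<zeta>\<^sup>2 - t\<^sup>2\<bar> powr (2 * s) * (cmod (fourier_L1 (wave t e) \<zeta>))\<^sup>2 \<partial>lborel) \<le> (d * L2_norm (wave t e))\<^sup>2"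
    by (rule wave_concentrates[OF s d])
  define \<psi> where "\<psi> = wave t e"
  note \<psi> = wave_fourier(1,2)[OF e(1), of t, folded \<psi>_def]
  define h where "h = (\<lambda>\<zeta>. (cmod (fourier_L1 \<psi> \<zeta>))\<^sup>2)"
  define w where "w = tensor \<phi> \<psi>"
  note w = tensor_L2_on[OF form_dom_L2_on[OF \<phi>(1)] S \<psi>, folded w_def]
  note wL = L2_onD[OF w(1)]
  have wn: "L2_norm w = L2_norm \<psi>" using w(4) \<phi>(2) by simp
  note [measurable] = L2D[OF wL] L2D[OF FT_L2[OF wL]]
  have FTw: "AE p in lborel. (cmod (FT w p))\<^sup>2 = (cmod (FT \<phi> (fst p)))\<^sup>2 * h (snd p)"
    using w(3) by eventually_elim (simp add: norm_mult power_mult_distrib h_def)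
  have h_int: "integrable lborel h" unfolding h_def by (intro L2_integrable plancherel_L1_L2 \<psi>)
  have h_val: "(\<integral>\<zeta>. h \<zeta> \<partial>lborel) = (L2_norm \<psi>)\<^sup>2"
    unfolding h_def L2_norm_sq[symmetric] plancherel_L1_L2(2)[OF \<psi>] ..
  have \<phi>_int: "integrable lborel (\<lambda>\<xi>. (cmod (FT \<phi> \<xi>))\<^sup>2)" by (intro L2_integrable FT_L2 form_dom_L2[OF \<phi>(1)])
  have \<phi>_val: "(\<integral>\<xi>. (cmod (FT \<phi> \<xi>))\<^sup>2 \<partial>lborel) = 1"
    using L2_norm_sq[of "FT \<phi>"] FT_norm[OF form_dom_L2[OF \<phi>(1)]] \<phi>(2) by simp
  have fst_m: "(\<lambda>p :: 'a \<times> real. fst p) \<in> borel_measurable borel" and snd_m: "(\<lambda>p :: 'a \<times> real. snd p) \<in> borel_measurable borel"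
    by (auto intro!: borel_measurable_continuous_onI continuous_intros)
  have hm: "h \<in> borel_measurable borel" using h_int by auto
  note [measurable] = measurable_compose[OF snd_m hm] measurable_compose[OF fst_m L2D[OF FT_L2[OF form_dom_L2[OF \<phi>(1)]]]] fst_m snd_m hm
    L2D[OF FT_L2[OF form_dom_L2[OF \<phi>(1)]]]
  have hB: "integrable lborel (\<lambda>\<zeta>. \<bar>\<zeta>\<^sup>2 - t\<^sup>2\<bar> powr (2 * s) * h \<zeta>)" using B(1) by (simp add: h_def \<psi>_def)
  have h0: "0 \<le> h \<zeta>" for \<zeta> by (simp add: h_def)
  have norm_p: "norm p powr (2 * s) = ((norm (fst p))\<^sup>2 + (snd p)\<^sup>2) powr s" for p :: "'a \<times> real"
    unfolding norm_sq_powr[symmetric] by (simp add: norm_prod_def)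
  have wd: "w \<in> form_dom s (S \<times> UNIV)"
  proof -
    have h2: "integrable lborel (\<lambda>\<zeta>. (1 + (t\<^sup>2) powr s) * h \<zeta> + \<bar>\<zeta>\<^sup>2 - t\<^sup>2\<bar> powr (2 * s) * h \<zeta>)"
      by (intro Bochner_Integration.integrable_add integrable_mult_right h_int hB)
    have "integrable lborel (\<lambda>p. norm p powr (2 * s) * (cmod (FT w p))\<^sup>2)"
    proof (rule Bochner_Integration.integrable_bound)
      show "integrable lborel (\<lambda>p. (norm (fst p) powr (2 * s) * (cmod (FT \<phi> (fst p)))\<^sup>2) * h (snd p)
         + (cmod (FT \<phi> (fst p)))\<^sup>2 * ((1 + (t\<^sup>2) powr s) * h (snd p) + \<bar>(snd p)\<^sup>2 - t\<^sup>2\<bar> powr (2 * s) * h (snd p)))"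
        by (intro Bochner_Integration.integrable_add integral_fst_snd(1)[OF _ h_int] integral_fst_snd(1)[OF \<phi>_int h2]
            form_dom_integrable[OF \<phi>(1) admissible_pw])
      show "AE p in lborel. norm (norm p powr (2 * s) * (cmod (FT w p))\<^sup>2)
         \<le> norm ((norm (fst p) powr (2 * s) * (cmod (FT \<phi> (fst p)))\<^sup>2) * h (snd p)
         + (cmod (FT \<phi> (fst p)))\<^sup>2 * ((1 + (t\<^sup>2) powr s) * h (snd p) + \<bar>(snd p)\<^sup>2 - t\<^sup>2\<bar> powr (2 * s) * h (snd p)))"
        using FTw
      proof eventually_elim
        case (elim p)
        let ?x = "norm (fst p) powr (2 * s)" and ?a = "\<bar>(snd p)\<^sup>2 - t\<^sup>2\<bar>"
        \<comment> \<open>Subadditivity, used twice, bounds the symbol by |\<xi>|^(2s), a constant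
          and \<open>?a powr (2 * s)\<close>; each of these weights has a finite integral against
          the product.\<close>
        have "norm p powr (2 * s) \<le> ?x + ((snd p)\<^sup>2) powr s"
          using powr_add_le[of "(norm (fst p))\<^sup>2" "(snd p)\<^sup>2" s] s unfolding norm_p by (simp add: norm_sq_powr)
        also have "((snd p)\<^sup>2) powr s \<le> ?a powr s + (t\<^sup>2) powr s"
        proof -
          have "((snd p)\<^sup>2) powr s \<le> (?a + t\<^sup>2) powr s" using s by (intro powr_mono2) auto
          also have "\<dots> \<le> ?a powr s + (t\<^sup>2) powr s" using s by (intro powr_add_le) auto
          finally show ?thesis .
        qed
        also have "?a powr s \<le> 1 + ?a powr (2 * s)"
        proof (cases "?a \<le> 1")
          case True
          then have "?a powr s \<le> 1" using s by (intro powr_le1) auto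
          then show ?thesis by (simp add: add_increasing2)
        next
          case False
          then have "?a powr s \<le> ?a powr (2 * s)" using s by (intro powr_mono) auto
          then show ?thesis by simp
        qed
        finally have "norm p powr (2 * s) \<le> ?x + ((1 + (t\<^sup>2) powr s) + ?a powr (2 * s))" by simp
        from mult_right_mono[OF this, of "(cmod (FT \<phi> (fst p)))\<^sup>2 * h (snd p)"]
        have "norm p powr (2 * s) * (cmod (FT w p))\<^sup>2 \<le> (?x * (cmod (FT \<phi> (fst p)))\<^sup>2) * h (snd p)
           + (cmod (FT \<phi> (fst p)))\<^sup>2 * ((1 + (t\<^sup>2) powr s) * h (snd p) + ?a powr (2 * s) * h (snd p))"
          unfolding elim using h0[of "snd p"] by (simp add: algebra_simps)
        then show ?case by (simp add: abs_mult)
      qed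
    qed measurable
    then show ?thesis using w(1) by (simp add: form_dom_iff)
  qed
  let ?\<mu> = "bottom s S t"
  let ?W = "\<lambda>p :: 'a \<times> real. symb s t (fst p)" and ?p = "\<lambda>p :: 'a \<times> real. norm p powr (2 * s)"
  note Wadm = admissible_symb_fst[OF s(1) s1, of t, where 'a='a]
  \<comment> \<open>\<open>?W\<close> is independent of the last frequency, so the energy of the
    product factors and \<open>w\<close> attains equality in \<open>cylinder_bound\<close>.\<close>
  have "wquad ?W w = (\<integral>p. (symb s t (fst p) * (cmod (FT \<phi> (fst p)))\<^sup>2) * h (snd p) \<partial>lborel)"
    unfolding wquad_def using FTw admissible_measurable[OF Wadm]
    by (intro integral_cong_AE) (auto elim!: eventually_mono)
  also have "\<dots> = wquad (symb s t) \<phi> * (L2_norm \<psi>)\<^sup>2"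
    unfolding integral_fst_snd(2)[OF form_dom_integrable[OF \<phi>(1) admissible_symb[OF s(1) s1]] h_int] by (simp add: wquad_def h_val)
  finally have Ww: "wquad ?W w = ?\<mu> * (L2_norm w)\<^sup>2" by (simp add: \<phi>(3) wn)
  interpret B: semi_inner "form_dom s (S \<times> (UNIV :: real set))" "wform (\<lambda>p. ?W p - ?\<mu>)"
  proof (rule semi_inner_form_dom)
    show "admissible s (\<lambda>p. ?W p - ?\<mu>)" by (intro admissible_diff Wadm admissible_const)
    show "0 \<le> wquad (\<lambda>p. ?W p - ?\<mu>) u" if "u \<in> form_dom s (S \<times> (UNIV :: real set))" for u
      using cylinder_bound[OF s(1) s1 S ex that, of t] wquad_diff[OF that Wadm admissible_const, of ?\<mu>]
      by (simp add: wquad_const form_dom_L2[OF that])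
  qed
  have "(B.nrm w)\<^sup>2 = 0"
    using B.nrm_sq[OF wd] wquad_diff[OF wd Wadm admissible_const, of ?\<mu>] Ww
    by (simp add: wform_self wquad_const wL)
  then have B0: "wform (\<lambda>p. ?W p - ?\<mu>) w v = 0" if "v \<in> form_dom s (S \<times> UNIV)" for v
    using B.Cauchy_Schwarz[OF wd that] by simp
  let ?D = "\<lambda>p. ?p p - ?W p"
  have Dadm: "admissible s ?D" by (intro admissible_diff admissible_pw Wadm)
  \<comment> \<open>The two arguments of the power share the term |\<xi>|^2, so the Hoelder bound
    depends on the last frequency alone.\<close>
  have D_le: "(?D p)\<^sup>2 \<le> \<bar>(snd p)\<^sup>2 - t\<^sup>2\<bar> powr (2 * s)" for p
  proof -
    have "\<bar>?D p\<bar> \<le> \<bar>(snd p)\<^sup>2 - t\<^sup>2\<bar> powr s"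
      unfolding norm_p symb_def using abs_powr_diff_le[of "(norm (fst p))\<^sup>2 + (snd p)\<^sup>2" "(norm (fst p))\<^sup>2 + t\<^sup>2" s] s by simp
    then have "\<bar>?D p\<bar>\<^sup>2 \<le> (\<bar>(snd p)\<^sup>2 - t\<^sup>2\<bar> powr s)\<^sup>2" by (intro power_mono) auto
    also have "\<dots> = \<bar>(snd p)\<^sup>2 - t\<^sup>2\<bar> powr (2 * s)"
      by (simp add: power2_eq_square[of "_ powr s"] powr_add[symmetric])
    finally show ?thesis by simp
  qed
  define Dw where "Dw = (\<lambda>p. complex_of_real (?D p) * FT w p)"
  have [measurable]: "Dw \<in> borel_measurable borel" unfolding Dw_def using admissible_measurable[OF Dadm] by measurable
  note prod = integral_fst_snd[OF \<phi>_int hB]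
  have Dw_le: "AE p in lborel. (cmod (Dw p))\<^sup>2 \<le> (cmod (FT \<phi> (fst p)))\<^sup>2 * (\<bar>(snd p)\<^sup>2 - t\<^sup>2\<bar> powr (2 * s) * h (snd p))"
    using FTw
  proof eventually_elim
    case (elim p)
    have "(cmod (Dw p))\<^sup>2 = (?D p)\<^sup>2 * ((cmod (FT \<phi> (fst p)))\<^sup>2 * h (snd p))"
      unfolding Dw_def norm_mult power_mult_distrib elim norm_of_real power2_abs ..
    also have "\<dots> \<le> \<bar>(snd p)\<^sup>2 - t\<^sup>2\<bar> powr (2 * s) * ((cmod (FT \<phi> (fst p)))\<^sup>2 * h (snd p))"
      using h0 by (intro mult_right_mono D_le) auto
    finally show ?case by (simp only: mult_ac)
  qed
  have Dw_int: "integrable lborel (\<lambda>p. (cmod (Dw p))\<^sup>2)"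
    by (rule Bochner_Integration.integrable_bound[OF prod(1)])
      (use Dw_le in \<open>auto elim!: eventually_mono\<close>)
  then have DwL: "Dw \<in> L2" by (simp add: L2_def)
  have "(L2_norm Dw)\<^sup>2 \<le> (\<integral>\<zeta>. \<bar>\<zeta>\<^sup>2 - t\<^sup>2\<bar> powr (2 * s) * h \<zeta> \<partial>lborel)"
    using integral_mono_AE[OF Dw_int prod(1) Dw_le] unfolding prod(2) by (simp add: L2_norm_sq \<phi>_val)
  also have "\<dots> \<le> (d * L2_norm w)\<^sup>2" using B(2) by (simp add: h_def \<psi>_def wn)
  finally have DwN: "L2_norm Dw \<le> d * L2_norm w" using d by (auto intro: power2_le_imp_le)
  show ?thesis
  proof (intro bexI[OF _ wd] conjI ballI)
    show "L2_norm w > 0" using e(2) by (simp add: wn \<psi>_def)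
    fix v assume v: "v \<in> form_dom s (S \<times> (UNIV :: real set))"
    note vL = form_dom_L2[OF v]
    have "wform ?p w v = wform (\<lambda>p. ?D p + ?W p) w v" by simp
    also have "\<dots> = wform ?D w v + wform ?W w v" by (rule wform_add[OF wd v Dadm Wadm])
    finally have "wform ?p w v - complex_of_real ?\<mu> * L2_inner w v = wform ?D w v"
      using wform_diff[OF wd v Wadm admissible_const, of ?\<mu>] B0[OF v] by (simp add: wform_const wL vL)
    \<comment> \<open>The whole error symbol is attached to the transform of \<open>w\<close>, so
      that \<open>v\<close> enters through its L2 norm and not through its energy.\<close>
    also have "\<dots> = L2_inner Dw (FT v)" by (simp add: wform_def L2_inner_def Dw_def)
    finally have "cmod (wform ?p w v - complex_of_real ?\<mu> * L2_inner w v) \<le> L2_norm Dw * L2_norm v"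
      using L2.Cauchy_Schwarz[OF DwL FT_L2[OF vL]] by (simp add: L2_nrm_eq FT_norm vL)
    also have "\<dots> \<le> d * L2_norm w * L2_norm v" by (intro mult_right_mono DwN) auto
    finally show "cmod (wform ?p w v - complex_of_real ?\<mu> * L2_inner w v) \<le> d * L2_norm w * L2_norm v" .
  qed
qed

section \<open>Spectrum and essential spectrum of the cylinder operator\<close>

theorem theorem1:
  fixes s :: real and \<omega> :: "'a::euclidean_space set" and \<Lambda> :: real
  assumes "0 < s" and "s < 1"
    and "open \<omega>" and "connected \<omega>" and "bounded \<omega>" and "\<omega> \<noteq> {}"
    and "complex_of_real \<Lambda> \<in> op_eigenvalues (frac_op s \<omega>)"
    and "\<forall>\<mu> \<in> op_eigenvalues (frac_op s \<omega>). \<Lambda> \<le> Re \<mu>"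
  shows "op_spectrum (L2_on (\<omega> \<times> (UNIV :: real set))) (frac_op s (\<omega> \<times> (UNIV :: real set)))
           = complex_of_real ` {\<Lambda>..}
       \<and> op_ess_spectrum (L2_on (\<omega> \<times> (UNIV :: real set))) (frac_op s (\<omega> \<times> (UNIV :: real set)))
           = complex_of_real ` {\<Lambda>..}"
proof -
  note s = assms(1,2)
  have s1: "s \<le> 1" using s by simp
  have S: "\<omega> \<in> sets borel" "bounded \<omega>" using assms by auto
  let ?Q = "\<omega> \<times> (UNIV :: real set)"
  let ?A = "frac_op s ?Q"
  obtain u where u: "frac_op s \<omega> u (\<lambda>x. complex_of_real \<Lambda> * u x)" "\<not> (AE x in lborel. u x = 0)"
    using assms(7) by (auto simp: op_eigenvalues_def eigenspace_op_def)
  have ud: "u \<in> form_dom s \<omega>" using u by (simp add: frac_op_iff)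
  have un: "L2_norm u \<noteq> 0" using u(2) L2_norm_eq_0_iff[OF form_dom_L2[OF ud]] by simp
  \<comment> \<open>The given eigenfunction makes the form domain nontrivial, so the infima in
    \<open>bottom\<close> are over nonempty sets.\<close>
  have ex: "\<exists>u\<in>form_dom s \<omega>. L2_norm u \<noteq> 0" using ud un by blast
  \<comment> \<open>The eigenfunction for \<open>\<Lambda>\<close> is a trial function for the
    infimum; conversely the minimiser is an eigenfunction, and \<open>\<Lambda>\<close> is minimal
    among eigenvalues.\<close>
  have bottom: "bottom s \<omega> 0 = \<Lambda>"
  proof (rule antisym)
    have "complex_of_real (wquad (symb s 0) u) = complex_of_real (\<Lambda> * (L2_norm u)\<^sup>2)"
      using frac_op_self[OF u(1)] L2.B_scale[OF form_dom_L2[OF ud] form_dom_L2[OF ud], of "complex_of_real \<Lambda>"] L2.B_self[OF form_dom_L2[OF ud]]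
      by (simp add: symb_0 L2_nrm_eq)
    then have "wquad (symb s 0) u = \<Lambda> * (L2_norm u)\<^sup>2" by (simp only: of_real_eq_iff)
    then have "bottom s \<omega> 0 * (L2_norm u)\<^sup>2 \<le> \<Lambda> * (L2_norm u)\<^sup>2"
      using bottom_le[OF s(1) s1 ud, of 0] by simp
    then show "bottom s \<omega> 0 \<le> \<Lambda>" using un by simp
    obtain \<phi> where \<phi>: "\<phi> \<in> form_dom s \<omega>" "L2_norm \<phi> = 1" "wquad (symb s 0) \<phi> = bottom s \<omega> 0"
      by (rule bottom_attained[OF s(1) s1 S ex])
    have "frac_op s \<omega> \<phi> (\<lambda>x. complex_of_real (bottom s \<omega> 0) * \<phi> x)"
      unfolding frac_op_iff
    proof (intro conjI ballI \<phi> L2_on_scale form_dom_L2_on[OF \<phi>(1)])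
      fix v assume v: "v \<in> form_dom s \<omega>"
      show "wform (pw s) \<phi> v = L2_inner (\<lambda>x. complex_of_real (bottom s \<omega> 0) * \<phi> x) v"
        using bottom_eigen[OF s(1) s1 \<phi> v] L2.B_scale[OF form_dom_L2[OF \<phi>(1)] form_dom_L2[OF v]] by (simp add: symb_0)
    qed
    moreover have "\<not> (AE x in lborel. \<phi> x = 0)"
      using \<phi>(2) L2_norm_eq_0_iff[OF form_dom_L2[OF \<phi>(1)]] by simp
    ultimately have "complex_of_real (bottom s \<omega> 0) \<in> op_eigenvalues (frac_op s \<omega>)"
      by (auto simp: op_eigenvalues_def eigenspace_op_def)
    then show "\<Lambda> \<le> bottom s \<omega> 0" using assms(8) by force
  qed
  \<comment> \<open>Dropping the last frequency only lowers the symbol, and the rest is the cylinder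
    bound at t = 0.\<close>
  have low: "\<Lambda> * (L2_norm v)\<^sup>2 \<le> wquad (pw s) v" if v: "v \<in> form_dom s ?Q" for v
  proof -
    have "\<Lambda> * (L2_norm v)\<^sup>2 \<le> wquad (\<lambda>p. symb s 0 (fst p)) v"
      using cylinder_bound[OF s(1) s1 S ex v, of 0] by (simp add: bottom)
    also have "\<dots> \<le> wquad (pw s) v"
    proof (rule wquad_mono[OF v admissible_symb_fst[OF s(1) s1] admissible_pw])
      show "symb s 0 (fst p) \<le> norm p powr (2 * s)" for p :: "'a \<times> real"
        unfolding symb_0 using s norm_fst_le[of "fst p" "snd p"] by (intro powr_mono2) auto
    qed
    finally show ?thesis .
  qed
  have spec: "op_spectrum (L2_on ?Q) ?A = complex_of_real ` {\<Lambda>..}"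
  proof (intro equalityI subsetI)
    fix z assume "z \<in> op_spectrum (L2_on ?Q) ?A"
    then show "z \<in> complex_of_real ` {\<Lambda>..}"
      using resolvent_off_ray[of s ?Q \<Lambda> z, OF low] by (auto simp: op_spectrum_def)
  next
    fix z assume "z \<in> complex_of_real ` {\<Lambda>..}"
    then obtain \<mu> where \<mu>: "z = complex_of_real \<mu>" "bottom s \<omega> 0 \<le> \<mu>" by (auto simp: bottom)
    obtain t where t: "bottom s \<omega> t = \<mu>" by (rule bottom_surj[OF s(1) s1 S ex \<mu>(2)])
    have "complex_of_real \<mu> \<notin> op_resolvent_set (L2_on ?Q) ?A"
      by (rule not_resolvent_of_approximate_eigenvector)
        (rule cylinder_weyl[OF s S ex, of _ t, unfolded t])
    then show "z \<in> op_spectrum (L2_on ?Q) ?A" by (simp add: op_spectrum_def \<mu>(1))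
  qed
  have "z \<notin> op_disc_spectrum (L2_on ?Q) ?A" if "z \<in> complex_of_real ` {\<Lambda>..}" for z
  proof
    assume "z \<in> op_disc_spectrum (L2_on ?Q) ?A"
    then obtain e where e: "e > 0" and iso: "\<And>\<mu>. \<mu> \<in> op_spectrum (L2_on ?Q) ?A \<Longrightarrow> cmod (\<mu> - z) < e \<Longrightarrow> \<mu> = z"
      unfolding op_disc_spectrum_def by blast
    obtain r where r: "z = complex_of_real r" "\<Lambda> \<le> r" using \<open>z \<in> complex_of_real ` {\<Lambda>..}\<close> by auto
    \<comment> \<open>The neighbouring spectral point is taken to the right of \<open>r\<close>, so
      that the endpoint \<open>\<Lambda>\<close> is covered as well.\<close>
    have "complex_of_real (r + e / 2) = z"
    proof (rule iso)
      show "complex_of_real (r + e / 2) \<in> op_spectrum (L2_on ?Q) ?A"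
        unfolding spec using r(2) e by (intro imageI) auto
      show "cmod (complex_of_real (r + e / 2) - z) < e"
        unfolding r(1) of_real_diff[symmetric] norm_of_real using e by simp
    qed
    then show False using e unfolding r(1) of_real_eq_iff by simp
  qed
  then have "op_ess_spectrum (L2_on ?Q) ?A = complex_of_real ` {\<Lambda>..}"
    unfolding op_ess_spectrum_def spec by blast
  with spec show ?thesis by blast
qed

end
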